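(* Let $h:\mathbb{R}^2\to[0,1]$ and $C:\mathbb{R}^2\times\mathbb{R}^2\to\mathbb{R}_+$ satisfy: (1) $h$ is a $\beta$-Hölder function, with $a=\inf_{x\in\mathbb{R}^2}h(x)>0$, $b=\sup_{x\in\mathbb{R}^2}h(x)<1$ and $b<\beta\le1$; (2) $(x,\xi)\mapsto C(x,\xi)$ is bounded: there is $M$ with $C(x,\xi)\le M$ for all $(x,\xi)\in\mathbb{R}^2\times\mathbb{R}^2$; (3) $\xi\mapsto C(x,\xi)$ is even and homogeneous of degree $0$: $C(x,\rho\xi)=C(x,\xi)$ for all $\rho>0$; (4) $x\mapsto C(x,\xi)$ is continuous, and there exists $\eta$ with $b<\eta\le1$ such that for all $x\in\mathbb{R}^2$, $$\sup_{z\in B(0,1)}\|z\|^{-2\eta}\int_{\mathbb{S}^1}\big[C(x+z,\Theta)-C(x,\Theta)\big]^2\,d\Theta\le A_x<\infty,$$ where moreover $x\mapsto A_x$ is bounded on any compact subset of $\mathbb{R}^2$. Let $X$ be the Generalized Anisotropic Fractional Brownian Field (GAFBF) $$X(x)=\int_{\mathbb{R}^2}(e^{\mathrm{j}\langle x,\xi\rangle}-1)\frac{C(x,\xi)}{\|\xi\|^{h(x)+1}}\,\widehat{\mathbf{W}}(d\xi),\qquad x\in\mathbb{R}^2.$$ Then at any point $x_0\in\mathbb{R}^2$, $X$ admits a tangent field $Y_{x_0}$ given by $$Y_{x_0}(x)=\int_{\mathbb{R}^2}(e^{\mathrm{j}\langle x,\xi\rangle}-1)f^{1/2}(x_0,\xi)\,\widehat{\mathbf{W}}(d\xi)=\int_{\mathbb{R}^2}(e^{\mathrm{j}\langle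 x,\xi\rangle}-1)\frac{C(x_0,\xi)}{\|\xi\|^{h(x_0)+1}}\,\widehat{\mathbf{W}}(d\xi),$$ where $f^{1/2}(x,\xi)=C(x,\xi)/\|\xi\|^{h(x)+1}$. In particular, for each point $x_0$, the local anisotropy function of the Gaussian field $X$ at $x_0$ is $$C_{x_0}:\Theta\mapsto C(x_0,\Theta)^2.$$
   Context: $\mathrm{j}$ is the imaginary unit, $\mathbb{S}^1$ the unit circle of $\mathbb{R}^2$ with arc length $d\Theta$, $B(0,1)$ the unit ball. $\widehat{\mathbf{W}}$ is a complex-valued Gaussian white noise on $\mathbb{R}^2$ (Fourier transform of a real white noise), so that $\mathbb{E}\big[\int g_1\,d\widehat{\mathbf{W}}\;\overline{\int g_2\,d\widehat{\mathbf{W}}}\big]=\int_{\mathbb{R}^2} g_1\overline{g_2}\,d\xi$ for square-integrable $g_1,g_2$ with $g_i(-\xi)=\overline{g_i(\xi)}$. $h$ is $\beta$-Hölder if $|h(x)-h(y)|\le\Lambda_h\|x-y\|^\beta$ for all $x,y$ and some constant $\Lambda_h$. For $H\in(0,1)$, a random field $Y=\{Y(x),x\in\mathbb{R}^2\}$ is $H$-localizable at $x_0\in\mathbb{R}^2$ with tangent field the non-trivial random field $Y_{x_0}=\{Y_{x_0}(x),x\in\mathbb{R}^2\}$ if $$\left\{\frac{Y(x_0+\rho u)-Y(x_0)}{\rho^H}\right\}_{u\in\mathbb{R}^2}\xrightarrow{\ d\ }\{Y_{x_0}(u)\}_{u\in\mathbb{R}^2}\quad\text{as }\rho\to0,$$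 where $\xrightarrow{d}$ means convergence in distribution, that is, weak convergence for stochastic processes. A field admits a tangent field at $x_0$ if it is $H$-localizable at $x_0$ for some $H\in(0,1)$. If the tangent field $Y_{x_0}$ is an $H$-self-similar Gaussian field with stationary increments having spectral density $f$, i.e. $\mathbb{E}[Y_{x_0}(x)Y_{x_0}(y)]=\int_{\mathbb{R}^2}(e^{\mathrm{j}\langle x,\xi\rangle}-1)(e^{-\mathrm{j}\langle y,\xi\rangle}-1)f(\xi)\,d\xi$, then $f(\xi)=\|\xi\|^{-2H-2}C_{x_0}(\xi/\|\xi\|)$; the function $C_{x_0}$ on $\mathbb{S}^1$ (the anisotropy function of $Y_{x_0}$) is called the local anisotropy function at $x_0$ of the localizable field.
   Formalization: Since a tangent field must be non-trivial and C(x_0,.) may vanish (e.g. C = 0), localizability and the local anisotropy function are claimed only where C(x_0,.) is not a.e. zero; the convergence to Y_{x_0} and the anisotropy function of Y_{x_0} are proved at every x_0. *)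

theory Defs
  imports "HOL-Probability.Probability"
begin

section \<open>Gaussian processes and the white noise\<close>

text \<open>Constants count as (degenerate) Gaussian variables.\<close>

definition gaussian_rv :: "'w measure \<Rightarrow> ('w \<Rightarrow> real) \<Rightarrow> bool" where
  "gaussian_rv P Z \<longleftrightarrow> Z \<in> borel_measurable P \<and>
     ((\<exists>\<mu> \<sigma>. \<sigma> > 0 \<and> distributed P lborel Z (normal_density \<mu> \<sigma>)) \<or> (\<exists>\<mu>. AE \<omega> in P. Z \<omega> = \<mu>))"

definition gaussian_process :: "'w measure \<Rightarrow> 'i set \<Rightarrow> ('i \<Rightarrow> 'w \<Rightarrow> real) \<Rightarrow> bool" where
  "gaussian_process P I Z \<longleftrightarrow>
     (\<forall>J c. finite J \<and> J \<subseteq> I \<longrightarrow> gaussian_rv P (\<lambda>\<omega>. \<Sum>j\<in>J. c j * Z j \<omega>))"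

definition hermitian_L2 :: "(real ^ 2 \<Rightarrow> complex) set" where
  "hermitian_L2 = {g. g \<in> borel_measurable borel \<and> integrable lborel (\<lambda>\<xi>. (cmod (g \<xi>))\<^sup>2) \<and>
     (\<forall>\<xi>. g (- \<xi>) = cnj (g \<xi>))}"

text \<open>The white noise is represented by its stochastic integral: \<open>W g\<close> is the integral of \<open>g\<close>
  against the Fourier transform of a real white noise, i.e. \<open>W\<close> is an isonormal Gaussian process
  indexed by the square-integrable Hermitian functions. On such functions the integral is
  real-valued, so no conjugate is needed on the left-hand side of the isometry. Nothing is assumed
  about \<open>W g\<close> for other functions \<open>g\<close>.\<close>

locale fourier_white_noise = prob_space P
  for P :: "'w measure" +
  fixes W :: "(real ^ 2 \<Rightarrow> complex) \<Rightarrow> 'w \<Rightarrow> real"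
  assumes gaussian: "gaussian_process P hermitian_L2 W"
    and centered: "\<And>g. g \<in> hermitian_L2 \<Longrightarrow> expectation (W g) = 0"
    and isometry: "\<And>g\<^sub>1 g\<^sub>2. g\<^sub>1 \<in> hermitian_L2 \<Longrightarrow> g\<^sub>2 \<in> hermitian_L2 \<Longrightarrow>
      complex_of_real (expectation (\<lambda>\<omega>. W g\<^sub>1 \<omega> * W g\<^sub>2 \<omega>)) = (LINT \<xi>|lborel. g\<^sub>1 \<xi> * cnj (g\<^sub>2 \<xi>))"

section \<open>The generalized anisotropic fractional Brownian field\<close>

definition sqrt_density ::
  "(real ^ 2 \<Rightarrow> real) \<Rightarrow> (real ^ 2 \<Rightarrow> real ^ 2 \<Rightarrow> real) \<Rightarrow> real ^ 2 \<Rightarrow> real ^ 2 \<Rightarrow> real" where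
  "sqrt_density h C x \<xi> = C x \<xi> / norm \<xi> powr (h x + 1)"

definition harmonizable ::
  "((real ^ 2 \<Rightarrow> complex) \<Rightarrow> 'w \<Rightarrow> real) \<Rightarrow> (real ^ 2 \<Rightarrow> real) \<Rightarrow> real ^ 2 \<Rightarrow> 'w \<Rightarrow> real" where
  "harmonizable W s x = W (\<lambda>\<xi>. (exp (\<i> * of_real (x \<bullet> \<xi>)) - 1) * of_real (s \<xi>))"

definition gafbf ::
  "((real ^ 2 \<Rightarrow> complex) \<Rightarrow> 'w \<Rightarrow> real) \<Rightarrow> (real ^ 2 \<Rightarrow> real) \<Rightarrow> (real ^ 2 \<Rightarrow> real ^ 2 \<Rightarrow> real) \<Rightarrow>
   real ^ 2 \<Rightarrow> 'w \<Rightarrow> real" where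
  "gafbf W h C x = harmonizable W (sqrt_density h C x) x"

definition arc_length :: "(real ^ 2) measure" where
  "arc_length = distr (restrict_space lborel {0..<2 * pi}) borel (\<lambda>t. vector [cos t, sin t])"

section \<open>Weak convergence of stochastic processes\<close>

text \<open>The topological space of continuous functions, with the topology of locally uniform
  convergence (its carrier consists of the continuous functions only).\<close>

definition compact_open :: "('a::topological_space \<Rightarrow> 'b::topological_space) topology" where
  "compact_open = topology_generated_by
     {{f. continuous_on UNIV f \<and> f ` K \<subseteq> U} | K U. compact K \<and> open U}"

definition continuous_modification ::
  "'w measure \<Rightarrow> ('a::topological_space \<Rightarrow> 'w \<Rightarrow> real) \<Rightarrow> ('a \<Rightarrow> 'w \<Rightarrow> real) \<Rightarrow> bool" where
  "continuous_modification P Z Z' \<longleftrightarrow>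
     (\<forall>u. Z' u \<in> borel_measurable P \<and> (AE \<omega> in P. Z' u \<omega> = Z u \<omega>)) \<and>
     (\<forall>\<omega>\<in>space P. continuous_on UNIV (\<lambda>u. Z' u \<omega>))"

text \<open>Processes defined by stochastic integrals are only determined up to modification, so weak
  convergence in the space of continuous functions refers to modifications with continuous paths.
  Their laws on that space do not depend on the choice of the modification, hence the existential
  quantifier. On the fields over \<open>\<real>\<^sup>2\<close> considered here, the Borel sets of \<open>compact_open\<close> are
  generated by the evaluations, so that the integrands below are measurable.\<close>

definition weakly_converges ::
  "'w measure \<Rightarrow> ('i \<Rightarrow> 'a::topological_space \<Rightarrow> 'w \<Rightarrow> real) \<Rightarrow>
   'v measure \<Rightarrow> ('a \<Rightarrow> 'v \<Rightarrow> real) \<Rightarrow> 'i filter \<Rightarrow> bool" where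
  "weakly_converges P Z Q Y F \<longleftrightarrow>
     (\<exists>Z' Y'. (\<forall>\<^sub>F \<rho> in F. continuous_modification P (Z \<rho>) (Z' \<rho>)) \<and>
        continuous_modification Q Y Y' \<and>
        (\<forall>\<Phi>. continuous_map compact_open euclideanreal \<Phi> \<and> bounded (\<Phi> ` topspace compact_open) \<longrightarrow>
          ((\<lambda>\<rho>. LINT \<omega>|P. \<Phi> (\<lambda>u. Z' \<rho> u \<omega>)) \<longlongrightarrow> (LINT \<omega>|Q. \<Phi> (\<lambda>u. Y' u \<omega>))) F))"

section \<open>Localizability and the local anisotropy function\<close>

definition rescaled_increments_converge ::
  "'w measure \<Rightarrow> (real ^ 2 \<Rightarrow> 'w \<Rightarrow> real) \<Rightarrow> real ^ 2 \<Rightarrow> real \<Rightarrow>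
   'v measure \<Rightarrow> (real ^ 2 \<Rightarrow> 'v \<Rightarrow> real) \<Rightarrow> bool" where
  "rescaled_increments_converge P X x\<^sub>0 H Q Y \<longleftrightarrow>
     weakly_converges P (\<lambda>\<rho> u \<omega>. (X (x\<^sub>0 + \<rho> *\<^sub>R u) \<omega> - X x\<^sub>0 \<omega>) / \<rho> powr H) Q Y (at_right 0)"

definition nontrivial_field :: "'w measure \<Rightarrow> (real ^ 2 \<Rightarrow> 'w \<Rightarrow> real) \<Rightarrow> bool" where
  "nontrivial_field P Y \<longleftrightarrow> (\<exists>u. \<not> (AE \<omega> in P. Y u \<omega> = 0))"

definition localizable_at ::
  "'w measure \<Rightarrow> (real ^ 2 \<Rightarrow> 'w \<Rightarrow> real) \<Rightarrow> real ^ 2 \<Rightarrow> real \<Rightarrow>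
   'v measure \<Rightarrow> (real ^ 2 \<Rightarrow> 'v \<Rightarrow> real) \<Rightarrow> bool" where
  "localizable_at P X x\<^sub>0 H Q Y \<longleftrightarrow>
     0 < H \<and> H < 1 \<and> nontrivial_field Q Y \<and> rescaled_increments_converge P X x\<^sub>0 H Q Y"

definition process_law :: "'w measure \<Rightarrow> ('i \<Rightarrow> 'w \<Rightarrow> real) \<Rightarrow> ('i \<Rightarrow> real) measure" where
  "process_law P Y = distr P (Pi\<^sub>M UNIV (\<lambda>_. borel)) (\<lambda>\<omega> u. Y u \<omega>)"

definition self_similar :: "'w measure \<Rightarrow> real \<Rightarrow> (real ^ 2 \<Rightarrow> 'w \<Rightarrow> real) \<Rightarrow> bool" where
  "self_similar P H Y \<longleftrightarrow>
     (\<forall>\<rho>>0. process_law P (\<lambda>u. Y (\<rho> *\<^sub>R u)) = process_law P (\<lambda>u \<omega>. \<rho> powr H * Y u \<omega>))"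

definition stationary_increments :: "'w measure \<Rightarrow> (real ^ 2 \<Rightarrow> 'w \<Rightarrow> real) \<Rightarrow> bool" where
  "stationary_increments P Y \<longleftrightarrow>
     (\<forall>z. process_law P (\<lambda>u \<omega>. Y (z + u) \<omega> - Y z \<omega>) = process_law P (\<lambda>u \<omega>. Y u \<omega> - Y 0 \<omega>))"

definition spectral_density ::
  "'w measure \<Rightarrow> (real ^ 2 \<Rightarrow> 'w \<Rightarrow> real) \<Rightarrow> (real ^ 2 \<Rightarrow> real) \<Rightarrow> bool" where
  "spectral_density P Y f \<longleftrightarrow> f \<in> borel_measurable borel \<and> (\<forall>\<xi>. 0 \<le> f \<xi>) \<and>
     (\<forall>x y. integrable P (\<lambda>\<omega>. Y x \<omega> * Y y \<omega>) \<and>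
        integrable lborel (\<lambda>\<xi>. (exp (\<i> * of_real (x \<bullet> \<xi>)) - 1) *
          (exp (- (\<i> * of_real (y \<bullet> \<xi>))) - 1) * of_real (f \<xi>)) \<and>
        complex_of_real (LINT \<omega>|P. Y x \<omega> * Y y \<omega>) =
          (LINT \<xi>|lborel. (exp (\<i> * of_real (x \<bullet> \<xi>)) - 1) *
            (exp (- (\<i> * of_real (y \<bullet> \<xi>))) - 1) * of_real (f \<xi>)))"

text \<open>Only the values of the anisotropy function \<open>c\<close> on the unit circle matter. It is determined
  up to null sets, like the spectral density, hence a predicate rather than a function.\<close>

definition anisotropy_function ::
  "'w measure \<Rightarrow> real \<Rightarrow> (real ^ 2 \<Rightarrow> 'w \<Rightarrow> real) \<Rightarrow> (real ^ 2 \<Rightarrow> real) \<Rightarrow> bool" where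
  "anisotropy_function P H Y c \<longleftrightarrow>
     gaussian_process P UNIV Y \<and> self_similar P H Y \<and> stationary_increments P Y \<and>
     (\<exists>f. spectral_density P Y f \<and>
        (\<forall>\<xi>. \<xi> \<noteq> 0 \<longrightarrow> f \<xi> = norm \<xi> powr (- 2 * H - 2) * c (\<xi> /\<^sub>R norm \<xi>)))"

definition local_anisotropy_function ::
  "'w measure \<Rightarrow> (real ^ 2 \<Rightarrow> 'w \<Rightarrow> real) \<Rightarrow> real ^ 2 \<Rightarrow> (real ^ 2 \<Rightarrow> real) \<Rightarrow> bool" where
  "local_anisotropy_function P X x\<^sub>0 c \<longleftrightarrow>
     (\<exists>H Y. localizable_at P X x\<^sub>0 H P Y \<and> anisotropy_function P H Y c)"

end

theory Submission
  imports Defs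
begin

text \<open>Write \<open>s x\<close> for the square root of the spectral density at \<open>x\<close> and \<open>H = h x\<^sub>0\<close>. The integrand of a
  rescaled increment of \<open>X\<close> at \<open>x\<^sub>0\<close> splits into the increment of the integrand with frozen density
  \<open>s x\<^sub>0\<close> and a remainder containing \<open>s (x\<^sub>0 + \<rho> u) - s x\<^sub>0\<close>. The composition of the modulation
  \<open>e\<^bsup>- i\<langle>x\<^sub>0, \<xi>\<rangle>\<^esup>\<close> with the dilation by \<open>\<rho>\<close> is unitary on the Hermitian functions, so it does not change the
  law of the stochastic integrals, and it turns the frozen part into the integrand of \<open>Y\<close>. Hence the rescaled
  increments have the law of a perturbation \<open>Y + R\<^sub>\<rho>\<close> of \<open>Y\<close> living on the same probability space,
  and neither tightness nor Prokhorov's theorem is needed. In \<open>L\<^sup>2\<close>, the increments of \<open>R\<^sub>\<rho>\<close> are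
  at most \<open>\<rho>\<^bsup>\<kappa> - H\<^esup>\<close> times a Hoelder modulus, where \<open>\<kappa> = min \<eta> \<beta> > H\<close>; the Gaussian moments and
  a quantitative Kolmogorov criterion then make \<open>R\<^sub>\<rho>\<close> tend to zero locally uniformly.\<close>

section \<open>Laws determined by linear combinations\<close>

lemma (in prob_space) tilted_law:
  assumes [measurable]: "X \<in> borel_measurable M" "G \<in> borel_measurable M"
    and G: "\<And>\<omega>. 0 \<le> G \<omega> \<and> G \<omega> \<le> (B::real)" and m: "m = expectation G" "0 < m"
  defines "N \<equiv> distr (density M (\<lambda>\<omega>. ennreal (G \<omega> / m))) borel X"
  shows "real_distribution N"
    and "char N t = (LINT \<omega>|M. complex_of_real (G \<omega>) * iexp (t * X \<omega>)) / m"
    and "A \<in> sets borel \<Longrightarrow> (LINT x|N. indicator A x :: real) = expectation (\<lambda>\<omega>. G \<omega> * indicator A (X \<omega>)) / m"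
proof -
  have "integrable M G" by (rule integrable_const_bound[where B=B]) (use G in auto)
  then have "(\<integral>\<^sup>+\<omega>. ennreal (G \<omega> / m) \<partial>M) = ennreal (expectation G / m)"
    using G m by (subst nn_integral_eq_integral) auto
  then have "prob_space (density M (\<lambda>\<omega>. ennreal (G \<omega> / m)))"
    using m by (intro prob_spaceI) (simp add: emeasure_density cong: nn_integral_cong)
  then interpret D: prob_space "density M (\<lambda>\<omega>. ennreal (G \<omega> / m))" .
  show "real_distribution N" unfolding N_def
    by (intro real_distribution.intro real_distribution_axioms.intro D.prob_space_distr) auto
  have "char N t = (LINT \<omega>|M. (G \<omega> / m) *\<^sub>R iexp (t * X \<omega>))"
    unfolding char_def N_def using G m by (subst integral_distr) (auto simp: integral_density)
  also have "\<dots> = (LINT \<omega>|M. complex_of_real (G \<omega>) * iexp (t * X \<omega>)) / m"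
    by (subst integral_divide_zero[symmetric]) (simp add: scaleR_conv_of_real)
  finally show "char N t = \<dots>" .
  assume [measurable]: "A \<in> sets borel"
  have "(LINT x|N. indicator A x :: real) = expectation (\<lambda>\<omega>. (G \<omega> / m) *\<^sub>R indicator A (X \<omega>))"
    unfolding N_def using G m by (subst integral_distr) (auto simp: integral_density)
  also have "\<dots> = expectation (\<lambda>\<omega>. G \<omega> * indicator A (X \<omega>)) / m"
    by (subst integral_divide_zero[symmetric]) simp
  finally show "(LINT x|N. indicator A x :: real) = \<dots>" .
qed

lemma (in prob_space) tilted_null:
  assumes [measurable]: "G \<in> borel_measurable M"
    and G: "\<And>\<omega>. 0 \<le> G \<omega> \<and> G \<omega> \<le> (B::real)" and m: "expectation G = 0"
  shows "expectation (\<lambda>\<omega>. G \<omega> * F \<omega>) = 0"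
proof -
  have "integrable M G" by (rule integrable_const_bound[where B=B]) (use G in auto)
  then have "AE \<omega> in M. G \<omega> = 0" using m G by (simp add: integral_nonneg_eq_0_iff_AE)
  then show ?thesis by (intro integral_eq_zero_AE) auto
qed

text \<open>Normalised by their total mass, the weights \<open>G\<close> and \<open>H\<close> become
  probability densities, and \<open>eq\<close> says that \<open>X\<close> and \<open>Y\<close> have
  the same characteristic function under the tilted measures; Levy's uniqueness theorem then
  identifies the two images. The masses agree by \<open>eq\<close> at \<open>t = 0\<close>. A weight
  of mass zero cannot be normalised, but it vanishes almost everywhere.\<close>

lemma tilted_char_unique:
  fixes X :: "'a \<Rightarrow> real" and Y :: "'b \<Rightarrow> real"
  assumes P: "prob_space P" and Q: "prob_space Q"
    and X: "X \<in> borel_measurable P" and Y: "Y \<in> borel_measurable Q"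
    and G: "G \<in> borel_measurable P" "\<And>\<omega>. 0 \<le> G \<omega> \<and> G \<omega> \<le> (B::real)"
    and H: "H \<in> borel_measurable Q" "\<And>\<omega>. 0 \<le> H \<omega> \<and> H \<omega> \<le> B"
    and eq: "\<And>t. (LINT \<omega>|P. complex_of_real (G \<omega>) * iexp (t * X \<omega>))
                 = (LINT \<omega>|Q. complex_of_real (H \<omega>) * iexp (t * Y \<omega>))"
    and A: "A \<in> sets borel"
  shows "(LINT \<omega>|P. G \<omega> * indicator A (X \<omega>)) = (LINT \<omega>|Q. H \<omega> * indicator A (Y \<omega>))"
proof -
  define m where "m = (LINT \<omega>|P. G \<omega>)"
  have "complex_of_real m = complex_of_real (LINT \<omega>|Q. H \<omega>)"
    using eq[of 0] by (simp add: m_def)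
  then have mH: "m = (LINT \<omega>|Q. H \<omega>)" by (simp only: of_real_eq_iff)
  show ?thesis
  proof (cases "m = 0")
    case True
    then show ?thesis using prob_space.tilted_null[OF P G] prob_space.tilted_null[OF Q H] mH m_def by simp
  next
    case False
    then have mp: "0 < m" using G(2) integral_nonneg_AE[of G P] by (simp add: m_def less_le)
    note GP = prob_space.tilted_law[OF P X G m_def mp] and HQ = prob_space.tilted_law[OF Q Y H mH mp]
    have "distr (density P (\<lambda>\<omega>. ennreal (G \<omega> / m))) borel X = distr (density Q (\<lambda>\<omega>. ennreal (H \<omega> / m))) borel Y"
      by (rule Levy_uniqueness[OF GP(1) HQ(1)]) (rule ext, unfold GP(2) HQ(2) eq, rule refl)
    then show ?thesis using GP(3)[OF A] HQ(3)[OF A] mp by simp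
  qed
qed

text \<open>One coordinate at a time, exponentials are replaced by indicators; the trigonometric weights
  \<open>1 + cos (l + \<theta>)\<close> keep the tilting measures positive.\<close>

lemma cylinder_char_unique:
  fixes X :: "'i \<Rightarrow> 'a \<Rightarrow> real" and Y :: "'i \<Rightarrow> 'b \<Rightarrow> real"
  assumes P: "prob_space P" and Q: "prob_space Q"
    and X[measurable]: "\<And>i. X i \<in> borel_measurable P"
    and Y[measurable]: "\<And>i. Y i \<in> borel_measurable Q"
    and eq: "\<And>J c. finite J \<Longrightarrow> (LINT \<omega>|P. iexp (\<Sum>j\<in>J. c j * X j \<omega>)) = (LINT \<omega>|Q. iexp (\<Sum>j\<in>J. c j * Y j \<omega>))"
    and S: "finite S" and A: "\<And>i. A i \<in> sets borel" and T: "finite T"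
  shows "(LINT \<omega>|P. complex_of_real (\<Prod>j\<in>S. indicator (A j) (X j \<omega>)) * iexp (\<Sum>j\<in>T. c j * X j \<omega>))
    = (LINT \<omega>|Q. complex_of_real (\<Prod>j\<in>S. indicator (A j) (Y j \<omega>)) * iexp (\<Sum>j\<in>T. c j * Y j \<omega>))"
  using S T
proof (induction S arbitrary: T c rule: finite_induct)
  case empty
  then show ?case using eq by simp
next
  case (insert k S)
  note A[measurable]
  define G where "G x = (\<Prod>j\<in>S. indicator (A j) (x j) :: real)" for x :: "'i \<Rightarrow> real"
  define L where "L x = (\<Sum>j\<in>T. c j * x j)" for x :: "'i \<Rightarrow> real"
  let ?i = "\<lambda>x. indicator (A k) (x k) :: real"
  have g: "0 \<le> G x \<and> G x \<le> 1" for x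
    unfolding G_def by (auto intro!: prod_nonneg prod_le_1 simp: indicator_def)
  \<comment> \<open>The index \<open>k\<close> may already belong to \<open>T\<close>. Coefficients
    built from two indicators cover both cases, and the free factor \<open>r\<close> lets one
    induction hypothesis serve several frequencies of \<open>L\<close>.\<close>
  have lin: "(\<Sum>j\<in>insert k T. (t * (if j = k then 1 else 0) + r * (if j \<in> T then c j else 0)) * x j) = t * x k + r * L x" for t r x
  proof -
    have "(\<Sum>j\<in>insert k T. (t * (if j = k then 1 else 0) + r * (if j \<in> T then c j else 0)) * x j)
      = (\<Sum>j\<in>insert k T. (if j = k then t * x j else 0)) + (\<Sum>j\<in>insert k T. (if j \<in> T then r * (c j * x j) else 0))"
      by (subst sum.distrib[symmetric]) (auto intro!: sum.cong simp: algebra_simps)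
    also have "(\<Sum>j\<in>insert k T. (if j = k then t * x j else 0)) = t * x k"
      using insert.prems by (simp add: sum.delta)
    also have "(\<Sum>j\<in>insert k T. (if j \<in> T then r * (c j * x j) else 0)) = r * L x"
      unfolding L_def using insert.prems by (subst sum.mono_neutral_right[where S=T]) (auto simp: sum_distrib_left)
    finally show ?thesis .
  qed
  have IH: "(LINT \<omega>|P. complex_of_real (G (\<lambda>j. X j \<omega>)) * iexp (t * X k \<omega> + r * L (\<lambda>j. X j \<omega>))) =
      (LINT \<omega>|Q. complex_of_real (G (\<lambda>j. Y j \<omega>)) * iexp (t * Y k \<omega> + r * L (\<lambda>j. Y j \<omega>)))" for t r
    using insert.IH[where T="insert k T" and c="\<lambda>j. t * (if j = k then 1 else 0) + r * (if j \<in> T then c j else 0)"]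
      insert.prems unfolding lin G_def[symmetric] by simp
  \<comment> \<open>In \<open>l\<close> the positive weight is a combination of exponentials of
    frequencies 0, 1 and -1, so its tilted characteristic function reduces to \<open>IH\<close> at
    \<open>r = 0\<close>, \<open>r = 1\<close> and \<open>r = -1\<close>.\<close>
  have tilt: "complex_of_real (b * (1 + cos (l + \<theta>))) * iexp z =
     of_real b * iexp (z + 0 * l) + (iexp \<theta> / 2 * (of_real b * iexp (z + 1 * l)) + iexp (- \<theta>) / 2 * (of_real b * iexp (z + (-1) * l)))"
    for b l \<theta> z :: real
  proof -
    define E F Z where "E = iexp l" and "F = iexp (- l)" and "Z = iexp z"
    define d where "d = cos (l + \<theta>)"
    have a: "complex_of_real d = (E * iexp \<theta> + F * iexp (- \<theta>)) / 2"
      unfolding E_def F_def d_def cos_of_real[symmetric] cos_exp_eq by (simp add: algebra_simps flip: exp_add)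
    have e: "iexp (z + 1 * l) = Z * E" "iexp (z + (-1) * l) = Z * F" "iexp (z + 0 * l) = Z" "iexp z = Z"
      unfolding E_def F_def Z_def by (simp_all add: exp_add[symmetric] algebra_simps)
    show ?thesis by (simp only: e d_def[symmetric]) (simp add: a field_simps)
  qed
  \<comment> \<open>Conversely the phases 0 and \<open>- pi / 2\<close> recover cosine and sine,
    hence the complex exponential, from two positive weights.\<close>
  have expand: "complex_of_real (i * b) * iexp l =
     of_real (b * (1 + cos (l + 0)) * i) - of_real (b * i) + \<i> * (of_real (b * (1 + cos (l + (- pi / 2))) * i) - of_real (b * i))"
    for i b l :: real
    unfolding cis_conv_exp[symmetric] by (simp add: complex_eq_iff cos_diff algebra_simps)
  have g2: "0 \<le> G x * (1 + cos z) \<and> G x * (1 + cos z) \<le> 2" for x z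
  proof -
    have "0 \<le> 1 + cos z" "1 + cos z \<le> 2" using cos_ge_minus_one[of z] cos_le_one[of z] by linarith+
    then show ?thesis using g[of x] mult_mono[of "G x" 1 "1 + cos z" 2] by simp
  qed
  have gi: "\<bar>G x * (1 + cos z) * ?i y\<bar> \<le> 2" "\<bar>G x * ?i y\<bar> \<le> 2" for x y z
    using g2[of x z] g[of x] by (auto simp: indicator_def)
  have gn: "cmod (complex_of_real (G x) * iexp l) \<le> 1" for x l
    using g[of x] by (simp add: norm_mult)
  have side: "(LINT \<omega>|R. complex_of_real (G (\<lambda>j. Z j \<omega>) * (1 + cos (L (\<lambda>j. Z j \<omega>) + \<theta>))) * iexp (t * Z k \<omega>)) =
        I t 0 + (iexp \<theta> / 2 * I t 1 + iexp (- \<theta>) / 2 * I t (-1))" (is ?tilted)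
      "(LINT \<omega>|R. complex_of_real (?i (\<lambda>j. Z j \<omega>) * G (\<lambda>j. Z j \<omega>)) * iexp (L (\<lambda>j. Z j \<omega>))) =
        of_real (J 0) - of_real K + \<i> * (of_real (J (- pi / 2)) - of_real K)" (is ?expanded)
    if R: "prob_space R" and Z: "\<And>i. Z i \<in> borel_measurable R"
      and I: "\<And>t r. I t r = (LINT \<omega>|R. complex_of_real (G (\<lambda>j. Z j \<omega>)) * iexp (t * Z k \<omega> + r * L (\<lambda>j. Z j \<omega>)))"
      and J: "\<And>\<theta>. J \<theta> = (LINT \<omega>|R. G (\<lambda>j. Z j \<omega>) * (1 + cos (L (\<lambda>j. Z j \<omega>) + \<theta>)) * ?i (\<lambda>j. Z j \<omega>))"
      and K: "K = (LINT \<omega>|R. G (\<lambda>j. Z j \<omega>) * ?i (\<lambda>j. Z j \<omega>))"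
    for R :: "'z measure" and Z \<theta> t I J K
  proof -
    interpret R: prob_space R by fact
    note [measurable] = Z
    have [measurable]: "(\<lambda>\<omega>. G (\<lambda>j. Z j \<omega>)) \<in> borel_measurable R" "(\<lambda>\<omega>. L (\<lambda>j. Z j \<omega>)) \<in> borel_measurable R"
      unfolding G_def L_def by measurable
    have i: "integrable R (\<lambda>\<omega>. complex_of_real (G (\<lambda>j. Z j \<omega>)) * iexp (t * Z k \<omega> + r * L (\<lambda>j. Z j \<omega>)))" for t r
      by (rule R.integrable_const_bound[where B=1], rule AE_I2, rule gn) measurable
    have "(LINT \<omega>|R. f \<omega> + (p * f1 \<omega> + q * f2 \<omega>)) = (LINT \<omega>|R. f \<omega>) + (p * (LINT \<omega>|R. f1 \<omega>) + q * (LINT \<omega>|R. f2 \<omega>))"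
      if "integrable R f" "integrable R f1" "integrable R f2" for p q :: complex and f f1 f2 using that by simp
    from this[OF i i i] show ?tilted unfolding tilt I .
    have j: "integrable R (\<lambda>\<omega>. G (\<lambda>j. Z j \<omega>) * (1 + cos (L (\<lambda>j. Z j \<omega>) + \<theta>)) * ?i (\<lambda>j. Z j \<omega>))"
      "integrable R (\<lambda>\<omega>. G (\<lambda>j. Z j \<omega>) * ?i (\<lambda>j. Z j \<omega>))" for \<theta>
      by (rule R.integrable_const_bound[where B=2], rule AE_I2, unfold real_norm_def, rule gi, measurable)+
    have "(LINT \<omega>|R. of_real (f1 \<omega>) - of_real (f \<omega>) + \<i> * (of_real (f2 \<omega>) - of_real (f \<omega>))) =
        complex_of_real (LINT \<omega>|R. f1 \<omega>) - of_real (LINT \<omega>|R. f \<omega>) + \<i> * (of_real (LINT \<omega>|R. f2 \<omega>) - of_real (LINT \<omega>|R. f \<omega>))"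
      if "integrable R f" "integrable R f1" "integrable R f2" for f f1 f2 :: "'z \<Rightarrow> real"
      using that by (simp add: integrable_of_real)
    from this[OF j(2) j(1) j(1)] show ?expanded unfolding expand J K .
  qed
  have [measurable]: "(\<lambda>\<omega>. G (\<lambda>j. X j \<omega>)) \<in> borel_measurable P" "(\<lambda>\<omega>. L (\<lambda>j. X j \<omega>)) \<in> borel_measurable P"
    "(\<lambda>\<omega>. G (\<lambda>j. Y j \<omega>)) \<in> borel_measurable Q" "(\<lambda>\<omega>. L (\<lambda>j. Y j \<omega>)) \<in> borel_measurable Q"
    unfolding G_def L_def by measurable
  have K: "(LINT \<omega>|P. G (\<lambda>j. X j \<omega>) * ?i (\<lambda>j. X j \<omega>)) = (LINT \<omega>|Q. G (\<lambda>j. Y j \<omega>) * ?i (\<lambda>j. Y j \<omega>))"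
    by (rule tilted_char_unique[OF P Q X Y, where B=1]) (use g IH[of _ 0] in auto)
  have J: "(LINT \<omega>|P. G (\<lambda>j. X j \<omega>) * (1 + cos (L (\<lambda>j. X j \<omega>) + \<theta>)) * ?i (\<lambda>j. X j \<omega>)) =
      (LINT \<omega>|Q. G (\<lambda>j. Y j \<omega>) * (1 + cos (L (\<lambda>j. Y j \<omega>) + \<theta>)) * ?i (\<lambda>j. Y j \<omega>))" for \<theta>
  proof (rule tilted_char_unique[OF P Q X Y _ g2 _ g2])
    show "(LINT \<omega>|P. complex_of_real (G (\<lambda>j. X j \<omega>) * (1 + cos (L (\<lambda>j. X j \<omega>) + \<theta>))) * iexp (t * X k \<omega>)) =
      (LINT \<omega>|Q. complex_of_real (G (\<lambda>j. Y j \<omega>) * (1 + cos (L (\<lambda>j. Y j \<omega>) + \<theta>))) * iexp (t * Y k \<omega>))" for t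
      by (rule trans[OF side(1)[OF P X refl refl refl] trans[OF _ side(1)[OF Q Y refl refl refl, symmetric]]]) (simp only: IH)
  qed measurable
  show ?case
    unfolding prod.insert[OF insert.hyps] G_def[symmetric] L_def[symmetric]
    by (rule trans[OF side(2)[OF P X refl refl refl] trans[OF _ side(2)[OF Q Y refl refl refl, symmetric]]]) (simp only: J K)
qed

text \<open>The Cramer-Wold device: characteristic functions of linear combinations determine the
  probabilities of finite-dimensional cylinders with Borel sides, and these generate the product
  sigma-algebra over an arbitrary index set.\<close>

lemma process_law_eqI:
  fixes X :: "'i \<Rightarrow> 'a \<Rightarrow> real" and Y :: "'i \<Rightarrow> 'b \<Rightarrow> real"
  assumes P: "prob_space P" and Q: "prob_space Q"
    and X: "\<And>i. X i \<in> borel_measurable P" and Y: "\<And>i. Y i \<in> borel_measurable Q"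
    and eq: "\<And>J c. finite J \<Longrightarrow> (LINT \<omega>|P. iexp (\<Sum>j\<in>J. c j * X j \<omega>)) = (LINT \<omega>|Q. iexp (\<Sum>j\<in>J. c j * Y j \<omega>))"
  shows "process_law P X = process_law Q Y"
proof (rule measure_eqI_PiM_infinite[where I=UNIV and M="\<lambda>_. borel"])
  fix A :: "'i \<Rightarrow> real set" and J :: "'i set"
  assume J: "finite J" and A: "\<And>i. i \<in> J \<Longrightarrow> A i \<in> sets borel"
  \<comment> \<open>The cylinder lemma expects a Borel set at every index, while \<open>A\<close> is
    Borel only on \<open>J\<close>.\<close>
  define A' where "A' i = (if i \<in> J then A i else UNIV)" for i
  have A': "A' i \<in> sets borel" for i using A by (auto simp: A'_def)
  let ?C = "{f. \<forall>i\<in>J. f i \<in> A' i}"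
  have em: "prod_emb UNIV (\<lambda>_. borel) J (Pi\<^sub>E J A) = ?C"
    by (auto simp: prod_emb_def A'_def PiE_iff)
  have s: "?C \<in> sets (Pi\<^sub>M UNIV (\<lambda>_. borel))"
    unfolding em[symmetric] using J A by (intro sets_PiM_I) auto
  have pr: "(\<Prod>j\<in>J. indicator (A' j) (z j) :: real) = indicator ?C z" for z
    using J by (auto simp: indicator_def prod_zero_iff)
  have law: "emeasure (process_law R Z) ?C = ennreal (LINT \<omega>|R. (\<Prod>j\<in>J. indicator (A' j) (Z j \<omega>)))"
    if R: "prob_space R" and [measurable]: "\<And>i. Z i \<in> borel_measurable R" for R :: "'z measure" and Z
  proof -
    interpret R: prob_space R by fact
    have [measurable]: "(\<lambda>\<omega> u. Z u \<omega>) \<in> R \<rightarrow>\<^sub>M Pi\<^sub>M UNIV (\<lambda>_. borel)" by (rule measurable_PiM_single') auto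
    let ?V = "(\<lambda>\<omega> u. Z u \<omega>) -` ?C \<inter> space R"
    have "emeasure (process_law R Z) ?C = emeasure R ?V"
      unfolding process_law_def using s by (intro emeasure_distr) auto
    also have "\<dots> = ennreal (LINT \<omega>|R. indicator ?V \<omega>)" by (simp add: R.emeasure_eq_measure)
    also have "\<dots> = ennreal (LINT \<omega>|R. (\<Prod>j\<in>J. indicator (A' j) (Z j \<omega>)))"
      unfolding pr by (intro arg_cong[where f=ennreal] Bochner_Integration.integral_cong) (auto simp: indicator_def)
    finally show ?thesis .
  qed
  have "complex_of_real (LINT \<omega>|P. (\<Prod>j\<in>J. indicator (A' j) (X j \<omega>))) = of_real (LINT \<omega>|Q. (\<Prod>j\<in>J. indicator (A' j) (Y j \<omega>)))"
    using cylinder_char_unique[where A=A' and S=J and T="{}" and c="\<lambda>_. 0" and X=X and Y=Y and P=P and Q=Q, OF P Q X Y eq J A' finite.emptyI]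
    by (simp del: of_real_prod)
  then show "emeasure (process_law P X) (prod_emb UNIV (\<lambda>_. borel) J (Pi\<^sub>E J A)) =
     emeasure (process_law Q Y) (prod_emb UNIV (\<lambda>_. borel) J (Pi\<^sub>E J A))"
    unfolding em law[OF P X] law[OF Q Y] by (simp only: of_real_eq_iff)
next
  show "finite_measure (process_law P X)"
    unfolding process_law_def
    by (intro prob_space.finite_measure prob_space.prob_space_distr[OF P] measurable_PiM_single') (use X in auto)
qed (simp_all add: process_law_def)

section \<open>Gaussian variables and the white noise integral\<close>

lemma (in prob_space) centered_gaussian_cases:
  assumes Z: "gaussian_rv M Z" and EZ: "expectation Z = 0"
  obtains (normal) \<sigma> where "0 < \<sigma>" "distributed M lborel Z (normal_density 0 \<sigma>)"
    | (null) "AE \<omega> in M. Z \<omega> = 0"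
proof -
  have [measurable]: "Z \<in> borel_measurable M" using Z by (simp add: gaussian_rv_def)
  from Z consider (a) \<mu> \<sigma> where "\<sigma> > 0" "distributed M lborel Z (normal_density \<mu> \<sigma>)" | (b) \<mu> where "AE \<omega> in M. Z \<omega> = \<mu>"
    unfolding gaussian_rv_def by blast
  then show ?thesis
  proof cases
    case a
    have "(LINT x|lborel. normal_density \<mu> \<sigma> x * x) = expectation Z"
      using a by (intro distributed_integral) auto
    then have "\<mu> = 0" using EZ integral_normal_moment_nz_1[OF a(1), of \<mu>] by simp
    then show ?thesis using a normal by simp
  next
    case b
    have "expectation Z = expectation (\<lambda>_. \<mu>)" using b by (intro integral_cong_AE) auto
    then have "\<mu> = 0" using EZ by (simp add: prob_space)
    then show ?thesis using b null by simp
  qed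
qed

text \<open>The constant is the double factorial (2k-1)!!. In terms of the variance the formula also
  covers the degenerate variable, where both sides are 0 for \<open>k > 0\<close> and 1 for
  \<open>k = 0\<close>.\<close>

lemma (in prob_space) centered_gaussian_moment:
  assumes Z: "gaussian_rv M Z" and EZ: "expectation Z = 0"
  shows "integrable M (\<lambda>\<omega>. Z \<omega> ^ (2 * k))"
    and "expectation (\<lambda>\<omega>. Z \<omega> ^ (2 * k)) = fact (2 * k) / (2 ^ k * fact k) * (expectation (\<lambda>\<omega>. (Z \<omega>)\<^sup>2)) ^ k"
proof -
  have [measurable]: "Z \<in> borel_measurable M" using Z by (simp add: gaussian_rv_def)
  show "integrable M (\<lambda>\<omega>. Z \<omega> ^ (2 * k))"
    using Z EZ
  proof (cases rule: centered_gaussian_cases)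
    case (normal \<sigma>)
    then show ?thesis using integrable_normal_moment[of \<sigma> 0 "2 * k"]
        distributed_integrable[OF normal(2), where g="\<lambda>x. x ^ (2 * k)"] by simp
  next
    case null
    have "integrable M (\<lambda>\<omega>. Z \<omega> ^ (2 * k)) \<longleftrightarrow> integrable M (\<lambda>\<omega>. 0 ^ (2 * k) :: real)"
      using null by (intro integrable_cong_AE) auto
    then show ?thesis by simp
  qed
  show "expectation (\<lambda>\<omega>. Z \<omega> ^ (2 * k)) = fact (2 * k) / (2 ^ k * fact k) * (expectation (\<lambda>\<omega>. (Z \<omega>)\<^sup>2)) ^ k"
    using Z EZ
  proof (cases rule: centered_gaussian_cases)
    case (normal \<sigma>)
    have "expectation (\<lambda>\<omega>. Z \<omega> ^ (2 * n)) = fact (2 * n) / ((2 / \<sigma>\<^sup>2) ^ n * fact n)" for n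
      using integral_normal_moment_even[OF normal(1), of 0 n]
      distributed_integral[OF normal(2), where g="\<lambda>x. x ^ (2 * n)"] by simp
    from this[of k] this[of 1] show ?thesis using normal(1)
      by (simp add: power_divide)
  next
    case null
    have "expectation (\<lambda>\<omega>. Z \<omega> ^ (2 * n)) = expectation (\<lambda>\<omega>. 0 ^ (2 * n) :: real)" for n
      using null by (intro integral_cong_AE) auto
    from this[of k] this[of 1] show ?thesis by (cases k) (auto simp: prob_space)
  qed
qed

lemma (in prob_space) centered_gaussian_char:
  assumes Z: "gaussian_rv M Z" and EZ: "expectation Z = 0"
  shows "(LINT \<omega>|M. iexp (Z \<omega>)) = exp (- expectation (\<lambda>\<omega>. (Z \<omega>)\<^sup>2) / 2)"
proof -
  have [measurable]: "Z \<in> borel_measurable M" using Z by (simp add: gaussian_rv_def)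
  show ?thesis using Z EZ
  proof (cases rule: centered_gaussian_cases)
    case (normal \<sigma>)
    have v: "expectation (\<lambda>\<omega>. (Z \<omega>)\<^sup>2) = \<sigma>\<^sup>2"
      using integral_normal_moment_even[OF normal(1), of 0 1]
        distributed_integral[OF normal(2), where g="\<lambda>x. x\<^sup>2"] normal(1) by simp
    have "distributed M lborel (\<lambda>\<omega>. Z \<omega> / \<sigma>) std_normal_density"
      using normal normal_standard_normal_convert[of \<sigma> Z 0] by simp
    then have d: "distr M borel (\<lambda>\<omega>. Z \<omega> / \<sigma>) = std_normal_distribution"
      using distributed_distr_eq_density by (metis distr_cong sets_lborel)
    have "(LINT \<omega>|M. iexp (Z \<omega>)) = char (distr M borel (\<lambda>\<omega>. Z \<omega> / \<sigma>)) \<sigma>"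
      unfolding char_def using normal(1) by (subst integral_distr) auto
    also have "\<dots> = complex_of_real (exp (- (\<sigma>\<^sup>2) / 2))"
      unfolding d char_std_normal_distribution ..
    finally show ?thesis unfolding v by (simp add: exp_of_real[symmetric])
  next
    case null
    have "(LINT \<omega>|M. iexp (Z \<omega>)) = (LINT \<omega>|M. 1)" using null by (intro integral_cong_AE) auto
    moreover have "expectation (\<lambda>\<omega>. (Z \<omega>)\<^sup>2) = expectation (\<lambda>\<omega>. 0)" using null by (intro integral_cong_AE) auto
    ultimately show ?thesis by (simp add: prob_space)
  qed
qed

lemma borel_measurable_cnj [measurable]: "cnj \<in> borel_measurable borel"
  by (intro borel_measurable_continuous_onI continuous_intros)

lemma hermitian_L2_D:
  assumes "g \<in> hermitian_L2"
  shows "g \<in> borel_measurable borel" "integrable lborel (\<lambda>\<xi>. (cmod (g \<xi>))\<^sup>2)" "g (- \<xi>) = cnj (g \<xi>)"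
  using assms by (auto simp: hermitian_L2_def)

lemma hermitian_L2_integrable_prod:
  assumes f: "f \<in> hermitian_L2" and g: "g \<in> hermitian_L2"
  shows "integrable lborel (\<lambda>\<xi>. f \<xi> * cnj (g \<xi>))"
proof -
  note [measurable] = hermitian_L2_D(1)[OF f] hermitian_L2_D(1)[OF g]
  show ?thesis
  proof (rule Bochner_Integration.integrable_bound)
    show "integrable lborel (\<lambda>\<xi>. (cmod (f \<xi>))\<^sup>2 + (cmod (g \<xi>))\<^sup>2)"
      using hermitian_L2_D(2)[OF f] hermitian_L2_D(2)[OF g] by simp
    show "AE \<xi> in lborel. norm (f \<xi> * cnj (g \<xi>)) \<le> norm ((cmod (f \<xi>))\<^sup>2 + (cmod (g \<xi>))\<^sup>2)"
    proof (rule AE_I2)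
      fix \<xi>
      have "2 * (cmod (f \<xi>) * cmod (g \<xi>)) \<le> (cmod (f \<xi>))\<^sup>2 + (cmod (g \<xi>))\<^sup>2"
        using sum_squares_bound[of "cmod (f \<xi>)" "cmod (g \<xi>)"] by simp
      moreover have "0 \<le> cmod (f \<xi>) * cmod (g \<xi>)" by simp
      ultimately show "norm (f \<xi> * cnj (g \<xi>)) \<le> norm ((cmod (f \<xi>))\<^sup>2 + (cmod (g \<xi>))\<^sup>2)"
        unfolding norm_mult complex_mod_cnj real_norm_def by linarith
    qed
  qed simp
qed

text \<open>Real coefficients keep the Hermitian symmetry. Square integrability is read off from the
  expansion of the squared modulus into pairwise products.\<close>

lemma hermitian_L2_lincomb:
  assumes J: "finite J" and g: "\<And>j. j \<in> J \<Longrightarrow> g j \<in> hermitian_L2"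
  shows "(\<lambda>\<xi>. \<Sum>j\<in>J. of_real (c j) * g j \<xi>) \<in> hermitian_L2"
proof -
  have m: "(\<lambda>\<xi>. \<Sum>j\<in>J. of_real (c j) * g j \<xi>) \<in> borel_measurable borel"
    using hermitian_L2_D(1)[OF g] by (intro borel_measurable_sum borel_measurable_times) auto
  have "integrable lborel (\<lambda>\<xi>. \<Sum>i\<in>J. \<Sum>j\<in>J. of_real (c i * c j) * (g i \<xi> * cnj (g j \<xi>)))"
    by (intro Bochner_Integration.integrable_sum integrable_mult_right hermitian_L2_integrable_prod g)
  also have "(\<lambda>\<xi>. \<Sum>i\<in>J. \<Sum>j\<in>J. of_real (c i * c j) * (g i \<xi> * cnj (g j \<xi>))) =
      (\<lambda>\<xi>. complex_of_real ((cmod (\<Sum>j\<in>J. of_real (c j) * g j \<xi>))\<^sup>2))"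
    unfolding complex_norm_square by (simp add: sum_product algebra_simps)
  finally have "integrable lborel (\<lambda>\<xi>. (cmod (\<Sum>j\<in>J. of_real (c j) * g j \<xi>))\<^sup>2)"
    by (simp only: complex_of_real_integrable_eq)
  then show ?thesis
    using m by (auto simp: hermitian_L2_def hermitian_L2_D(3)[OF g] intro!: sum.cong)
qed

section \<open>Almost sure linearity, moments and laws of the white noise integral\<close>

context fourier_white_noise
begin

text \<open>\<open>gaussian_process\<close> speaks of finite sets of distinct indices, whereas the
  family \<open>g\<close> may take the same value several times; summing the coefficients over the
  fibres of \<open>g\<close> reconciles the two.\<close>

lemma gaussian_lincomb:
  assumes J: "finite J" and g: "\<And>j. j \<in> J \<Longrightarrow> g j \<in> hermitian_L2"
  shows "gaussian_rv P (\<lambda>\<omega>. \<Sum>j\<in>J. c j * W (g j) \<omega>)"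
proof -
  have "(\<Sum>j\<in>J. c j * W (g j) \<omega>) = (\<Sum>f\<in>g ` J. (\<Sum>j\<in>{j\<in>J. g j = f}. c j) * W f \<omega>)" for \<omega>
  proof -
    have "(\<Sum>j\<in>J. c j * W (g j) \<omega>) = (\<Sum>f\<in>g ` J. \<Sum>j\<in>{j\<in>J. g j = f}. c j * W (g j) \<omega>)"
      using J by (rule sum.image_gen)
    then show ?thesis by (simp add: sum_distrib_right)
  qed
  moreover have "gaussian_rv P (\<lambda>\<omega>. \<Sum>f\<in>g ` J. (\<Sum>j\<in>{j\<in>J. g j = f}. c j) * W f \<omega>)"
    using gaussian[unfolded gaussian_process_def, rule_format, of "g ` J" "\<lambda>f. \<Sum>j\<in>{j\<in>J. g j = f}. c j"] J g
    by auto
  ultimately show ?thesis by simp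
qed

lemma gaussian_W: "g \<in> hermitian_L2 \<Longrightarrow> gaussian_rv P (W g)"
  using gaussian_lincomb[of "{()}" "\<lambda>_. g" "\<lambda>_. 1"] by simp

lemma measurable_W [measurable]: "g \<in> hermitian_L2 \<Longrightarrow> W g \<in> borel_measurable P"
  using gaussian_W by (auto simp: gaussian_rv_def)

lemma integrable_W_prod:
  assumes f: "f \<in> hermitian_L2" and g: "g \<in> hermitian_L2"
  shows "integrable P (\<lambda>\<omega>. W f \<omega> * W g \<omega>)"
proof -
  note [measurable] = measurable_W[OF f] measurable_W[OF g]
  have "integrable P (\<lambda>\<omega>. (W f \<omega>)\<^sup>2 + (W g \<omega>)\<^sup>2)"
    using centered_gaussian_moment(1)[OF gaussian_W centered, of _ 1] f g by simp
  then show ?thesis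
  proof (rule Bochner_Integration.integrable_bound)
    show "AE \<omega> in P. norm (W f \<omega> * W g \<omega>) \<le> norm ((W f \<omega>)\<^sup>2 + (W g \<omega>)\<^sup>2)"
    proof (rule AE_I2)
      fix \<omega>
      have "2 * (\<bar>W f \<omega>\<bar> * \<bar>W g \<omega>\<bar>) \<le> (W f \<omega>)\<^sup>2 + (W g \<omega>)\<^sup>2"
        using sum_squares_bound[of "\<bar>W f \<omega>\<bar>" "\<bar>W g \<omega>\<bar>"] by simp
      moreover have "0 \<le> \<bar>W f \<omega>\<bar> * \<bar>W g \<omega>\<bar>" by simp
      ultimately show "norm (W f \<omega> * W g \<omega>) \<le> norm ((W f \<omega>)\<^sup>2 + (W g \<omega>)\<^sup>2)"
        unfolding abs_mult real_norm_def by linarith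
    qed
  qed simp
qed

lemma integrable_W:
  assumes g: "g \<in> hermitian_L2"
  shows "integrable P (W g)"
proof (rule square_integrable_imp_integrable[OF measurable_W[OF g]])
  show "integrable P (\<lambda>\<omega>. (W g \<omega>)\<^sup>2)"
    unfolding power2_eq_square by (rule integrable_W_prod[OF g g])
qed

lemma expectation_lincomb:
  assumes g: "\<And>j. j \<in> J \<Longrightarrow> g j \<in> hermitian_L2"
  shows "expectation (\<lambda>\<omega>. \<Sum>j\<in>J. c j * W (g j) \<omega>) = 0"
  by (subst Bochner_Integration.integral_sum) (simp_all add: g integrable_W centered)

lemma second_moment_lincomb_double_sum:
  assumes g: "\<And>j. j \<in> J \<Longrightarrow> g j \<in> hermitian_L2"
  shows "complex_of_real (expectation (\<lambda>\<omega>. (\<Sum>j\<in>J. c j * W (g j) \<omega>)\<^sup>2)) =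
     (\<Sum>i\<in>J. \<Sum>j\<in>J. of_real (c i * c j) * (LINT \<xi>|lborel. g i \<xi> * cnj (g j \<xi>)))"
proof -
  have "expectation (\<lambda>\<omega>. (\<Sum>j\<in>J. c j * W (g j) \<omega>)\<^sup>2) =
     expectation (\<lambda>\<omega>. \<Sum>i\<in>J. \<Sum>j\<in>J. (c i * c j) * (W (g i) \<omega> * W (g j) \<omega>))"
    by (simp add: power2_eq_square sum_product algebra_simps)
  also have "\<dots> = (\<Sum>i\<in>J. \<Sum>j\<in>J. (c i * c j) * expectation (\<lambda>\<omega>. W (g i) \<omega> * W (g j) \<omega>))"
    using g by (simp add: integrable_W_prod Bochner_Integration.integral_sum)
  finally have "complex_of_real (expectation (\<lambda>\<omega>. (\<Sum>j\<in>J. c j * W (g j) \<omega>)\<^sup>2)) =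
     (\<Sum>i\<in>J. \<Sum>j\<in>J. of_real (c i * c j) * complex_of_real (expectation (\<lambda>\<omega>. W (g i) \<omega> * W (g j) \<omega>)))"
    by simp
  also have "\<dots> = (\<Sum>i\<in>J. \<Sum>j\<in>J. of_real (c i * c j) * (LINT \<xi>|lborel. g i \<xi> * cnj (g j \<xi>)))"
    using g by (intro sum.cong arg_cong2[where f="(*)"] isometry refl) auto
  finally show ?thesis .
qed

lemma second_moment_lincomb:
  assumes g: "\<And>j. j \<in> J \<Longrightarrow> g j \<in> hermitian_L2"
  shows "expectation (\<lambda>\<omega>. (\<Sum>j\<in>J. c j * W (g j) \<omega>)\<^sup>2) =
    (LINT \<xi>|lborel. (cmod (\<Sum>j\<in>J. of_real (c j) * g j \<xi>))\<^sup>2)"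
proof -
  have "(LINT \<xi>|lborel. complex_of_real ((cmod (\<Sum>j\<in>J. of_real (c j) * g j \<xi>))\<^sup>2)) =
     (LINT \<xi>|lborel. (\<Sum>i\<in>J. \<Sum>j\<in>J. of_real (c i * c j) * (g i \<xi> * cnj (g j \<xi>))))"
    unfolding complex_norm_square by (simp add: sum_product algebra_simps)
  also have "\<dots> = (\<Sum>i\<in>J. \<Sum>j\<in>J. of_real (c i * c j) * (LINT \<xi>|lborel. g i \<xi> * cnj (g j \<xi>)))"
    using g by (simp add: hermitian_L2_integrable_prod Bochner_Integration.integral_sum)
  finally have "complex_of_real (expectation (\<lambda>\<omega>. (\<Sum>j\<in>J. c j * W (g j) \<omega>)\<^sup>2)) =
     (LINT \<xi>|lborel. complex_of_real ((cmod (\<Sum>j\<in>J. of_real (c j) * g j \<xi>))\<^sup>2))"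
    using second_moment_lincomb_double_sum[where g=g and J=J and c=c, OF g] by simp
  then show ?thesis by (simp only: integral_complex_of_real of_real_eq_iff)
qed

text \<open>Linearity of \<open>W\<close> is a consequence of the isometry: the defect
  \<open>W h - a W f - b W g\<close> is itself a combination of white noise integrals, and its
  second moment is the squared norm of the zero function. It holds outside a null set that depends
  on the functions and coefficients.\<close>

lemma W_lincomb2:
  assumes f: "f \<in> hermitian_L2" and g: "g \<in> hermitian_L2"
  shows "(\<lambda>\<xi>. of_real a * f \<xi> + of_real b * g \<xi>) \<in> hermitian_L2"
    and "AE \<omega> in P. W (\<lambda>\<xi>. of_real a * f \<xi> + of_real b * g \<xi>) \<omega> = a * W f \<omega> + b * W g \<omega>"
proof -
  let ?h = "\<lambda>\<xi>. of_real a * f \<xi> + of_real b * g \<xi>"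
  show h: "?h \<in> hermitian_L2"
    using hermitian_L2_lincomb[of "UNIV :: bool set" "case_bool f g" "case_bool a b"] f g
    by (auto simp: UNIV_bool add.commute split: bool.split)
  define G where "G i = (if i = 0 then ?h else if i = 1 then f else g)" for i :: nat
  define c where "c i = (if i = 0 then 1 else if i = 1 then - a else - b)" for i :: nat
  have G: "G i \<in> hermitian_L2" for i using f g h by (auto simp: G_def)
  have S: "(\<Sum>i\<in>{0,1,2}. c i * W (G i) \<omega>) = W ?h \<omega> - (a * W f \<omega> + b * W g \<omega>)" for \<omega>
    by (simp add: c_def G_def)
  have Z: "(\<Sum>i\<in>{0,1,2}. complex_of_real (c i) * G i \<xi>) = 0" for \<xi>
    by (simp add: c_def G_def)
  have "expectation (\<lambda>\<omega>. (W ?h \<omega> - (a * W f \<omega> + b * W g \<omega>))\<^sup>2) = 0"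
    using second_moment_lincomb[where g=G and J="{0,1,2}" and c=c, OF G] unfolding S Z by simp
  moreover have "integrable P (\<lambda>\<omega>. (W ?h \<omega> - (a * W f \<omega> + b * W g \<omega>))\<^sup>2)"
    using centered_gaussian_moment(1)[where k=1, OF gaussian_lincomb[where J="{0,1,2}" and g=G and c=c, OF _ G] expectation_lincomb[where J="{0,1,2}" and g=G and c=c, OF G]]
    unfolding S by simp
  ultimately have "AE \<omega> in P. (W ?h \<omega> - (a * W f \<omega> + b * W g \<omega>))\<^sup>2 = 0"
    by (subst (asm) integral_nonneg_eq_0_iff_AE) auto
  then show "AE \<omega> in P. W ?h \<omega> = a * W f \<omega> + b * W g \<omega>" by simp
qed

lemma moment_W_diff:
  assumes f: "f \<in> hermitian_L2" and g: "g \<in> hermitian_L2"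
  shows "(\<integral>\<^sup>+\<omega>. ennreal (\<bar>W f \<omega> - W g \<omega>\<bar> ^ (2 * k)) \<partial>P) =
    ennreal (fact (2 * k) / (2 ^ k * fact k) * (LINT \<xi>|lborel. (cmod (f \<xi> - g \<xi>))\<^sup>2) ^ k)"
proof -
  let ?G = "case_bool f g" and ?c = "case_bool 1 (-1) :: bool \<Rightarrow> real"
  have G: "?G i \<in> hermitian_L2" for i using f g by (auto split: bool.split)
  have S: "(\<Sum>i\<in>UNIV. ?c i * W (?G i) \<omega>) = W f \<omega> - W g \<omega>" for \<omega> by (simp add: UNIV_bool)
  have Z: "(\<Sum>i\<in>UNIV. complex_of_real (?c i) * ?G i \<xi>) = f \<xi> - g \<xi>" for \<xi> by (simp add: UNIV_bool)
  note M0 = centered_gaussian_moment[where k=k, OF gaussian_lincomb[where g="?G" and c="?c", OF finite G] expectation_lincomb[where J=UNIV and g="?G" and c="?c", OF G]]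
  note M = M0[unfolded S]
  have V: "expectation (\<lambda>\<omega>. (W f \<omega> - W g \<omega>)\<^sup>2) = (LINT \<xi>|lborel. (cmod (f \<xi> - g \<xi>))\<^sup>2)"
    using second_moment_lincomb[where J=UNIV and g="?G" and c="?c", OF G] unfolding S Z .
  have "(\<integral>\<^sup>+\<omega>. ennreal (\<bar>W f \<omega> - W g \<omega>\<bar> ^ (2 * k)) \<partial>P) = (\<integral>\<^sup>+\<omega>. ennreal ((W f \<omega> - W g \<omega>) ^ (2 * k)) \<partial>P)"
    by (simp add: power_even_abs)
  also have "\<dots> = ennreal (expectation (\<lambda>\<omega>. (W f \<omega> - W g \<omega>) ^ (2 * k)))"
    by (rule nn_integral_eq_integral[OF M(1)]) (simp add: zero_le_even_power)
  finally show ?thesis unfolding M(2) V .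
qed

text \<open>A centered Gaussian law is determined by its covariance, and the isometry turns the
  covariance into the pairing of the integrands. Agreement with the integrals is required only
  almost surely at each index, so the lemma applies to continuous modifications; \<open>G'\<close>
  will typically be the image of \<open>G\<close> under a unitary map.\<close>

lemma process_law_W_eqI:
  fixes Z Z' :: "'i \<Rightarrow> 'w \<Rightarrow> real"
  assumes G: "\<And>u. G u \<in> hermitian_L2" and G': "\<And>u. G' u \<in> hermitian_L2"
    and Z[measurable]: "\<And>u. Z u \<in> borel_measurable P" and Z'[measurable]: "\<And>u. Z' u \<in> borel_measurable P"
    and ZW: "\<And>u. AE \<omega> in P. Z u \<omega> = W (G u) \<omega>" and ZW': "\<And>u. AE \<omega> in P. Z' u \<omega> = W (G' u) \<omega>"
    and eq: "\<And>u v. (LINT \<xi>|lborel. G u \<xi> * cnj (G v \<xi>)) = (LINT \<xi>|lborel. G' u \<xi> * cnj (G' v \<xi>))"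
  shows "process_law P Z = process_law P Z'"
proof (rule process_law_eqI)
  fix J :: "'i set" and c :: "'i \<Rightarrow> real"
  assume J: "finite J"
  note [measurable] = measurable_W[OF G] measurable_W[OF G']
  have 1: "AE \<omega> in P. \<forall>j\<in>J. Z j \<omega> = W (G j) \<omega>" using J ZW by (intro AE_finite_allI)
  have 2: "AE \<omega> in P. \<forall>j\<in>J. Z' j \<omega> = W (G' j) \<omega>" using J ZW' by (intro AE_finite_allI)
  have "(LINT \<omega>|P. iexp (\<Sum>j\<in>J. c j * Z j \<omega>)) = (LINT \<omega>|P. iexp (\<Sum>j\<in>J. c j * W (G j) \<omega>))"
  proof (rule integral_cong_AE)
    show "AE \<omega> in P. iexp (\<Sum>j\<in>J. c j * Z j \<omega>) = iexp (\<Sum>j\<in>J. c j * W (G j) \<omega>)"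
      using 1 by eventually_elim simp
  qed measurable
  also have "\<dots> = exp (- complex_of_real (expectation (\<lambda>\<omega>. (\<Sum>j\<in>J. c j * W (G j) \<omega>)\<^sup>2)) / 2)"
    using centered_gaussian_char[OF gaussian_lincomb[where g=G and c=c, OF J G] expectation_lincomb[where g=G and c=c and J=J, OF G]] by (simp add: exp_of_real[symmetric])
  also have "complex_of_real (expectation (\<lambda>\<omega>. (\<Sum>j\<in>J. c j * W (G j) \<omega>)\<^sup>2)) =
      complex_of_real (expectation (\<lambda>\<omega>. (\<Sum>j\<in>J. c j * W (G' j) \<omega>)\<^sup>2))"
    unfolding second_moment_lincomb_double_sum[where g=G, OF G] second_moment_lincomb_double_sum[where g=G', OF G'] eq ..
  also have "exp (- complex_of_real (expectation (\<lambda>\<omega>. (\<Sum>j\<in>J. c j * W (G' j) \<omega>)\<^sup>2)) / 2) =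
      (LINT \<omega>|P. iexp (\<Sum>j\<in>J. c j * W (G' j) \<omega>))"
    using centered_gaussian_char[OF gaussian_lincomb[where g=G' and c=c, OF J G'] expectation_lincomb[where g=G' and c=c and J=J, OF G']] by (simp add: exp_of_real[symmetric])
  also have "\<dots> = (LINT \<omega>|P. iexp (\<Sum>j\<in>J. c j * Z' j \<omega>))"
  proof (rule integral_cong_AE)
    show "AE \<omega> in P. iexp (\<Sum>j\<in>J. c j * W (G' j) \<omega>) = iexp (\<Sum>j\<in>J. c j * Z' j \<omega>)"
      using 2 by eventually_elim simp
  qed measurable
  finally show "(LINT \<omega>|P. iexp (\<Sum>j\<in>J. c j * Z j \<omega>)) = (LINT \<omega>|P. iexp (\<Sum>j\<in>J. c j * Z' j \<omega>))" .
qed (auto intro: prob_space_axioms)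

end

section \<open>Interpolation and functionals on the space of continuous functions\<close>

definition hat :: "real \<Rightarrow> real" where
  "hat t = max 0 (1 - \<bar>t\<bar>)"

text \<open>Tensor products of hat functions form a partition of unity adapted to the dyadic mesh of
  width \<open>1 / 2 ^ n\<close>; interpolation with them is piecewise bilinear.\<close>

definition tent :: "nat \<Rightarrow> int \<times> int \<Rightarrow> real ^ 2 \<Rightarrow> real" where
  "tent n k u = hat (2 ^ n * u $ 1 - of_int (fst k)) * hat (2 ^ n * u $ 2 - of_int (snd k))"

definition node :: "nat \<Rightarrow> int \<times> int \<Rightarrow> real ^ 2" where
  "node n k = vector [of_int (fst k) / 2 ^ n, of_int (snd k) / 2 ^ n]"

definition grid :: "nat \<Rightarrow> nat \<Rightarrow> (int \<times> int) set" where
  "grid N n = {- (int N * 2 ^ n)..int N * 2 ^ n} \<times> {- (int N * 2 ^ n)..int N * 2 ^ n}"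

text \<open>The sum is cut off outside a square that grows with \<open>n\<close>, so that \<open>interp n f\<close> depends on
  finitely many values of \<open>f\<close>.\<close>

definition interp :: "nat \<Rightarrow> (real ^ 2 \<Rightarrow> real) \<Rightarrow> real ^ 2 \<Rightarrow> real" where
  "interp n f u = (\<Sum>k\<in>grid (Suc n) n. f (node n k) * tent n k u)"

lemma finite_grid [simp]: "finite (grid N n)"
  by (simp add: grid_def)

lemma hat_nonneg: "0 \<le> hat t" by (simp add: hat_def)

lemma hat_neq_0: "hat t \<noteq> 0 \<Longrightarrow> \<bar>t\<bar> < 1" by (auto simp: hat_def max_def split: if_splits)

lemma continuous_on_hat: "continuous_on S hat"
  unfolding hat_def by (intro continuous_intros)

lemma tent_nonneg: "0 \<le> tent n k u" by (simp add: tent_def hat_nonneg)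

lemma tent_neq_0:
  assumes "tent n k u \<noteq> 0"
  shows "\<bar>2 ^ n * u $ 1 - of_int (fst k)\<bar> < 1" "\<bar>2 ^ n * u $ 2 - of_int (snd k)\<bar> < 1"
  using assms by (auto simp: tent_def hat_neq_0)

lemma continuous_on_tent: "continuous_on S (tent n k)"
proof -
  have "continuous_on S (\<lambda>u :: real ^ 2. hat (2 ^ n * u $ i - c))" for i c
    by (rule continuous_on_compose2[OF continuous_on_hat[of UNIV]]) (auto intro!: continuous_intros)
  then show ?thesis unfolding tent_def by (intro continuous_on_mult)
qed

lemma sum_hat:
  fixes m :: int
  assumes "\<bar>t\<bar> \<le> of_int m"
  shows "(\<Sum>k\<in>{-m..m}. hat (t - of_int k)) = 1"
proof -
  define j where "j = \<lfloor>t\<rfloor>"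
  have j: "of_int j \<le> t" "t < of_int j + 1" unfolding j_def by linarith+
  have "- m \<le> j" "j \<le> m" using assms j by linarith+
  \<comment> \<open>Only the two integers around \<open>t\<close> contribute. For
    \<open>t = m\<close> the upper one leaves the range, so the range is enlarged by an index at
    which the hat vanishes.\<close>
  have "(\<Sum>k\<in>{-m..m}. hat (t - of_int k)) = (\<Sum>k\<in>{-m..m + 1}. hat (t - of_int k))"
  proof (rule sum.mono_neutral_left)
    show "\<forall>k\<in>{- m..m + 1} - {- m..m}. hat (t - of_int k) = 0"
    proof
      fix k assume "k \<in> {- m..m + 1} - {- m..m}"
      then have "k = m + 1" by auto
      then show "hat (t - of_int k) = 0" using assms by (auto simp: hat_def)
    qed
  qed auto
  also have "\<dots> = (\<Sum>k\<in>{j, j + 1}. hat (t - of_int k))"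
  proof (rule sum.mono_neutral_right)
    show "{j, j + 1} \<subseteq> {- m..m + 1}" using \<open>- m \<le> j\<close> \<open>j \<le> m\<close> by auto
    show "\<forall>k\<in>{- m..m + 1} - {j, j + 1}. hat (t - of_int k) = 0"
    proof
      fix k assume "k \<in> {- m..m + 1} - {j, j + 1}"
      then have "k \<le> j - 1 \<or> j + 2 \<le> k" by auto
      then have "real_of_int k \<le> of_int j - 1 \<or> of_int j + 2 \<le> real_of_int k" by linarith
      then show "hat (t - of_int k) = 0" using j by (auto simp: hat_def)
    qed
  qed auto
  also have "\<dots> = 1" using j by (simp add: hat_def)
  finally show ?thesis .
qed

lemma sum_tent:
  assumes "\<bar>u $ 1\<bar> \<le> real N" "\<bar>u $ 2\<bar> \<le> real N"
  shows "(\<Sum>k\<in>grid N n. tent n k u) = 1"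
proof -
  have a: "\<bar>2 ^ n * u $ i\<bar> \<le> of_int (int N * 2 ^ n)" if "\<bar>u $ i\<bar> \<le> real N" for i
    using that by (simp add: abs_mult mult.commute)
  have "(\<Sum>k\<in>grid N n. tent n k u) =
     (\<Sum>i\<in>{- (int N * 2 ^ n)..int N * 2 ^ n}. hat (2 ^ n * u $ 1 - of_int i)) *
     (\<Sum>i\<in>{- (int N * 2 ^ n)..int N * 2 ^ n}. hat (2 ^ n * u $ 2 - of_int i))"
    unfolding sum_product sum.cartesian_product grid_def tent_def by (simp add: case_prod_unfold)
  then show ?thesis unfolding sum_hat[OF a[OF assms(1)]] sum_hat[OF a[OF assms(2)]] by simp
qed

lemma norm_real2_le: "norm (v :: real ^ 2) \<le> \<bar>v $ 1\<bar> + \<bar>v $ 2\<bar>"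
  using norm_le_l1_cart[of v] by (simp add: sum_2)

lemma dist_node_le:
  assumes "tent n k u \<noteq> 0"
  shows "dist (node n k) u \<le> 2 / 2 ^ n"
proof -
  have "\<bar>c / 2 ^ n - v\<bar> \<le> 1 / 2 ^ n" if "\<bar>2 ^ n * v - c\<bar> < 1" for c v :: real
  proof -
    have "\<bar>c / 2 ^ n - v\<bar> = \<bar>2 ^ n * v - c\<bar> / 2 ^ n"
    proof -
      have "c / 2 ^ n - v = - ((2 ^ n * v - c) / 2 ^ n)" by (simp add: diff_divide_distrib)
      then show ?thesis by (simp only: abs_minus_cancel abs_divide) simp
    qed
    then show ?thesis using that by (simp add: divide_right_mono)
  qed
  from this[OF tent_neq_0(1)[OF assms]] this[OF tent_neq_0(2)[OF assms]] show ?thesis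
    using norm_real2_le[of "node n k - u"] by (simp add: dist_norm node_def)
qed

lemma weighted_average_close:
  fixes a w :: "'k \<Rightarrow> real"
  assumes "\<And>k. k \<in> A \<Longrightarrow> 0 \<le> w k" "(\<Sum>k\<in>A. w k) = 1"
    and "\<And>k. k \<in> A \<Longrightarrow> w k \<noteq> 0 \<Longrightarrow> \<bar>a k - c\<bar> \<le> e"
  shows "\<bar>(\<Sum>k\<in>A. a k * w k) - c\<bar> \<le> e"
proof -
  have "(\<Sum>k\<in>A. a k * w k) - c = (\<Sum>k\<in>A. (a k - c) * w k)"
    using assms(2) by (simp add: left_diff_distrib sum_subtractf sum_distrib_left[symmetric])
  also have "\<bar>\<dots>\<bar> \<le> (\<Sum>k\<in>A. \<bar>(a k - c) * w k\<bar>)" by (rule sum_abs)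
  also have "\<dots> \<le> (\<Sum>k\<in>A. e * w k)"
  proof (rule sum_mono)
    fix k assume k: "k \<in> A"
    show "\<bar>(a k - c) * w k\<bar> \<le> e * w k"
      using assms(1,3)[OF k] by (cases "w k = 0") (auto simp: abs_mult intro!: mult_right_mono)
  qed
  also have "\<dots> = e" using assms(2) by (simp add: sum_distrib_left[symmetric])
  finally show ?thesis .
qed

lemma component_le_Suc:
  assumes "norm (u :: real ^ 2) \<le> real N" "N \<le> n"
  shows "\<bar>u $ i\<bar> \<le> real n"
  using component_le_norm_cart[of u i] assms by linarith

lemma continuous_on_interp: "continuous_on S (interp n f)"
  unfolding interp_def by (intro continuous_intros continuous_on_tent)

text \<open>Once \<open>n\<close> exceeds the radius of \<open>K\<close>, the cut-off of the sum is
  invisible on \<open>K\<close>, and the interpolant at \<open>u\<close> is an average of values of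
  \<open>f\<close> at nodes within distance \<open>2 / 2 ^ n\<close> of \<open>u\<close>. Uniform
  continuity on a slightly larger ball concludes.\<close>

lemma uniform_limit_interp:
  assumes f: "continuous_on UNIV f" and K: "compact K"
  shows "uniform_limit K (\<lambda>n. interp n f) f sequentially"
proof (rule uniform_limitI)
  fix e :: real assume e: "0 < e"
  obtain B where B: "\<And>u. u \<in> K \<Longrightarrow> norm u \<le> B" using compact_imp_bounded[OF K] by (auto simp: bounded_iff)
  obtain N :: nat where N: "B \<le> real N" using real_arch_simple by blast
  \<comment> \<open>The margin 2 bounds the distance \<open>2 / 2 ^ n\<close> of the contributing
    nodes for every \<open>n\<close>.\<close>
  have "uniformly_continuous_on (cball 0 (real N + 2)) f"
    by (rule compact_uniformly_continuous) (auto intro: continuous_on_subset[OF f])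
  then obtain d where d: "d > 0" "\<And>u v. u \<in> cball 0 (real N + 2) \<Longrightarrow> v \<in> cball 0 (real N + 2) \<Longrightarrow> dist v u < d \<Longrightarrow> dist (f v) (f u) < e / 2"
    unfolding uniformly_continuous_on_def using e by (metis half_gt_zero)
  have "(\<lambda>n. 2 * (1 / 2) ^ n :: real) \<longlonglongrightarrow> 2 * 0" by (intro tendsto_mult_left LIMSEQ_realpow_zero) auto
  then have "\<forall>\<^sub>F n in sequentially. 2 * (1 / 2) ^ n < d" using d(1) by (intro order_tendstoD(2)) auto
  then show "\<forall>\<^sub>F n in sequentially. \<forall>u\<in>K. dist (interp n f u) (f u) < e"
    using eventually_ge_at_top[of N]
  proof eventually_elim
    case (elim n)
    show ?case
    proof
      fix u assume u: "u \<in> K"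
      have nu: "norm u \<le> real N" using B[OF u] N by linarith
      have "\<bar>(\<Sum>k\<in>grid (Suc n) n. f (node n k) * tent n k u) - f u\<bar> \<le> e / 2"
      proof (rule weighted_average_close)
        show "(\<Sum>k\<in>grid (Suc n) n. tent n k u) = 1"
          by (rule sum_tent; rule component_le_Suc[OF nu]) (use elim in auto)
        fix k assume "tent n k u \<noteq> 0"
        from dist_node_le[OF this] have c: "dist (node n k) u \<le> 2 / 2 ^ n" .
        have "2 / 2 ^ n \<le> (2 :: real)" by (simp add: divide_le_eq)
        then have nb: "norm (node n k) \<le> real N + 2"
          using c nu norm_triangle_sub[of "node n k" u] by (simp add: dist_norm)
        have "2 / 2 ^ n < d" using elim(1) by (simp add: power_one_over)
        then have "dist (node n k) u < d" using c by linarith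
        then have "dist (f (node n k)) (f u) < e / 2" using nu nb by (intro d(2)) auto
        then show "\<bar>f (node n k) - f u\<bar> \<le> e / 2" by (simp add: dist_real_def)
      qed (rule tent_nonneg)
      then show "dist (interp n f u) (f u) < e" using e by (simp add: interp_def dist_real_def)
    qed
  qed
qed

section \<open>Continuous functionals for the compact-open topology\<close>

lemma topspace_compact_open: "topspace compact_open = {f. continuous_on UNIV f}"
proof -
  have "{f. continuous_on UNIV f} \<in> {{f. continuous_on UNIV f \<and> f ` K \<subseteq> U} | K U. compact K \<and> open U}"
    by (rule CollectI, rule exI[of _ "{}"], rule exI[of _ "{}"]) auto
  then show ?thesis unfolding compact_open_def topology_generated_by_topspace by auto
qed

text \<open>Convergence needs checking only on the generating sets: the compact image
  \<open>g\<close>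
  K\<open>has a positive distance of security inside the open set\<close>V\<open>, and uniform closeness on\<close>K\<open>keeps\<close>f
  i \<open>K\<close> inside \<open>V\<close>. Finite intersections and unions follow by induction on
  the generated topology.\<close>

lemma limitin_compact_openI:
  fixes f :: "'i \<Rightarrow> 'a::topological_space \<Rightarrow> 'b::metric_space"
  assumes g: "continuous_on UNIV g" and f: "\<forall>\<^sub>F i in F. continuous_on UNIV (f i)"
    and lim: "\<And>K. compact K \<Longrightarrow> uniform_limit K f g F"
  shows "limitin compact_open f g F"
  unfolding limitin_def
proof (intro conjI allI impI)
  show "g \<in> topspace compact_open" using g by (simp add: topspace_compact_open)
  fix U assume "openin compact_open U \<and> g \<in> U"
  then have U: "generate_topology_on {{f. continuous_on UNIV f \<and> f ` K \<subseteq> U} | K U. compact K \<and> open U} U" and gU: "g \<in> U"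
    by (auto simp: compact_open_def openin_topology_generated_by_iff)
  from U gU show "\<forall>\<^sub>F i in F. f i \<in> U"
  proof induction
    case Empty
    then show ?case by simp
  next
    case (Int a b)
    then show ?case by (auto intro: eventually_conj)
  next
    case (UN K)
    then obtain k where "k \<in> K" "g \<in> k" by auto
    then show ?case using UN.IH[of k] by (auto elim!: eventually_mono)
  next
    case (Basis s)
    then obtain K V where s: "s = {f. continuous_on UNIV f \<and> f ` K \<subseteq> V}" and K: "compact K" and V: "open V" by auto
    have gK: "compact (g ` K)" "g ` K \<subseteq> V"
      using Basis(2) s K by (auto intro!: compact_continuous_image continuous_on_subset[OF g])
    obtain e where e: "e > 0" "\<And>x y. x \<in> g ` K \<Longrightarrow> dist x y < e \<Longrightarrow> y \<in> V"
    proof (cases "g ` K = {}")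
      case True
      then show thesis using that[of 1] by simp
    next
      case False
      obtain e where "e > 0" "(\<Union>x\<in>g ` K. ball x e) \<subseteq> V"
        using compact_subset_open_imp_ball_epsilon_subset[OF gK(1) V gK(2)] by blast
      then show thesis by (intro that[of e]) (auto simp: mem_ball subset_iff)
    qed
    have "\<forall>\<^sub>F i in F. \<forall>x\<in>K. dist (f i x) (g x) < e" using lim[OF K] e(1) by (rule uniform_limitD)
    then show ?case using f
      by eventually_elim (auto simp: s dist_commute intro!: e(2))
  qed
qed

lemma tendsto_compact_open_functional:
  fixes f :: "'i \<Rightarrow> 'a::topological_space \<Rightarrow> 'b::metric_space"
  assumes \<Phi>: "continuous_map compact_open euclideanreal \<Phi>"
    and "continuous_on UNIV g" "\<forall>\<^sub>F i in F. continuous_on UNIV (f i)"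
    and "\<And>K. compact K \<Longrightarrow> uniform_limit K f g F"
  shows "((\<lambda>i. \<Phi> (f i)) \<longlongrightarrow> \<Phi> g) F"
  using continuous_map_limit[OF \<Phi> limitin_compact_openI[OF assms(2-4)]] by (simp add: o_def)

lemma measurable_interp_functional:
  assumes \<Phi>: "continuous_map compact_open euclideanreal \<Phi>"
  shows "(\<lambda>a. \<Phi> (interp n a)) \<in> borel_measurable (Pi\<^sub>M UNIV (\<lambda>_. borel))"
proof -
  \<comment> \<open>The detour through coefficients indexed by pairs of integers has a reason: over
    a countable index set the product sigma-algebra is the Borel sigma-algebra, so continuity of
    \<open>\<Phi>\<close> composed with \<open>J\<close> gives measurability. The index set of the
    paths themselves is uncountable.\<close>
  define J where "J a u = (\<Sum>k\<in>grid (Suc n) n. a k * tent n k u)" for a u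
  have cJ: "continuous_on UNIV (J a)" for a
    unfolding J_def by (intro continuous_intros continuous_on_tent)
  have "continuous_on UNIV (\<lambda>a. \<Phi> (J a))"
  proof (unfold continuous_on_sequentially, intro allI ballI impI, elim conjE)
    fix x :: "nat \<Rightarrow> int \<times> int \<Rightarrow> real" and a
    assume lim: "x \<longlonglongrightarrow> a"
    have "(\<lambda>i. \<Phi> (J (x i))) \<longlonglongrightarrow> \<Phi> (J a)"
    proof (rule tendsto_compact_open_functional[OF \<Phi> cJ])
      fix K :: "(real ^ 2) set" assume K: "compact K"
      have term_lim: "uniform_limit K (\<lambda>i u. x i k * tent n k u) (\<lambda>u. a k * tent n k u) sequentially" for k
      proof (rule uniform_lim_mult)
        have "(\<lambda>i. x i k) \<longlonglongrightarrow> a k"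
          by (rule continuous_on_tendsto_compose[OF continuous_on_product_coordinates lim]) auto
        then show "uniform_limit K (\<lambda>i u. x i k) (\<lambda>u. a k) sequentially" by (auto simp: uniform_limit_iff tendsto_iff elim!: eventually_mono)
        show "uniform_limit K (\<lambda>i. tent n k) (tent n k) sequentially" by (rule uniform_limit_const)
        show "bounded (tent n k ` K)"
          by (intro compact_imp_bounded compact_continuous_image continuous_on_tent K)
        show "bounded ((\<lambda>u. a k) ` K)" by (rule bounded_subset[of "{a k}"]) auto
      qed
      have "uniform_limit K (\<lambda>i u. \<Sum>k\<in>A. x i k * tent n k u) (\<lambda>u. \<Sum>k\<in>A. a k * tent n k u) sequentially" if "finite A" for A
        using that by induction (auto intro!: uniform_limit_const uniform_limit_add term_lim)
      then show "uniform_limit K (\<lambda>i. J (x i)) (J a) sequentially"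
        unfolding J_def by simp
    qed (use cJ in auto)
    then show "((\<lambda>a. \<Phi> (J a)) \<circ> x) \<longlonglongrightarrow> \<Phi> (J a)" by (simp add: o_def)
  qed
  then have "(\<lambda>a. \<Phi> (J a)) \<in> borel_measurable borel" by (rule borel_measurable_continuous_onI)
  then have m[measurable]: "(\<lambda>a. \<Phi> (J a)) \<in> borel_measurable (Pi\<^sub>M UNIV (\<lambda>_. borel))"
    by (simp add: measurable_cong_sets[OF sets_PiM_equal_borel refl])
  have "(\<lambda>a k. a (node n k)) \<in> Pi\<^sub>M UNIV (\<lambda>_. borel) \<rightarrow>\<^sub>M Pi\<^sub>M UNIV (\<lambda>_. borel :: real measure)"
    by (rule measurable_PiM_single') auto
  from measurable_compose[OF this m]
  have "(\<lambda>a. \<Phi> (J (\<lambda>k. a (node n k)))) \<in> borel_measurable (Pi\<^sub>M UNIV (\<lambda>_. borel))" .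
  moreover have "J (\<lambda>k. a (node n k)) = interp n a" for a
    by (simp add: J_def interp_def fun_eq_iff)
  ultimately show ?thesis by (simp only:)
qed

lemma measurable_paths:
  assumes "\<And>u. Z u \<in> borel_measurable P"
  shows "(\<lambda>\<omega> u. Z u \<omega>) \<in> P \<rightarrow>\<^sub>M Pi\<^sub>M UNIV (\<lambda>_. borel)"
  using assms by (intro measurable_PiM_single') auto

lemma measurable_path_functional:
  fixes Z :: "real ^ 2 \<Rightarrow> 'w \<Rightarrow> real"
  assumes \<Phi>: "continuous_map compact_open euclideanreal \<Phi>"
    and Z: "\<And>u. Z u \<in> borel_measurable P"
    and cont: "\<And>\<omega>. \<omega> \<in> space P \<Longrightarrow> continuous_on UNIV (\<lambda>u. Z u \<omega>)"
  shows "(\<lambda>\<omega>. \<Phi> (\<lambda>u. Z u \<omega>)) \<in> borel_measurable P"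
proof (rule borel_measurable_LIMSEQ_real)
  show "(\<lambda>n. \<Phi> (interp n (\<lambda>u. Z u \<omega>))) \<longlonglongrightarrow> \<Phi> (\<lambda>u. Z u \<omega>)" if "\<omega> \<in> space P" for \<omega>
    using that by (intro tendsto_compact_open_functional[OF \<Phi>] cont)
      (auto intro!: uniform_limit_interp cont continuous_on_interp always_eventually)
  show "(\<lambda>\<omega>. \<Phi> (interp n (\<lambda>u. Z u \<omega>))) \<in> borel_measurable P" for n
    by (rule measurable_compose[OF measurable_paths[OF Z] measurable_interp_functional[OF \<Phi>]])
qed

text \<open>The law on the product sigma-algebra determines the integrals of \<open>\<Phi>\<close>
  applied to interpolants, since these depend on finitely many coordinates. Both sides of the claim
  are limits of such integrals by dominated convergence, the paths being continuous and
  \<open>\<Phi>\<close> bounded on continuous functions.\<close>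

lemma integral_path_functional_eqI:
  fixes Z :: "real ^ 2 \<Rightarrow> 'w \<Rightarrow> real" and V :: "real ^ 2 \<Rightarrow> 'v \<Rightarrow> real"
  assumes P: "prob_space P" and Q: "prob_space Q"
    and \<Phi>: "continuous_map compact_open euclideanreal \<Phi>" and bd: "bounded (\<Phi> ` topspace compact_open)"
    and Z: "\<And>u. Z u \<in> borel_measurable P" "\<And>\<omega>. \<omega> \<in> space P \<Longrightarrow> continuous_on UNIV (\<lambda>u. Z u \<omega>)"
    and V: "\<And>u. V u \<in> borel_measurable Q" "\<And>\<omega>. \<omega> \<in> space Q \<Longrightarrow> continuous_on UNIV (\<lambda>u. V u \<omega>)"
    and law: "process_law P Z = process_law Q V"
  shows "(LINT \<omega>|P. \<Phi> (\<lambda>u. Z u \<omega>)) = (LINT \<omega>|Q. \<Phi> (\<lambda>u. V u \<omega>))"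
proof -
  obtain B where B: "\<And>f. continuous_on UNIV f \<Longrightarrow> norm (\<Phi> f) \<le> B"
    using bd by (auto simp: bounded_iff topspace_compact_open)
  have lim: "(\<lambda>n. LINT \<omega>|R. \<Phi> (interp n (\<lambda>u. T u \<omega>))) \<longlonglongrightarrow> (LINT \<omega>|R. \<Phi> (\<lambda>u. T u \<omega>))"
    and step: "(LINT \<omega>|R. \<Phi> (interp n (\<lambda>u. T u \<omega>))) = (LINT a|process_law R T. \<Phi> (interp n a))"
    if R: "prob_space R" and T: "\<And>u. T u \<in> borel_measurable R" "\<And>\<omega>. \<omega> \<in> space R \<Longrightarrow> continuous_on UNIV (\<lambda>u. T u \<omega>)"
    for R :: "'z measure" and T n
  proof -
    interpret R: prob_space R by fact
    show "(\<lambda>n. LINT \<omega>|R. \<Phi> (interp n (\<lambda>u. T u \<omega>))) \<longlonglongrightarrow> (LINT \<omega>|R. \<Phi> (\<lambda>u. T u \<omega>))"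
    proof (rule integral_dominated_convergence[where w="\<lambda>_. B"])
      show "(\<lambda>\<omega>. \<Phi> (\<lambda>u. T u \<omega>)) \<in> borel_measurable R" by (rule measurable_path_functional[OF \<Phi> T])
      show "(\<lambda>\<omega>. \<Phi> (interp n (\<lambda>u. T u \<omega>))) \<in> borel_measurable R" for n
        by (rule measurable_compose[OF measurable_paths[OF T(1)] measurable_interp_functional[OF \<Phi>]])
      show "AE \<omega> in R. (\<lambda>n. \<Phi> (interp n (\<lambda>u. T u \<omega>))) \<longlonglongrightarrow> \<Phi> (\<lambda>u. T u \<omega>)"
        by (rule AE_I2, rule tendsto_compact_open_functional[OF \<Phi>])
          (auto intro!: uniform_limit_interp T(2) continuous_on_interp always_eventually)
      show "AE \<omega> in R. norm (\<Phi> (interp n (\<lambda>u. T u \<omega>))) \<le> B" for n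
        by (rule AE_I2, rule B, rule continuous_on_interp)
    qed simp
    show "(LINT \<omega>|R. \<Phi> (interp n (\<lambda>u. T u \<omega>))) = (LINT a|process_law R T. \<Phi> (interp n a))"
      unfolding process_law_def
      by (rule integral_distr[symmetric, OF measurable_paths[OF T(1)] measurable_interp_functional[OF \<Phi>]])
  qed
  have lP: "(\<lambda>n. LINT \<omega>|P. \<Phi> (interp n (\<lambda>u. Z u \<omega>))) \<longlonglongrightarrow> (LINT \<omega>|P. \<Phi> (\<lambda>u. Z u \<omega>))"
    by (rule lim) (use P Z in auto)
  have lQ: "(\<lambda>n. LINT \<omega>|Q. \<Phi> (interp n (\<lambda>u. V u \<omega>))) \<longlonglongrightarrow> (LINT \<omega>|Q. \<Phi> (\<lambda>u. V u \<omega>))"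
    by (rule lim) (use Q V in auto)
  have sP: "(LINT \<omega>|P. \<Phi> (interp n (\<lambda>u. Z u \<omega>))) = (LINT a|process_law P Z. \<Phi> (interp n a))" for n
    by (rule step) (use P Z in auto)
  have sQ: "(LINT \<omega>|Q. \<Phi> (interp n (\<lambda>u. V u \<omega>))) = (LINT a|process_law Q V. \<Phi> (interp n a))" for n
    by (rule step) (use Q V in auto)
  show ?thesis
    using lQ unfolding sQ law[symmetric] sP[symmetric] by (rule LIMSEQ_unique[OF lP])
qed

section \<open>Kolmogorov's criterion\<close>

text \<open>Two tents of levels \<open>n\<close> and \<open>Suc n\<close> that are both nonzero at
  one point have indices \<open>k\<close> and \<open>l\<close> whose coordinates satisfy |l - 2k| <
  3, so the window of offsets catches every pair of nodes that meet there. Its 49 elements reappear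
  in the constants.\<close>

definition mesh_increments :: "nat \<Rightarrow> nat \<Rightarrow> nat \<Rightarrow> (real ^ 2 \<Rightarrow> real) \<Rightarrow> real" where
  "mesh_increments q N n f = (\<Sum>k\<in>grid (Suc N) n. \<Sum>j\<in>{-3..3} \<times> {-3..3}.
     \<bar>f (node (Suc n) (2 * fst k + fst j, 2 * snd k + snd j)) - f (node n k)\<bar> ^ q)"

lemma mesh_increments_nonneg: "0 \<le> mesh_increments q N n f"
  by (auto simp: mesh_increments_def intro!: sum_nonneg)

text \<open>Either \<open>x \<le> r\<close>, or \<open>x * r ^ (q - 1) \<le> x ^ q\<close>. The
  bound is linear in \<open>S\<close>, so it can be integrated directly against q-th moments,
  without roots or exceptional events; \<open>r\<close> remains free for balancing.\<close>

lemma le_add_power_quotient: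
  fixes x r S :: real
  assumes "0 \<le> x" "0 < r" "1 \<le> q" "x ^ q \<le> S"
  shows "x \<le> r + S / r ^ (q - 1)"
proof (cases "x \<le> r")
  case True
  have "0 \<le> S" using assms by (meson order_trans zero_le_power)
  then show ?thesis using True assms(2) by (simp add: add_increasing2)
next
  case False
  have "x * r ^ (q - 1) \<le> x * x ^ (q - 1)"
    using False assms by (intro mult_left_mono power_mono) auto
  also have "\<dots> = x ^ q" using assms(3) by (cases q) auto
  finally have "x * r ^ (q - 1) \<le> S" using assms by linarith
  then have "x \<le> S / r ^ (q - 1)" using assms(2) by (simp add: pos_le_divide_eq)
  then show ?thesis using assms by linarith
qed

lemma tent_support_grid:
  assumes u: "norm u \<le> real N" and t: "tent n k u \<noteq> 0"
  shows "k \<in> grid (Suc N) n"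
proof -
  have *: "- (int (Suc N) * 2 ^ n) \<le> m \<and> m \<le> int (Suc N) * 2 ^ n" if "\<bar>2 ^ n * v - of_int m\<bar> < 1" "\<bar>v\<bar> \<le> real N" for v m
  proof -
    have "\<bar>2 ^ n * v\<bar> \<le> 2 ^ n * real N" using that(2) by (simp add: abs_mult)
    moreover have "(1::real) \<le> 2 ^ n" by simp
    ultimately have "\<bar>real_of_int m\<bar> \<le> 2 ^ n * real N + 2 ^ n" using that(1) by linarith
    also have "\<dots> = of_int (int (Suc N) * 2 ^ n)" by (simp add: algebra_simps)
    finally have "\<bar>m\<bar> \<le> int (Suc N) * 2 ^ n" by linarith
    then show ?thesis by linarith
  qed
  have "\<bar>u $ i\<bar> \<le> real N" for i using component_le_Suc[OF u order_refl] .
  from *[OF tent_neq_0(1)[OF t] this] *[OF tent_neq_0(2)[OF t] this] show ?thesis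
    by (simp add: grid_def mem_Times_iff)
qed

text \<open>At \<open>u\<close> both interpolants are convex combinations of node values, and every
  coarse node in play differs from every fine one by an increment counted in
  \<open>mesh_increments\<close>. Averaging first over the fine nodes and then over the coarse ones
  keeps the bound.\<close>

lemma interp_step:
  assumes u: "norm u \<le> real N" and n: "N \<le> n" and q: "1 \<le> q" and r: "0 < r"
  shows "\<bar>interp (Suc n) f u - interp n f u\<bar> \<le> r + mesh_increments q N n f / r ^ (q - 1)" (is "_ \<le> ?e")
proof -
  have close: "\<bar>f (node (Suc n) l) - f (node n k)\<bar> \<le> ?e" if l: "tent (Suc n) l u \<noteq> 0" and k: "tent n k u \<noteq> 0" for l k
  proof (rule le_add_power_quotient[OF _ r q])
    define j where "j = (fst l - 2 * fst k, snd l - 2 * snd k)"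
    have "\<bar>real_of_int (a - 2 * b)\<bar> < 3" if "\<bar>2 ^ Suc n * v - of_int a\<bar> < 1" "\<bar>2 ^ n * v - of_int b\<bar> < 1" for a b and v :: real
      using that by simp
    from this[OF tent_neq_0(1)[OF l] tent_neq_0(1)[OF k]] this[OF tent_neq_0(2)[OF l] tent_neq_0(2)[OF k]]
    have j: "j \<in> {-3..3} \<times> {-3..3}" unfolding j_def by auto
    have leq: "l = (2 * fst k + fst j, 2 * snd k + snd j)" by (simp add: j_def)
    let ?t = "\<lambda>k j. \<bar>f (node (Suc n) (2 * fst k + fst j, 2 * snd k + snd j)) - f (node n k)\<bar> ^ q"
    have "\<bar>f (node (Suc n) l) - f (node n k)\<bar> ^ q = ?t k j" using leq by simp
    also have "\<dots> \<le> (\<Sum>j\<in>{-3..3} \<times> {-3..3}. ?t k j)" using j by (intro member_le_sum) auto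
    also have "\<dots> \<le> mesh_increments q N n f"
      unfolding mesh_increments_def using tent_support_grid[OF u k]
      by (intro member_le_sum[where f="\<lambda>k. \<Sum>j\<in>{-3..3} \<times> {-3..3}. ?t k j"]) (auto intro!: sum_nonneg)
    finally show "\<bar>f (node (Suc n) l) - f (node n k)\<bar> ^ q \<le> mesh_increments q N n f" .
  qed simp
  have comp: "\<bar>u $ i\<bar> \<le> real (Suc n)" "\<bar>u $ i\<bar> \<le> real (Suc (Suc n))" for i
    by (rule component_le_Suc[OF u]; use n in simp)+
  have "\<bar>(\<Sum>k\<in>grid (Suc n) n. f (node n k) * tent n k u) - interp (Suc n) f u\<bar> \<le> ?e"
  proof (rule weighted_average_close)
    fix k assume k: "tent n k u \<noteq> 0"
    have "\<bar>interp (Suc n) f u - f (node n k)\<bar> \<le> ?e"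
      unfolding interp_def
      by (rule weighted_average_close) (use close k comp sum_tent tent_nonneg in auto)
    then show "\<bar>f (node n k) - interp (Suc n) f u\<bar> \<le> ?e" by (simp add: abs_minus_commute)
  qed (use comp sum_tent tent_nonneg in auto)
  then show ?thesis by (simp add: interp_def abs_minus_commute)
qed

lemma interp_base:
  assumes u: "norm u \<le> real N" and q: "1 \<le> q"
  shows "\<bar>interp N f u\<bar> \<le> (\<Sum>k\<in>grid (Suc N) N. 1 + \<bar>f (node N k)\<bar> ^ q)"
proof -
  have comp: "\<bar>u $ i\<bar> \<le> real (Suc N)" for i by (rule component_le_Suc[OF u]) simp
  have "\<bar>(\<Sum>k\<in>grid (Suc N) N. f (node N k) * tent N k u) - 0\<bar> \<le> (\<Sum>k\<in>grid (Suc N) N. 1 + \<bar>f (node N k)\<bar> ^ q)"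
  proof (rule weighted_average_close)
    fix k assume k: "k \<in> grid (Suc N) N"
    have "\<bar>f (node N k)\<bar> \<le> 1 + \<bar>f (node N k)\<bar> ^ q"
      using le_add_power_quotient[of "\<bar>f (node N k)\<bar>" 1 q] q by simp
    also have "\<dots> \<le> (\<Sum>k\<in>grid (Suc N) N. 1 + \<bar>f (node N k)\<bar> ^ q)"
      using k by (intro member_le_sum) auto
    finally show "\<bar>f (node N k) - 0\<bar> \<le> (\<Sum>k\<in>grid (Suc N) N. 1 + \<bar>f (node N k)\<bar> ^ q)" by simp
  qed (use comp sum_tent tent_nonneg in auto)
  then show ?thesis by (simp add: interp_def)
qed

text \<open>This compares the interpolant with the value at a given point, without continuity of
  \<open>f\<close>; it serves to identify the limit of the interpolants with the original process at
  each point. The q-th root only brings the statement into the form of a weighted average.\<close>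

lemma interp_error:
  assumes u: "norm u \<le> real N" and n: "N \<le> n" and q: "1 \<le> q"
  shows "\<bar>interp n f u - f u\<bar> ^ q \<le> (\<Sum>k\<in>{k\<in>grid (Suc N) n. tent n k u \<noteq> 0}. \<bar>f (node n k) - f u\<bar> ^ q)" (is "_ \<le> ?S")
proof -
  have S: "0 \<le> ?S" by (auto intro!: sum_nonneg)
  have comp: "\<bar>u $ i\<bar> \<le> real (Suc n)" for i by (rule component_le_Suc[OF u]; use n in simp)
  have "\<bar>(\<Sum>k\<in>grid (Suc n) n. f (node n k) * tent n k u) - f u\<bar> \<le> root q ?S"
  proof (rule weighted_average_close)
    fix k assume k: "tent n k u \<noteq> 0"
    have "\<bar>f (node n k) - f u\<bar> ^ q \<le> ?S"
      using tent_support_grid[OF u k] k by (intro member_le_sum[where f="\<lambda>k. \<bar>f (node n k) - f u\<bar> ^ q"]) auto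
    then have "root q (\<bar>f (node n k) - f u\<bar> ^ q) \<le> root q ?S" using q by (intro real_root_le_mono) auto
    then show "\<bar>f (node n k) - f u\<bar> \<le> root q ?S" using q by (simp add: real_root_power_cancel)
  qed (use comp sum_tent tent_nonneg in auto)
  then have "\<bar>interp n f u - f u\<bar> ^ q \<le> root q ?S ^ q" by (intro power_mono) (auto simp: interp_def)
  then show ?thesis using S q by simp
qed

lemma card_grid_le: "real (card (grid N n)) \<le> (4 * real N + 1) ^ 2 * 4 ^ n"
proof -
  have "card (grid N n) = (card {- (int N * 2 ^ n)..int N * 2 ^ n})\<^sup>2"
    by (simp add: grid_def card_cartesian_product power2_eq_square)
  also have "card {- (int N * 2 ^ n)..int N * 2 ^ n} = 2 * N * 2 ^ n + 1"
    by (simp add: nat_add_distrib nat_mult_distrib nat_power_eq)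
  finally have "real (card (grid N n)) = (2 * real N * 2 ^ n + 1)\<^sup>2" by simp
  also have "\<dots> \<le> ((4 * real N + 1) * 2 ^ n)\<^sup>2"
    by (intro power_mono) (auto simp: algebra_simps add_mono)
  also have "\<dots> = (4 * real N + 1) ^ 2 * 4 ^ n"
  proof -
    have "((2::real) ^ n)\<^sup>2 = 4 ^ n" by (simp add: power2_eq_square flip: power_mult_distrib)
    then show ?thesis by (simp only: power_mult_distrib)
  qed
  finally show ?thesis .
qed

lemma norm_node_le:
  assumes "k \<in> grid N n"
  shows "norm (node n k) \<le> 2 * real N"
proof -
  have "\<bar>of_int m / 2 ^ n\<bar> \<le> real N" if "- (int N * 2 ^ n) \<le> m" "m \<le> int N * 2 ^ n" for m
  proof -
    have "\<bar>m\<bar> \<le> int N * 2 ^ n" using that by linarith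
    then have "real_of_int \<bar>m\<bar> \<le> of_int (int N * 2 ^ n)" by (simp only: of_int_le_iff)
    then have "\<bar>real_of_int m\<bar> \<le> real N * 2 ^ n" by simp
    then show ?thesis by (simp add: abs_divide pos_divide_le_eq)
  qed
  then have "\<bar>node n k $ 1\<bar> \<le> real N" "\<bar>node n k $ 2\<bar> \<le> real N"
    using assms by (auto simp: grid_def node_def)
  then show ?thesis using norm_real2_le[of "node n k"] by linarith
qed

lemma dist_node_Suc_le:
  assumes "j \<in> {-3..3} \<times> {-3..3}"
  shows "norm (node (Suc n) (2 * fst k + fst j, 2 * snd k + snd j) - node n k) \<le> 3 / 2 ^ n"
proof -
  have *: "\<bar>(2 * of_int b + of_int a) / (2 * 2 ^ n) - of_int b / 2 ^ n\<bar> \<le> (3 / 2) / (2 :: real) ^ n" if "a \<in> {-3..3}" for a b :: int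
  proof -
    have "(2 * of_int b + of_int a) / (2 * 2 ^ n) - of_int b / 2 ^ n = of_int a / 2 / (2 :: real) ^ n"
      by (simp add: field_simps)
    moreover have "\<bar>of_int a / 2 / (2 :: real) ^ n\<bar> = \<bar>of_int a\<bar> / 2 / 2 ^ n" by (simp add: abs_divide)
    moreover have "\<bar>real_of_int a\<bar> \<le> 3" using that by auto
    ultimately show ?thesis by (simp add: divide_right_mono)
  qed
  have "norm (node (Suc n) (2 * fst k + fst j, 2 * snd k + snd j) - node n k) \<le> (3 / 2) / 2 ^ n + (3 / 2) / 2 ^ n"
    by (rule order_trans[OF norm_real2_le add_mono]) (use assms *[of "fst j" "fst k"] *[of "snd j" "snd k"] in \<open>auto simp: node_def\<close>)
  then show ?thesis by simp
qed


text \<open>The exponent 2 of the dimension yields \<open>(1 / 4) ^ n\<close>, which cancels the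
  number of nodes, of order \<open>4 ^ n\<close>; the excess \<open>\<tau>\<close> leaves a
  geometric factor.\<close>

lemma dyadic_powr: "(c / 2 ^ n) powr (2 + \<tau>) = c powr (2 + \<tau>) * (1 / 4) ^ n * (2 powr (- \<tau>)) ^ n" if "0 \<le> c" for c \<tau> :: real
proof -
  have h: "1 / 2 ^ n = 2 powr (- real n)" by (simp add: powr_minus powr_realpow divide_inverse)
  have "(c / 2 ^ n) powr (2 + \<tau>) = c powr (2 + \<tau>) * (1 / 2 ^ n) powr (2 + \<tau>)"
    using that by (simp add: powr_divide)
  also have "(1 / 2 ^ n) powr (2 + \<tau>) = ((1 / 2 ^ n :: real) powr 2) * (1 / 2 ^ n) powr \<tau>"
    by (simp add: powr_add)
  also have "(1 / 2 ^ n :: real) powr 2 = (1 / 4) ^ n"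
  proof -
    have "(1 / 2 ^ n :: real) powr 2 = (1 / 2 ^ n) ^ 2" by (rule powr_numeral) simp
    also have "\<dots> = ((1 / 2)\<^sup>2) ^ n" by (simp only: power_one_over[symmetric] power_mult[symmetric] mult.commute)
    finally show ?thesis by (simp add: power2_eq_square)
  qed
  also have "(1 / 2 ^ n) powr \<tau> = (2 powr (- \<tau>)) ^ n"
    unfolding h by (simp add: powr_powr powr_power mult.commute)
  finally show ?thesis by simp
qed

lemma (in prob_space) nn_integral_mesh_increments_le:
  fixes Z :: "real ^ 2 \<Rightarrow> 'a \<Rightarrow> real"
  assumes [measurable]: "\<And>u. Z u \<in> borel_measurable M"
    and K: "0 \<le> K" and \<tau>: "0 < \<tau>"
    and mom: "\<And>u v. norm u \<le> real (2 * N + 5) \<Longrightarrow> norm v \<le> real (2 * N + 5) \<Longrightarrow>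
      (\<integral>\<^sup>+\<omega>. ennreal (\<bar>Z u \<omega> - Z v \<omega>\<bar> ^ q) \<partial>M) \<le> ennreal (K * norm (u - v) powr (2 + \<tau>))"
  shows "(\<integral>\<^sup>+\<omega>. ennreal (mesh_increments q N n (\<lambda>u. Z u \<omega>)) \<partial>M)
    \<le> ennreal ((4 * real (Suc N) + 1)\<^sup>2 * 49 * K * 3 powr (2 + \<tau>) * (2 powr (- \<tau>)) ^ n)"
proof -
  let ?J = "{-3..3} \<times> {-3..3} :: (int \<times> int) set"
  let ?a = "\<lambda>k j. node (Suc n) (2 * fst k + fst j, 2 * snd k + snd j)"
  let ?b = "K * (3 / 2 ^ n) powr (2 + \<tau>)"
  have step: "(\<integral>\<^sup>+\<omega>. ennreal (\<bar>Z (?a k j) \<omega> - Z (node n k) \<omega>\<bar> ^ q) \<partial>M) \<le> ennreal ?b"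
    if k: "k \<in> grid (Suc N) n" and j: "j \<in> ?J" for k j
  proof -
    \<comment> \<open>The radius \<open>2 * N + 5\<close> arises here: nodes of
      \<open>grid (Suc N) n\<close> have norm at most \<open>2 * N + 2\<close>, and the finer
      neighbours lie at most 3 further out.\<close>
    have d: "norm (?a k j - node n k) \<le> 3 / 2 ^ n" by (rule dist_node_Suc_le[OF j])
    also have "\<dots> \<le> (3 :: real)" by (simp add: divide_le_eq)
    finally have "norm (?a k j) \<le> norm (node n k) + 3" using norm_triangle_sub[of "?a k j" "node n k"] by linarith
    then have "norm (?a k j) \<le> real (2 * N + 5)" "norm (node n k) \<le> real (2 * N + 5)" using norm_node_le[OF k] by auto
    then have "(\<integral>\<^sup>+\<omega>. ennreal (\<bar>Z (?a k j) \<omega> - Z (node n k) \<omega>\<bar> ^ q) \<partial>M) \<le> ennreal (K * norm (?a k j - node n k) powr (2 + \<tau>))"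
      by (rule mom)
    also have "\<dots> \<le> ennreal ?b"
      using K \<tau> d by (intro ennreal_leI mult_left_mono powr_mono2) auto
    finally show ?thesis .
  qed
  have "(\<integral>\<^sup>+\<omega>. ennreal (mesh_increments q N n (\<lambda>u. Z u \<omega>)) \<partial>M) =
     (\<integral>\<^sup>+\<omega>. (\<Sum>k\<in>grid (Suc N) n. \<Sum>j\<in>?J. ennreal (\<bar>Z (?a k j) \<omega> - Z (node n k) \<omega>\<bar> ^ q)) \<partial>M)"
    unfolding mesh_increments_def by (simp add: sum_nonneg flip: sum_ennreal)
  also have "\<dots> = (\<Sum>k\<in>grid (Suc N) n. \<Sum>j\<in>?J. \<integral>\<^sup>+\<omega>. ennreal (\<bar>Z (?a k j) \<omega> - Z (node n k) \<omega>\<bar> ^ q) \<partial>M)"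
    by (subst nn_integral_sum, measurable, intro sum.cong refl nn_integral_sum, measurable)
  also have "\<dots> \<le> (\<Sum>k\<in>grid (Suc N) n. \<Sum>j\<in>?J. ennreal ?b)"
    by (intro sum_mono step)
  also have "\<dots> = ennreal (real (card (grid (Suc N) n)) * (49 * ?b))"
    using K by (simp add: card_cartesian_product ennreal_mult ennreal_of_nat_eq_real_of_nat)
  also have "\<dots> \<le> ennreal (((4 * real (Suc N) + 1)\<^sup>2 * 4 ^ n) * (49 * ?b))"
    using K by (intro ennreal_leI mult_right_mono card_grid_le) auto
  also have "((4 * real (Suc N) + 1)\<^sup>2 * 4 ^ n) * (49 * ?b) =
      (4 * real (Suc N) + 1)\<^sup>2 * 49 * K * 3 powr (2 + \<tau>) * (2 powr (- \<tau>)) ^ n * (4 ^ n * (1 / 4) ^ n)"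
    by (subst dyadic_powr) (simp_all add: mult_ac)
  also have "(4 :: real) ^ n * (1 / 4) ^ n = 1" by (simp flip: power_mult_distrib)
  finally show ?thesis by simp
qed

text \<open>For fixed \<open>u\<close> the expected q-th powers of the interpolation errors decay
  geometrically, so their sum is almost surely finite and the errors tend to zero. The null set
  depends on \<open>u\<close>, which suffices for a modification.\<close>

lemma (in prob_space) interp_tendsto_AE:
  fixes Z :: "real ^ 2 \<Rightarrow> 'a \<Rightarrow> real"
  assumes [measurable]: "\<And>u. Z u \<in> borel_measurable M"
    and q: "1 \<le> q" and K: "0 \<le> K" and \<tau>: "0 < \<tau>"
    and mom: "\<And>v w. norm v \<le> real (2 * N + 5) \<Longrightarrow> norm w \<le> real (2 * N + 5) \<Longrightarrow>
      (\<integral>\<^sup>+\<omega>. ennreal (\<bar>Z v \<omega> - Z w \<omega>\<bar> ^ q) \<partial>M) \<le> ennreal (K * norm (v - w) powr (2 + \<tau>))"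
    and u: "norm u \<le> real N"
  shows "AE \<omega> in M. (\<lambda>n. interp n (\<lambda>v. Z v \<omega>) u) \<longlonglongrightarrow> Z u \<omega>"
proof -
  let ?e = "\<lambda>n \<omega>. \<bar>interp (n + N) (\<lambda>v. Z v \<omega>) u - Z u \<omega>\<bar> ^ q"
  let ?G = "\<lambda>n. {k \<in> grid (Suc N) n. tent n k u \<noteq> 0}"
  define C where "C = (4 * real (Suc N) + 1)\<^sup>2 * K * 2 powr (2 + \<tau>)"
  have C: "0 \<le> C" using K by (simp add: C_def)
  define s where "s = 2 powr (- \<tau>)"
  have s: "0 < s" "s < 1" using \<tau> by (auto simp: s_def powr_less_one)
  have [measurable]: "(\<lambda>\<omega>. interp n (\<lambda>v. Z v \<omega>) u) \<in> borel_measurable M" for n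
    unfolding interp_def by measurable
  have e: "(\<integral>\<^sup>+\<omega>. ennreal (\<bar>interp n (\<lambda>v. Z v \<omega>) u - Z u \<omega>\<bar> ^ q) \<partial>M) \<le> ennreal (C * s ^ n)" if n: "N \<le> n" for n
  proof -
    let ?b = "K * (2 / 2 ^ n) powr (2 + \<tau>)"
    have step: "(\<integral>\<^sup>+\<omega>. ennreal (\<bar>Z (node n k) \<omega> - Z u \<omega>\<bar> ^ q) \<partial>M) \<le> ennreal ?b" if k: "k \<in> ?G n" for k
    proof -
      have "norm (node n k) \<le> real (2 * N + 5)" using norm_node_le[of k "Suc N" n] k by auto
      then have "(\<integral>\<^sup>+\<omega>. ennreal (\<bar>Z (node n k) \<omega> - Z u \<omega>\<bar> ^ q) \<partial>M) \<le> ennreal (K * norm (node n k - u) powr (2 + \<tau>))"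
        using u by (intro mom) auto
      also have "\<dots> \<le> ennreal ?b"
        using K \<tau> dist_node_le[of n k u] k by (intro ennreal_leI mult_left_mono powr_mono2) (auto simp: dist_norm)
      finally show ?thesis .
    qed
    have "(\<integral>\<^sup>+\<omega>. ennreal (\<bar>interp n (\<lambda>v. Z v \<omega>) u - Z u \<omega>\<bar> ^ q) \<partial>M) \<le> (\<integral>\<^sup>+\<omega>. (\<Sum>k\<in>?G n. ennreal (\<bar>Z (node n k) \<omega> - Z u \<omega>\<bar> ^ q)) \<partial>M)"
    proof (rule nn_integral_mono)
      fix \<omega>
      show "ennreal (\<bar>interp n (\<lambda>v. Z v \<omega>) u - Z u \<omega>\<bar> ^ q) \<le> (\<Sum>k\<in>?G n. ennreal (\<bar>Z (node n k) \<omega> - Z u \<omega>\<bar> ^ q))"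
        using interp_error[OF u n q, of "\<lambda>v. Z v \<omega>"] by (subst sum_ennreal) (auto intro!: ennreal_leI)
    qed
    also have "\<dots> = (\<Sum>k\<in>?G n. \<integral>\<^sup>+\<omega>. ennreal (\<bar>Z (node n k) \<omega> - Z u \<omega>\<bar> ^ q) \<partial>M)"
      by (rule nn_integral_sum) measurable
    also have "\<dots> \<le> (\<Sum>k\<in>?G n. ennreal ?b)" by (intro sum_mono step)
    also have "\<dots> \<le> (\<Sum>k\<in>grid (Suc N) n. ennreal ?b)" by (rule sum_mono2) auto
    also have "\<dots> = ennreal (real (card (grid (Suc N) n)) * ?b)"
      using K by (simp add: ennreal_mult ennreal_of_nat_eq_real_of_nat)
    also have "\<dots> \<le> ennreal (((4 * real (Suc N) + 1)\<^sup>2 * 4 ^ n) * ?b)"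
      using K by (intro ennreal_leI mult_right_mono card_grid_le) auto
    also have "((4 * real (Suc N) + 1)\<^sup>2 * 4 ^ n) * ?b = C * s ^ n * (4 ^ n * (1 / 4) ^ n)"
      by (subst dyadic_powr) (simp_all add: mult_ac C_def s_def)
    also have "(4 :: real) ^ n * (1 / 4) ^ n = 1" by (simp flip: power_mult_distrib)
    finally show ?thesis by simp
  qed
  have "(\<integral>\<^sup>+\<omega>. (\<Sum>n. ennreal (?e n \<omega>)) \<partial>M) = (\<Sum>n. \<integral>\<^sup>+\<omega>. ennreal (?e n \<omega>) \<partial>M)"
    by (rule nn_integral_suminf) measurable
  also have "\<dots> \<le> (\<Sum>n. ennreal (C * s ^ (n + N)))"
    by (intro suminf_le e) auto
  also have "\<dots> < \<infinity>"
  proof -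
    have "summable (\<lambda>n. C * s ^ (n + N))"
      unfolding summable_iff_shift[of "\<lambda>n. C * s ^ n"] using s by (intro summable_mult summable_geometric) auto
    then show ?thesis using C s by (subst suminf_ennreal2) auto
  qed
  finally have "AE \<omega> in M. (\<Sum>n. ennreal (?e n \<omega>)) \<noteq> \<infinity>"
    by (intro nn_integral_noteq_infinite) (auto simp: less_top)
  then show ?thesis
  proof eventually_elim
    case (elim \<omega>)
    then have "summable (\<lambda>n. ?e n \<omega>)" by (intro summable_suminf_not_top) auto
    then have "(\<lambda>n. ?e n \<omega>) \<longlonglongrightarrow> 0" by (rule summable_LIMSEQ_zero)
    then have "(\<lambda>n. root q (?e n \<omega>)) \<longlonglongrightarrow> root q 0" by (rule tendsto_real_root)
    then have "(\<lambda>n. \<bar>interp (n + N) (\<lambda>v. Z v \<omega>) u - Z u \<omega>\<bar>) \<longlonglongrightarrow> 0" using q by (simp add: real_root_power_cancel)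
    then have "(\<lambda>n. interp (n + N) (\<lambda>v. Z v \<omega>) u) \<longlonglongrightarrow> Z u \<omega>"
      using LIM_zero_iff tendsto_rabs_zero_iff by blast
    then show ?case by (rule LIMSEQ_offset)
  qed
qed

abbreviation moment_modulus :: "'w measure \<Rightarrow> nat \<Rightarrow> (nat \<Rightarrow> real) \<Rightarrow> real \<Rightarrow> (real ^ 2 \<Rightarrow> 'w \<Rightarrow> real) \<Rightarrow> bool" where
  "moment_modulus P q K \<tau> Z \<equiv> (\<forall>N u v. norm u \<le> real N \<longrightarrow> norm v \<le> real N \<longrightarrow>
    (\<integral>\<^sup>+\<omega>. ennreal (\<bar>Z u \<omega> - Z v \<omega>\<bar> ^ q) \<partial>P) \<le> ennreal (K N * norm (u - v) powr (2 + \<tau>)))"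

text \<open>The supremum over a ball enters through a measurable majorant \<open>B\<close>; this
  spares any discussion of the measurability of an uncountable supremum.\<close>

abbreviation dominated_modification ::
  "'w measure \<Rightarrow> (real ^ 2 \<Rightarrow> 'w \<Rightarrow> real) \<Rightarrow> (real ^ 2 \<Rightarrow> 'w \<Rightarrow> real) \<Rightarrow> (nat \<Rightarrow> real) \<Rightarrow> bool" where
  "dominated_modification P Z Z' c \<equiv> continuous_modification P Z Z' \<and>
    (\<forall>N. \<exists>B \<in> borel_measurable P. (\<forall>\<omega>\<in>space P. \<forall>u. norm u \<le> real N \<longrightarrow> ennreal \<bar>Z' u \<omega>\<bar> \<le> B \<omega>) \<and>
      (\<integral>\<^sup>+\<omega>. B \<omega> \<partial>P) \<le> ennreal (c N))"

text \<open>The constants \<open>c\<close> depend on the moment bounds only, so that the bound is uniform over families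
  of fields with a common modulus.\<close>

theorem (in prob_space) kolmogorov_continuity:
  fixes K :: "nat \<Rightarrow> real"
  assumes q: "1 \<le> q" and \<tau>: "0 < \<tau>" and K: "\<And>N. 0 \<le> K N"
  shows "\<exists>c. \<forall>Z. (\<forall>u. Z u \<in> borel_measurable M) \<longrightarrow> (AE \<omega> in M. Z 0 \<omega> = 0) \<longrightarrow>
    moment_modulus M q K \<tau> Z \<longrightarrow> (\<exists>Z'. dominated_modification M Z Z' c)"
proof -
  \<comment> \<open>This value balances the two terms of \<open>interp_step\<close>: at level
    \<open>m\<close> the expected mesh sum is of order \<open>r ^ (q * m)\<close>, and division by
    \<open>(r ^ m) ^ (q - 1)\<close> leaves \<open>r ^ m\<close>, the order of the other
    term.\<close>
  define r where "r = 2 powr (- \<tau> / real q)"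
  have r: "0 < r" "r < 1" using q \<tau> by (auto simp: r_def powr_less_one)
  have rq: "r ^ q = 2 powr (- \<tau>)" using q by (simp add: r_def powr_power)
  define c1 where "c1 N = (4 * real (Suc N) + 1)\<^sup>2 * 49 * K (2 * N + 5) * 3 powr (2 + \<tau>)" for N
  have c1: "0 \<le> c1 N" for N using K by (simp add: c1_def)
  define c0 where "c0 N = real (card (grid (Suc N) N)) * (1 + K (2 * N + 2) * real (2 * N + 2) powr (2 + \<tau>))" for N
  have c0: "0 \<le> c0 N" for N using K by (simp add: c0_def)
  show ?thesis
  proof (rule exI[of _ "\<lambda>N. c0 N + (1 + c1 N) / (1 - r)"], intro allI impI)
    fix Z :: "real ^ 2 \<Rightarrow> 'a \<Rightarrow> real"
    assume Z: "\<forall>u. Z u \<in> borel_measurable M" and Z0: "AE \<omega> in M. Z 0 \<omega> = 0"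
      and mom: "moment_modulus M q K \<tau> Z"
    have [measurable]: "Z u \<in> borel_measurable M" for u using Z by simp
    have [measurable]: "(\<lambda>\<omega>. interp n (\<lambda>v. Z v \<omega>) u) \<in> borel_measurable M" for n u
      unfolding interp_def by measurable
    have [measurable]: "(\<lambda>\<omega>. mesh_increments q N n (\<lambda>v. Z v \<omega>)) \<in> borel_measurable M" for N n
      unfolding mesh_increments_def by measurable
    \<comment> \<open>On the ball of radius \<open>N\<close> the telescoping sum starts at level
      \<open>N\<close>, since \<open>interp_step\<close> requires \<open>N \<le> n\<close>; this is
      the shift \<open>n + N\<close> in \<open>D\<close>. The vanishing of \<open>Z 0\<close> lets
      increment moments bound the values in \<open>base\<close>.\<close>
    define base where "base N \<omega> = (\<Sum>k\<in>grid (Suc N) N. 1 + \<bar>Z (node N k) \<omega>\<bar> ^ q)" for N \<omega>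
    define D where "D N n \<omega> = r ^ (n + N) + mesh_increments q N (n + N) (\<lambda>v. Z v \<omega>) / (r ^ (n + N)) ^ (q - 1)" for N n \<omega>
    define B where "B N \<omega> = ennreal (base N \<omega>) + (\<Sum>n. ennreal (D N n \<omega>))" for N \<omega>
    have base0: "0 \<le> base N \<omega>" for N \<omega> by (auto simp: base_def intro!: sum_nonneg)
    have D0: "0 \<le> D N n \<omega>" for N n \<omega> using r mesh_increments_nonneg by (simp add: D_def)
    have [measurable]: "base N \<in> borel_measurable M" for N unfolding base_def[abs_def] by measurable
    have [measurable]: "D N n \<in> borel_measurable M" for N n unfolding D_def[abs_def] by measurable
    have [measurable]: "B N \<in> borel_measurable M" for N unfolding B_def[abs_def] by measurable
    have Ebase: "(\<integral>\<^sup>+\<omega>. ennreal (base N \<omega>) \<partial>M) \<le> ennreal (c0 N)" for N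
    proof -
      have step: "(\<integral>\<^sup>+\<omega>. ennreal (1 + \<bar>Z (node N k) \<omega>\<bar> ^ q) \<partial>M) \<le> ennreal (1 + K (2 * N + 2) * real (2 * N + 2) powr (2 + \<tau>))"
        if k: "k \<in> grid (Suc N) N" for k
      proof -
        have nk: "norm (node N k) \<le> real (2 * N + 2)" using norm_node_le[OF k] by simp
        have "(\<integral>\<^sup>+\<omega>. ennreal (\<bar>Z (node N k) \<omega>\<bar> ^ q) \<partial>M) = (\<integral>\<^sup>+\<omega>. ennreal (\<bar>Z (node N k) \<omega> - Z 0 \<omega>\<bar> ^ q) \<partial>M)"
          using Z0 by (intro nn_integral_cong_AE) auto
        also have "\<dots> \<le> ennreal (K (2 * N + 2) * norm (node N k - 0) powr (2 + \<tau>))"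
          by (intro mom[rule_format] nk) simp
        also have "\<dots> \<le> ennreal (K (2 * N + 2) * real (2 * N + 2) powr (2 + \<tau>))"
          using K \<tau> nk by (intro ennreal_leI mult_left_mono powr_mono2) auto
        finally have "(\<integral>\<^sup>+\<omega>. ennreal (\<bar>Z (node N k) \<omega>\<bar> ^ q) \<partial>M) \<le> ennreal (K (2 * N + 2) * real (2 * N + 2) powr (2 + \<tau>))" .
        moreover have "(\<integral>\<^sup>+\<omega>. ennreal (1 + \<bar>Z (node N k) \<omega>\<bar> ^ q) \<partial>M) = 1 + (\<integral>\<^sup>+\<omega>. ennreal (\<bar>Z (node N k) \<omega>\<bar> ^ q) \<partial>M)"
          by (simp add: nn_integral_add emeasure_space_1)
        ultimately show ?thesis using K by (simp add: add_left_mono)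
      qed
      have "(\<integral>\<^sup>+\<omega>. ennreal (base N \<omega>) \<partial>M) = (\<integral>\<^sup>+\<omega>. (\<Sum>k\<in>grid (Suc N) N. ennreal (1 + \<bar>Z (node N k) \<omega>\<bar> ^ q)) \<partial>M)"
        unfolding base_def by (subst sum_ennreal) auto
      also have "\<dots> = (\<Sum>k\<in>grid (Suc N) N. \<integral>\<^sup>+\<omega>. ennreal (1 + \<bar>Z (node N k) \<omega>\<bar> ^ q) \<partial>M)"
        by (rule nn_integral_sum) measurable
      also have "\<dots> \<le> (\<Sum>k\<in>grid (Suc N) N. ennreal (1 + K (2 * N + 2) * real (2 * N + 2) powr (2 + \<tau>)))"
        by (intro sum_mono step)
      also have "\<dots> = ennreal (c0 N)"
        using K by (simp add: c0_def ennreal_mult ennreal_of_nat_eq_real_of_nat)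
      finally show ?thesis .
    qed
    have ED: "(\<integral>\<^sup>+\<omega>. ennreal (D N n \<omega>) \<partial>M) \<le> ennreal ((1 + c1 N) * r ^ (n + N))" for N n
    proof -
      let ?m = "n + N"
      have "(\<integral>\<^sup>+\<omega>. ennreal (D N n \<omega>) \<partial>M) = (\<integral>\<^sup>+\<omega>. ennreal (r ^ ?m) + ennreal (1 / (r ^ ?m) ^ (q - 1)) * ennreal (mesh_increments q N ?m (\<lambda>v. Z v \<omega>)) \<partial>M)"
        unfolding D_def using r mesh_increments_nonneg by (intro nn_integral_cong) (simp flip: ennreal_mult ennreal_plus)
      also have "\<dots> = ennreal (r ^ ?m) + ennreal (1 / (r ^ ?m) ^ (q - 1)) * (\<integral>\<^sup>+\<omega>. ennreal (mesh_increments q N ?m (\<lambda>v. Z v \<omega>)) \<partial>M)"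
        by (simp add: nn_integral_add nn_integral_cmult emeasure_space_1)
      also have "(\<integral>\<^sup>+\<omega>. ennreal (mesh_increments q N ?m (\<lambda>v. Z v \<omega>)) \<partial>M) \<le> ennreal (c1 N * (2 powr (- \<tau>)) ^ ?m)"
        unfolding c1_def by (rule nn_integral_mesh_increments_le[OF _ K \<tau>]) (use mom in auto)
      also have "ennreal (r ^ ?m) + ennreal (1 / (r ^ ?m) ^ (q - 1)) * ennreal (c1 N * (2 powr (- \<tau>)) ^ ?m) =
          ennreal (r ^ ?m + c1 N * ((r ^ ?m) ^ q / (r ^ ?m) ^ (q - 1)))"
        using r c1 unfolding rq[symmetric]
        by (simp add: power_mult[symmetric] mult.commute[of q] flip: ennreal_mult ennreal_plus)
      also have "(r ^ ?m) ^ q / (r ^ ?m) ^ (q - 1) = r ^ ?m"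
        using r q by (cases q) auto
      finally show ?thesis by (simp add: distrib_right add_left_mono mult_left_mono)
    qed
    have EB: "(\<integral>\<^sup>+\<omega>. B N \<omega> \<partial>M) \<le> ennreal (c0 N + (1 + c1 N) / (1 - r))" for N
    proof -
      have "(\<integral>\<^sup>+\<omega>. B N \<omega> \<partial>M) = (\<integral>\<^sup>+\<omega>. ennreal (base N \<omega>) \<partial>M) + (\<Sum>n. \<integral>\<^sup>+\<omega>. ennreal (D N n \<omega>) \<partial>M)"
        unfolding B_def by (subst nn_integral_add) (auto simp: nn_integral_suminf)
      also have "\<dots> \<le> ennreal (c0 N) + (\<Sum>n. ennreal ((1 + c1 N) * r ^ n))"
      proof (intro add_mono Ebase suminf_le)
        fix n
        have "(1 + c1 N) * r ^ (n + N) \<le> (1 + c1 N) * r ^ n"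
          using c1[of N] r by (intro mult_left_mono power_decreasing) auto
        then show "(\<integral>\<^sup>+\<omega>. ennreal (D N n \<omega>) \<partial>M) \<le> ennreal ((1 + c1 N) * r ^ n)"
          by (rule order_trans[OF ED ennreal_leI])
      qed auto
      also have "(\<Sum>n. ennreal ((1 + c1 N) * r ^ n)) = ennreal (\<Sum>n. (1 + c1 N) * r ^ n)"
        using c1[of N] r by (intro suminf_ennreal2 summable_mult summable_geometric) auto
      also have "(\<Sum>n. (1 + c1 N) * r ^ n) = (1 + c1 N) / (1 - r)"
        using r by (simp add: suminf_mult suminf_geometric summable_geometric)
      finally show ?thesis using c0 c1[of N] r by (simp flip: ennreal_plus)
    qed
    define G where "G \<omega> \<longleftrightarrow> (\<forall>N. (\<Sum>n. ennreal (D N n \<omega>)) < top)" for \<omega>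
    have [measurable]: "Measurable.pred M G" unfolding G_def by measurable
    have AEG: "AE \<omega> in M. G \<omega>"
      unfolding G_def AE_all_countable
    proof
      fix N
      have "(\<integral>\<^sup>+\<omega>. B N \<omega> \<partial>M) \<noteq> \<infinity>" using EB[of N] by (auto simp: top_unique)
      then have "AE \<omega> in M. B N \<omega> \<noteq> \<infinity>" by (intro nn_integral_noteq_infinite) auto
      then show "AE \<omega> in M. (\<Sum>n. ennreal (D N n \<omega>)) < top"
        by eventually_elim (auto simp: B_def less_top)
    qed
    \<comment> \<open>The event \<open>G\<close> does not depend on \<open>u\<close>. Outside it the
      path is set to 0, so that all paths are continuous and dominated, and not merely almost all of
      them.\<close>
    define Z' where "Z' u \<omega> = (if G \<omega> then lim (\<lambda>n. interp n (\<lambda>v. Z v \<omega>) u) else 0)" for u \<omega>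
    have good: "uniform_limit {u. norm u \<le> real N} (\<lambda>n. interp (n + N) (\<lambda>v. Z v \<omega>)) (\<lambda>u. Z' u \<omega>) sequentially"
        "\<And>u. norm u \<le> real N \<Longrightarrow> ennreal \<bar>Z' u \<omega>\<bar> \<le> B N \<omega>"
        "\<And>u. norm u \<le> real N \<Longrightarrow> (\<lambda>n. interp n (\<lambda>v. Z v \<omega>) u) \<longlonglongrightarrow> Z' u \<omega>"
      if G: "G \<omega>" for \<omega> N
    proof -
      let ?f = "\<lambda>n. interp n (\<lambda>v. Z v \<omega>)"
      define d where "d n u = ?f (Suc (n + N)) u - ?f (n + N) u" for n u
      have db: "norm (d n u) \<le> D N n \<omega>" if "norm u \<le> real N" for n u
        unfolding d_def D_def real_norm_def using that r by (intro interp_step q) auto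
      have fin: "(\<Sum>n. ennreal (D N n \<omega>)) < top" using G by (simp add: G_def)
      then have sD: "summable (\<lambda>n. D N n \<omega>)" by (intro summable_suminf_not_top D0) auto
      have tele: "(\<Sum>i<n. d i u) = ?f (n + N) u - ?f N u" for n u
        unfolding d_def using sum_lessThan_telescope[of "\<lambda>i. ?f (i + N) u" n] by simp
      have U: "uniform_limit {u. norm u \<le> real N} (\<lambda>n u. \<Sum>i<n. d i u) (\<lambda>u. \<Sum>i. d i u) sequentially"
        by (rule Weierstrass_m_test[OF _ sD]) (use db in auto)
      have U2: "uniform_limit {u. norm u \<le> real N} (\<lambda>n u. ?f N u + (\<Sum>i<n. d i u)) (\<lambda>u. ?f N u + (\<Sum>i. d i u)) sequentially"
        by (intro uniform_limit_add uniform_limit_const U)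
      then have U3: "uniform_limit {u. norm u \<le> real N} (\<lambda>n. ?f (n + N)) (\<lambda>u. ?f N u + (\<Sum>i. d i u)) sequentially"
        unfolding tele by simp
      have L: "(\<lambda>n. ?f n u) \<longlonglongrightarrow> ?f N u + (\<Sum>i. d i u)" if "norm u \<le> real N" for u
        by (rule LIMSEQ_offset[of _ N], rule tendsto_uniform_limitI[OF U3]) (use that in simp)
      have Zeq: "Z' u \<omega> = ?f N u + (\<Sum>i. d i u)" if "norm u \<le> real N" for u
        using G limI[OF L[OF that]] by (simp add: Z'_def)
      show "(\<lambda>n. ?f n u) \<longlonglongrightarrow> Z' u \<omega>" if "norm u \<le> real N" for u
        using L[OF that] Zeq[OF that] by simp
      show "uniform_limit {u. norm u \<le> real N} (\<lambda>n. ?f (n + N)) (\<lambda>u. Z' u \<omega>) sequentially"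
        using U3 Zeq by (subst uniform_limit_cong'[where g="\<lambda>n. ?f (n + N)" and i="\<lambda>u. ?f N u + (\<Sum>i. d i u)"]) auto
      show "ennreal \<bar>Z' u \<omega>\<bar> \<le> B N \<omega>" if u: "norm u \<le> real N" for u
      proof -
        have sn: "summable (\<lambda>i. norm (d i u))" by (rule summable_comparison_test'[OF sD]) (use db[OF u] in auto)
        have "\<bar>\<Sum>i. d i u\<bar> \<le> (\<Sum>i. norm (d i u))" using summable_norm[OF sn] by simp
        also have "\<dots> \<le> (\<Sum>i. D N i \<omega>)" by (intro suminf_le sn sD db u)
        finally have "\<bar>Z' u \<omega>\<bar> \<le> base N \<omega> + (\<Sum>i. D N i \<omega>)"
          unfolding Zeq[OF u] base_def using interp_base[OF u q, of "\<lambda>v. Z v \<omega>"] by linarith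
        then have "ennreal \<bar>Z' u \<omega>\<bar> \<le> ennreal (base N \<omega> + (\<Sum>i. D N i \<omega>))" by (rule ennreal_leI)
        also have "\<dots> = ennreal (base N \<omega>) + ennreal (\<Sum>i. D N i \<omega>)"
          by (intro ennreal_plus base0 suminf_nonneg sD D0)
        also have "ennreal (\<Sum>i. D N i \<omega>) = (\<Sum>i. ennreal (D N i \<omega>))"
          by (rule suminf_ennreal2[symmetric]) (auto intro: D0 sD)
        finally show ?thesis by (simp add: B_def)
      qed
    qed
    have cont: "continuous_on UNIV (\<lambda>u. Z' u \<omega>)" for \<omega>
    proof (cases "G \<omega>")
      case False
      then show ?thesis by (simp add: Z'_def)
    next
      case True
      have cN: "continuous_on {u. norm u \<le> real N} (\<lambda>u. Z' u \<omega>)" for N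
        by (rule uniform_limit_theorem[OF _ good(1)[OF True]]) (auto intro!: always_eventually continuous_on_interp)
      show ?thesis
      proof (rule continuous_at_imp_continuous_on, rule ballI)
        fix u :: "real ^ 2"
        obtain N :: nat where "norm u < real N" using reals_Archimedean2 by blast
        then have "u \<in> ball 0 (real N)" by simp
        moreover have "continuous_on (ball 0 (real N)) (\<lambda>u. Z' u \<omega>)"
          by (rule continuous_on_subset[OF cN[of N]]) auto
        ultimately show "isCont (\<lambda>u. Z' u \<omega>) u" by (simp add: continuous_on_eq_continuous_at)
      qed
    qed
    have meas: "Z' u \<in> borel_measurable M" for u
    proof (rule borel_measurable_LIMSEQ_real)
      obtain N :: nat where N: "norm u \<le> real N" using real_arch_simple by blast
      show "(\<lambda>n. if G \<omega> then interp n (\<lambda>v. Z v \<omega>) u else 0) \<longlonglongrightarrow> Z' u \<omega>" for \<omega>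
        using good(3)[OF _ N, of \<omega>] by (cases "G \<omega>") (auto simp: Z'_def)
    qed measurable
    have mod: "AE \<omega> in M. Z' u \<omega> = Z u \<omega>" for u
    proof -
      obtain N :: nat where N: "norm u \<le> real N" using real_arch_simple by blast
      have "AE \<omega> in M. (\<lambda>n. interp n (\<lambda>v. Z v \<omega>) u) \<longlonglongrightarrow> Z u \<omega>"
        by (rule interp_tendsto_AE[where K="K (2 * N + 5)", OF _ q K \<tau> mom[rule_format] N]) simp
      with AEG show ?thesis
        by eventually_elim (use good(3)[OF _ N] LIMSEQ_unique in blast)
    qed
    show "\<exists>Z'. dominated_modification M Z Z' (\<lambda>N. c0 N + (1 + c1 N) / (1 - r))"
    proof (intro exI[of _ Z'] conjI allI)
      show "continuous_modification M Z Z'"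
        using meas mod cont by (simp add: continuous_modification_def)
      fix N
      have "ennreal \<bar>Z' u \<omega>\<bar> \<le> B N \<omega>" if "norm u \<le> real N" for u \<omega>
        using good(2)[OF _ that, of \<omega>] by (cases "G \<omega>") (auto simp: Z'_def)
      then show "\<exists>B \<in> borel_measurable M. (\<forall>\<omega>\<in>space M. \<forall>u. norm u \<le> real N \<longrightarrow> ennreal \<bar>Z' u \<omega>\<bar> \<le> B \<omega>) \<and>
        (\<integral>\<^sup>+\<omega>. B \<omega> \<partial>M) \<le> ennreal (c0 N + (1 + c1 N) / (1 - r))"
        using EB[of N] by (intro bexI[of _ "B N"]) auto
    qed
  qed
qed

section \<open>Polar coordinates in the plane\<close>

lemma vector_2_axis: "(vector [x, y] :: real ^ 2) = x *\<^sub>R axis 1 1 + y *\<^sub>R axis 2 1"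
  by (simp add: vec_eq_iff forall_2 axis_def)

lemma borel_measurable_vector_2 [measurable (raw)]:
  assumes [measurable]: "f \<in> borel_measurable M" "g \<in> borel_measurable M"
  shows "(\<lambda>x. vector [f x, g x] :: real ^ 2) \<in> borel_measurable M"
  unfolding vector_2_axis by measurable

lemma norm_vector_2: "norm (vector [x, y] :: real ^ 2) = sqrt (x\<^sup>2 + y\<^sup>2)"
  by (simp add: norm_vec_def L2_set_def sum_2)

lemma lborel_real2: "(lborel :: (real ^ 2) measure) = distr (lborel \<Otimes>\<^sub>M lborel) borel (\<lambda>p. vector [fst p, snd p])"
proof (rule lborel_eqI)
  fix l u :: "real ^ 2"
  assume le: "\<And>b. b \<in> Basis \<Longrightarrow> l \<bullet> b \<le> u \<bullet> b"
  have B: "(Basis :: (real ^ 2) set) = {axis 1 1, axis 2 1}"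
    by (auto simp: Basis_vec_def UNIV_2)
  have ne: "axis 1 (1::real) \<noteq> (axis 2 1 :: real ^ 2)" by (simp add: axis_eq_axis)
  have l: "l $ 1 \<le> u $ 1" "l $ 2 \<le> u $ 2"
    using le[of "axis 1 1"] le[of "axis 2 1"] by (auto simp: B inner_axis)
  have "(\<lambda>p. vector [fst p, snd p] :: real ^ 2) -` box l u \<inter> space (lborel \<Otimes>\<^sub>M lborel) = {l $ 1<..<u $ 1} \<times> {l $ 2<..<u $ 2}"
    by (auto simp: mem_box_cart forall_2 space_pair_measure)
  then show "emeasure (distr (lborel \<Otimes>\<^sub>M lborel) borel (\<lambda>p. vector [fst p, snd p] :: real ^ 2)) (box l u) =
      ennreal (\<Prod>b\<in>Basis. (u - l) \<bullet> b)"
    using l ne by (subst emeasure_distr)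
      (auto simp: lborel.emeasure_pair_measure_Times B inner_axis simp flip: ennreal_mult)
qed simp

lemma nn_integral_real2:
  assumes [measurable]: "f \<in> borel_measurable borel"
  shows "(\<integral>\<^sup>+\<xi>. f \<xi> \<partial>(lborel :: (real ^ 2) measure)) = (\<integral>\<^sup>+x. \<integral>\<^sup>+y. f (vector [x, y]) \<partial>lborel \<partial>lborel)"
  by (subst lborel_real2, subst nn_integral_distr) (simp_all add: lborel.nn_integral_fst[symmetric])

text \<open>The substitution rule is available on compact intervals. Both sides are measures with
  densities, evaluated on increasing sets \<open>V n\<close> and \<open>U n\<close> that correspond
  under the arctangent, so continuity from below extends the identity to the whole line.\<close>

lemma nn_integral_arctan_substitution:
  fixes f :: "real \<Rightarrow> ennreal"
  assumes [measurable]: "f \<in> borel_measurable borel"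
  shows "(\<integral>\<^sup>+t. f (tan t) * indicator {- (pi / 2)<..<pi / 2} t \<partial>lborel) = (\<integral>\<^sup>+s. f s * ennreal (1 / (1 + s\<^sup>2)) \<partial>lborel)"
proof -
  have [measurable]: "tan \<in> borel_measurable (borel :: real measure)"
    unfolding tan_def by measurable
  define U V where "U n = {- real (Suc n)..real (Suc n)}" and "V n = {arctan (- real (Suc n))..arctan (real (Suc n))}" for n
  have UV: "range U \<subseteq> sets lborel" "range V \<subseteq> sets lborel" "incseq U" "incseq V"
    unfolding U_def V_def incseq_def by (auto intro: order_trans[OF arctan_monotone'] order_trans[OF _ arctan_monotone'] simp del: of_nat_Suc)
  have "s \<in> (\<Union>n. U n)" for s
  proof -
    obtain n where "\<bar>s\<bar> \<le> real n" using real_arch_simple by blast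
    then show ?thesis by (auto simp: U_def intro!: exI[of _ n])
  qed
  then have uU: "(\<Union>n. U n) = UNIV" by auto
  have "t \<in> (\<Union>n. V n)" if "t \<in> {- (pi / 2)<..<pi / 2}" for t
  proof -
    have t: "t = arctan (tan t)" using that by (simp add: arctan_tan)
    obtain n where "\<bar>tan t\<bar> \<le> real n" using real_arch_simple by blast
    then have "arctan (- real (Suc n)) \<le> arctan (tan t)" "arctan (tan t) \<le> arctan (real (Suc n))"
      by (auto intro!: arctan_monotone')
    then show ?thesis using t by (auto simp: V_def intro!: exI[of _ n])
  qed
  moreover have "V n \<subseteq> {- (pi / 2)<..<pi / 2}" for n
    using arctan_bounded[of "real (Suc n)"] arctan_bounded[of "- real (Suc n)"] by (auto simp: V_def simp del: of_nat_Suc)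
  ultimately have uV: "(\<Union>n. V n) = {- (pi / 2)<..<pi / 2}" by blast
  have "(\<integral>\<^sup>+t. f (tan t) * indicator (V n) t \<partial>lborel) = (\<integral>\<^sup>+s. f s * ennreal (1 / (1 + s\<^sup>2)) * indicator (U n) s \<partial>lborel)" for n
  proof -
    have p: "1 + s\<^sup>2 \<noteq> 0" for s :: real by (smt (verit) zero_le_power2)
    have "(\<integral>\<^sup>+t. f (tan t) * indicator (V n) t \<partial>lborel) = (\<integral>\<^sup>+s. f (tan (arctan s)) * ennreal (1 / (1 + s\<^sup>2)) * indicator (U n) s \<partial>lborel)"
      unfolding U_def V_def by (rule nn_integral_substitution_aux[where f="\<lambda>t. f (tan t)"])
        (auto intro!: derivative_eq_intros continuous_intros simp: p field_simps)
    then show ?thesis by (simp add: arctan)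
  qed
  then have "emeasure (density lborel (\<lambda>t. f (tan t))) (V n) = emeasure (density lborel (\<lambda>s. f s * ennreal (1 / (1 + s\<^sup>2)))) (U n)" for n
    using UV by (subst (1 2) emeasure_density) auto
  then have "emeasure (density lborel (\<lambda>t. f (tan t))) (\<Union>n. V n) = emeasure (density lborel (\<lambda>s. f s * ennreal (1 / (1 + s\<^sup>2)))) (\<Union>n. U n)"
    using UV by (subst (1 2) SUP_emeasure_incseq[symmetric]) auto
  then show ?thesis unfolding uU uV by (simp add: emeasure_density)
qed

lemma nn_integral_reflect:
  fixes f :: "real \<Rightarrow> ennreal"
  assumes [measurable]: "f \<in> borel_measurable borel"
  shows "(\<integral>\<^sup>+x. f (- x) \<partial>lborel) = (\<integral>\<^sup>+x. f x \<partial>lborel)"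
  by (subst nn_integral_real_affine[where c="-1" and t=0 and f=f]) auto

lemma nn_integral_shift:
  fixes f :: "real \<Rightarrow> ennreal"
  assumes [measurable]: "f \<in> borel_measurable borel"
  shows "(\<integral>\<^sup>+x. f (t + x) \<partial>lborel) = (\<integral>\<^sup>+x. f x \<partial>lborel)"
  by (subst nn_integral_real_affine[where c=1 and t=t and f=f]) auto

text \<open>By evenness the circle counts twice its right half, and by homogeneity that half can be
  projected from the origin onto the vertical line at abscissa 1. The slope \<open>s = tan t\<close>
  is the coordinate there, and arc length has density \<open>1 / (1 + s\<^sup>2)\<close>.\<close>

lemma nn_integral_arc_length:
  fixes k :: "real ^ 2 \<Rightarrow> ennreal"
  assumes [measurable]: "k \<in> borel_measurable borel"
    and hom: "\<And>c \<xi>. 0 < c \<Longrightarrow> k (c *\<^sub>R \<xi>) = k \<xi>" and even: "\<And>\<xi>. k (- \<xi>) = k \<xi>"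
  shows "(\<integral>\<^sup>+\<Theta>. k \<Theta> \<partial>arc_length) = 2 * (\<integral>\<^sup>+s. k (vector [1, s]) * ennreal (1 / (1 + s\<^sup>2)) \<partial>lborel)"
proof -
  define F where "F t = k (vector [cos t, sin t])" for t
  have [measurable]: "F \<in> borel_measurable borel" unfolding F_def by measurable
  have mV: "(\<lambda>t. vector [cos t, sin t] :: real ^ 2) \<in> measurable (restrict_space lborel {0..<2 * pi}) borel"
    by (rule measurable_restrict_space1) measurable
  have pi_shift: "F (pi + t) = F t" for t
  proof -
    have "(vector [cos (pi + t), sin (pi + t)] :: real ^ 2) = - vector [cos t, sin t]"
      by (simp add: vec_eq_iff forall_2)
    then show ?thesis unfolding F_def by (simp add: even)
  qed
  then have pi2_shift: "F (2 * pi + t) = F t" for t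
    by (metis add.assoc mult_2)
  have "(\<integral>\<^sup>+\<Theta>. k \<Theta> \<partial>arc_length) = (\<integral>\<^sup>+t. F t * indicator {0..<2 * pi} t \<partial>lborel)"
    unfolding arc_length_def F_def using mV
    by (subst nn_integral_distr) (simp_all add: nn_integral_restrict_space)
  \<comment> \<open>The circle is cut at the two vertical directions, a null set on which the
    tangent is singular. The left half moves to the right by the period \<open>pi\<close> of
    \<open>F\<close>, and the fourth quadrant by \<open>2 * pi\<close>.\<close>
  also have "\<dots> = (\<integral>\<^sup>+t. F t * indicator {0..<pi / 2} t + (F t * indicator {pi / 2<..<3 * pi / 2} t + F t * indicator {3 * pi / 2<..<2 * pi} t) \<partial>lborel)"
  proof (rule nn_integral_cong_AE)
    have "AE t in lborel. t \<noteq> pi / 2" "AE t in lborel. t \<noteq> 3 * pi / 2" by (rule AE_lborel_singleton)+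
    then show "AE t in lborel. F t * indicator {0..<2 * pi} t = F t * indicator {0..<pi / 2} t + (F t * indicator {pi / 2<..<3 * pi / 2} t + F t * indicator {3 * pi / 2<..<2 * pi} t)"
      by eventually_elim (use pi_gt_zero in \<open>auto simp: indicator_def\<close>)
  qed
  also have "\<dots> = (\<integral>\<^sup>+t. F t * indicator {0..<pi / 2} t \<partial>lborel) +
      ((\<integral>\<^sup>+t. F t * indicator {pi / 2<..<3 * pi / 2} t \<partial>lborel) + (\<integral>\<^sup>+t. F t * indicator {3 * pi / 2<..<2 * pi} t \<partial>lborel))"
    by (simp add: nn_integral_add)
  also have "(\<integral>\<^sup>+t. F t * indicator {pi / 2<..<3 * pi / 2} t \<partial>lborel) = (\<integral>\<^sup>+t. F (pi + t) * indicator {pi / 2<..<3 * pi / 2} (pi + t) \<partial>lborel)"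
    by (rule nn_integral_shift[symmetric]) measurable
  also have "\<dots> = (\<integral>\<^sup>+t. F t * indicator {- (pi / 2)<..<pi / 2} t \<partial>lborel)"
    unfolding pi_shift by (intro nn_integral_cong arg_cong2[where f="(*)"]) (auto simp: indicator_def)
  also have "(\<integral>\<^sup>+t. F t * indicator {3 * pi / 2<..<2 * pi} t \<partial>lborel) = (\<integral>\<^sup>+t. F (2 * pi + t) * indicator {3 * pi / 2<..<2 * pi} (2 * pi + t) \<partial>lborel)"
    by (rule nn_integral_shift[symmetric]) measurable
  also have "\<dots> = (\<integral>\<^sup>+t. F t * indicator {- (pi / 2)<..<0} t \<partial>lborel)"
    unfolding pi2_shift by (intro nn_integral_cong arg_cong2[where f="(*)"]) (auto simp: indicator_def)
  also have "(\<integral>\<^sup>+t. F t * indicator {0..<pi / 2} t \<partial>lborel) +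
      ((\<integral>\<^sup>+t. F t * indicator {- (pi / 2)<..<pi / 2} t \<partial>lborel) + (\<integral>\<^sup>+t. F t * indicator {- (pi / 2)<..<0} t \<partial>lborel)) =
      (\<integral>\<^sup>+t. F t * indicator {0..<pi / 2} t + (F t * indicator {- (pi / 2)<..<pi / 2} t + F t * indicator {- (pi / 2)<..<0} t) \<partial>lborel)"
    by (simp add: nn_integral_add)
  also have "\<dots> = (\<integral>\<^sup>+t. 2 * (F t * indicator {- (pi / 2)<..<pi / 2} t) \<partial>lborel)"
    by (rule nn_integral_cong) (use pi_gt_zero in \<open>auto simp: indicator_def mult_2\<close>)
  also have "\<dots> = 2 * (\<integral>\<^sup>+t. F t * indicator {- (pi / 2)<..<pi / 2} t \<partial>lborel)"
    by (rule nn_integral_cmult) measurable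
  also have "(\<integral>\<^sup>+t. F t * indicator {- (pi / 2)<..<pi / 2} t \<partial>lborel) =
      (\<integral>\<^sup>+t. k (vector [1, tan t]) * indicator {- (pi / 2)<..<pi / 2} t \<partial>lborel)"
  proof (rule nn_integral_cong)
    fix t :: real
    have "F t = k (vector [1, tan t])" if "t \<in> {- (pi / 2)<..<pi / 2}"
    proof -
      have c: "cos t > 0" using that cos_gt_zero_pi by simp
      then have "(vector [cos t, sin t] :: real ^ 2) = cos t *\<^sub>R vector [1, tan t]"
        by (simp add: vec_eq_iff forall_2 tan_def)
      then show ?thesis unfolding F_def by (simp add: hom[OF c])
    qed
    then show "F t * indicator {- (pi / 2)<..<pi / 2} t = k (vector [1, tan t]) * indicator {- (pi / 2)<..<pi / 2} t"
      by (auto simp: indicator_def)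
  qed
  also have "\<dots> = (\<integral>\<^sup>+s. k (vector [1, s]) * ennreal (1 / (1 + s\<^sup>2)) \<partial>lborel)"
    by (rule nn_integral_arctan_substitution) measurable
  finally show ?thesis .
qed

text \<open>The substitutions \<open>y = x s\<close> on each vertical line and then \<open>r = \<bar>x\<bar> sqrt (1 + s\<^sup>2)\<close> are
  linear, so only the arc length itself needs a nonlinear change of variables.\<close>

lemma nn_integral_polar_homogeneous:
  fixes k :: "real ^ 2 \<Rightarrow> ennreal" and \<phi> :: "real \<Rightarrow> ennreal"
  assumes [measurable]: "k \<in> borel_measurable borel" "\<phi> \<in> borel_measurable borel"
    and hom: "\<And>c \<xi>. 0 < c \<Longrightarrow> k (c *\<^sub>R \<xi>) = k \<xi>" and even: "\<And>\<xi>. k (- \<xi>) = k \<xi>"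
  shows "(\<integral>\<^sup>+\<xi>. \<phi> (norm \<xi>) * k \<xi> \<partial>lborel) = (\<integral>\<^sup>+r. \<phi> r * ennreal r \<partial>lborel) * (\<integral>\<^sup>+\<Theta>. k \<Theta> \<partial>arc_length)"
proof -
  have k1: "k (vector [x, x * s]) = k (vector [1, s])" if "x \<noteq> 0" for x s
  proof -
    have v: "(vector [x, x * s] :: real ^ 2) = x *\<^sub>R vector [1, s]" for x by (simp add: vec_eq_iff forall_2)
    show ?thesis
    proof (cases "x > 0")
      case True
      then show ?thesis using v hom by simp
    next
      case False
      then have "k (vector [x, x * s]) = k (- ((- x) *\<^sub>R vector [1, s]))" using v by simp
      also have "\<dots> = k (vector [1, s])" unfolding even using False that by (intro hom) auto
      finally show ?thesis .
    qed
  qed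
  have nrm: "norm (vector [x, x * s] :: real ^ 2) = \<bar>x\<bar> * sqrt (1 + s\<^sup>2)" for x s
  proof -
    have "x\<^sup>2 + (x * s)\<^sup>2 = x\<^sup>2 * (1 + s\<^sup>2)" by algebra
    then show ?thesis by (simp add: norm_vector_2 real_sqrt_mult)
  qed
  define J where "J = (\<integral>\<^sup>+s. k (vector [1, s]) * ennreal (1 / (1 + s\<^sup>2)) \<partial>lborel)"
  have arc: "(\<integral>\<^sup>+\<Theta>. k \<Theta> \<partial>arc_length) = 2 * J"
    unfolding J_def by (rule nn_integral_arc_length) (simp_all add: hom even)
  define I where "I = (\<integral>\<^sup>+r. ennreal \<bar>r\<bar> * \<phi> \<bar>r\<bar> \<partial>lborel)"
  have "(\<integral>\<^sup>+\<xi>. \<phi> (norm \<xi>) * k \<xi> \<partial>lborel) =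
      (\<integral>\<^sup>+x. \<integral>\<^sup>+y. \<phi> (norm (vector [x, y] :: real ^ 2)) * k (vector [x, y]) \<partial>lborel \<partial>lborel)"
    by (rule nn_integral_real2) measurable
  also have "\<dots> = (\<integral>\<^sup>+x. \<integral>\<^sup>+s. ennreal \<bar>x\<bar> * \<phi> (\<bar>x\<bar> * sqrt (1 + s\<^sup>2)) * k (vector [1, s]) \<partial>lborel \<partial>lborel)"
  proof (rule nn_integral_cong_AE)
    have "AE x in lborel. x \<noteq> (0::real)" by (rule AE_lborel_singleton)
    then show "AE x in lborel. (\<integral>\<^sup>+y. \<phi> (norm (vector [x, y] :: real ^ 2)) * k (vector [x, y]) \<partial>lborel) =
       (\<integral>\<^sup>+s. ennreal \<bar>x\<bar> * \<phi> (\<bar>x\<bar> * sqrt (1 + s\<^sup>2)) * k (vector [1, s]) \<partial>lborel)"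
    proof eventually_elim
      case (elim x)
      have "(\<integral>\<^sup>+y. \<phi> (norm (vector [x, y] :: real ^ 2)) * k (vector [x, y]) \<partial>lborel) =
        \<bar>x\<bar> * (\<integral>\<^sup>+s. \<phi> (norm (vector [x, 0 + x * s] :: real ^ 2)) * k (vector [x, 0 + x * s]) \<partial>lborel)"
        by (rule nn_integral_real_affine) (use elim in auto)
      also have "\<dots> = \<bar>x\<bar> * (\<integral>\<^sup>+s. \<phi> (\<bar>x\<bar> * sqrt (1 + s\<^sup>2)) * k (vector [1, s]) \<partial>lborel)"
        using elim by (simp add: k1 nrm)
      also have "\<dots> = (\<integral>\<^sup>+s. \<bar>x\<bar> * (\<phi> (\<bar>x\<bar> * sqrt (1 + s\<^sup>2)) * k (vector [1, s])) \<partial>lborel)"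
        by (rule nn_integral_cmult[symmetric]) measurable
      finally show ?case by (simp add: mult.assoc)
    qed
  qed
  also have "\<dots> = (\<integral>\<^sup>+s. \<integral>\<^sup>+x. ennreal \<bar>x\<bar> * \<phi> (\<bar>x\<bar> * sqrt (1 + s\<^sup>2)) * k (vector [1, s]) \<partial>lborel \<partial>lborel)"
    by (rule lborel_pair.Fubini') measurable
  also have "\<dots> = (\<integral>\<^sup>+s. I * (k (vector [1, s]) * ennreal (1 / (1 + s\<^sup>2))) \<partial>lborel)"
  proof (rule nn_integral_cong)
    fix s :: real
    define w where "w = sqrt (1 + s\<^sup>2)"
    have w: "w > 0" "w\<^sup>2 = 1 + s\<^sup>2" unfolding w_def by (auto simp: add_pos_nonneg)
    have "(\<integral>\<^sup>+x. ennreal \<bar>x\<bar> * \<phi> (\<bar>x\<bar> * w) \<partial>lborel) =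
       ennreal \<bar>1 / w\<bar> * (\<integral>\<^sup>+r. ennreal \<bar>0 + 1 / w * r\<bar> * \<phi> (\<bar>0 + 1 / w * r\<bar> * w) \<partial>lborel)"
      by (rule nn_integral_real_affine) (use w in auto)
    also have "(\<integral>\<^sup>+r. ennreal \<bar>0 + 1 / w * r\<bar> * \<phi> (\<bar>0 + 1 / w * r\<bar> * w) \<partial>lborel) = (\<integral>\<^sup>+r. ennreal (1 / w) * (ennreal \<bar>r\<bar> * \<phi> \<bar>r\<bar>) \<partial>lborel)"
      using w by (intro nn_integral_cong) (simp add: abs_mult mult.assoc[symmetric] flip: ennreal_mult)
    also have "\<dots> = ennreal (1 / w) * I"
      unfolding I_def by (rule nn_integral_cmult) measurable
    finally have e: "(\<integral>\<^sup>+x. ennreal \<bar>x\<bar> * \<phi> (\<bar>x\<bar> * w) \<partial>lborel) = ennreal (1 / (1 + s\<^sup>2)) * I"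
      using w by (simp add: mult.assoc[symmetric] power2_eq_square flip: ennreal_mult)
    have "(\<integral>\<^sup>+x. ennreal \<bar>x\<bar> * \<phi> (\<bar>x\<bar> * w) * k (vector [1, s]) \<partial>lborel) = (\<integral>\<^sup>+x. ennreal \<bar>x\<bar> * \<phi> (\<bar>x\<bar> * w) \<partial>lborel) * k (vector [1, s])"
      by (rule nn_integral_multc) measurable
    then show "(\<integral>\<^sup>+x. ennreal \<bar>x\<bar> * \<phi> (\<bar>x\<bar> * sqrt (1 + s\<^sup>2)) * k (vector [1, s]) \<partial>lborel) = I * (k (vector [1, s]) * ennreal (1 / (1 + s\<^sup>2)))"
      unfolding w_def[symmetric] e by (simp add: mult_ac)
  qed
  also have "\<dots> = I * (\<integral>\<^sup>+s. k (vector [1, s]) * ennreal (1 / (1 + s\<^sup>2)) \<partial>lborel)"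
    by (rule nn_integral_cmult) measurable
  \<comment> \<open>As \<open>ennreal\<close> sends negative reals to 0, the summands are the parts
    of \<open>I\<close> over the two half-lines. They are equal, and their sum supplies the factor 2
    of the arc length formula.\<close>
  also have "I = (\<integral>\<^sup>+r. \<phi> r * ennreal r \<partial>lborel) + (\<integral>\<^sup>+r. \<phi> (- r) * ennreal (- r) \<partial>lborel)"
    unfolding I_def by (subst nn_integral_add[symmetric])
      (auto intro!: nn_integral_cong simp: abs_if ennreal_neg mult.commute)
  also have "(\<integral>\<^sup>+r. \<phi> (- r) * ennreal (- r) \<partial>lborel) = (\<integral>\<^sup>+r. \<phi> r * ennreal r \<partial>lborel)"
    by (rule nn_integral_reflect) measurable
  also have "(\<integral>\<^sup>+s. k (vector [1, s]) * ennreal (1 / (1 + s\<^sup>2)) \<partial>lborel) = J" by (simp add: J_def)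
  finally show ?thesis
    unfolding arc by (simp add: mult_2 distrib_left distrib_right)
qed

lemma nn_integral_powr_powr_finite:
  assumes "p > -2" "q < -2"
  shows "(\<integral>\<^sup>+r. ennreal (if r \<le> 1 then r powr p else r powr q) * ennreal r \<partial>lborel) < \<infinity>"
proof -
  have 1: "((\<lambda>x::real. x powr (p + 1)) has_integral (1 powr (p + 1 + 1) / (p + 1 + 1))) {0..1}"
    using assms by (intro has_integral_powr_from_0) auto
  have 2: "((\<lambda>x::real. x powr (q + 1)) has_integral (- (1 powr (q + 1 + 1)) / (q + 1 + 1))) {1..}"
    using assms by (intro has_integral_powr_to_inf) auto
  have "(\<integral>\<^sup>+r. ennreal (if r \<le> 1 then r powr p else r powr q) * ennreal r \<partial>lborel) \<le>
     (\<integral>\<^sup>+r. ennreal (indicator {0..1} r * r powr (p + 1)) + ennreal (indicator {1..} r * r powr (q + 1)) \<partial>lborel)"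
  proof (rule nn_integral_mono)
    fix r :: real
    have "r powr s * r = r powr (s + 1)" if "r > 0" for s using that by (simp add: powr_add)
    then show "ennreal (if r \<le> 1 then r powr p else r powr q) * ennreal r \<le> ennreal (indicator {0..1} r * r powr (p + 1)) + ennreal (indicator {1..} r * r powr (q + 1))"
      by (cases "r > 0") (auto simp: indicator_def ennreal_neg simp flip: ennreal_mult)
  qed
  also have "\<dots> = (\<integral>\<^sup>+r. ennreal (indicator {0..1} r * r powr (p + 1)) \<partial>lborel) + (\<integral>\<^sup>+r. ennreal (indicator {1..} r * r powr (q + 1)) \<partial>lborel)"
    by (rule nn_integral_add) measurable
  also have "\<dots> < \<infinity>"
    using nn_integral_has_integral_lebesgue[OF _ 1] nn_integral_has_integral_lebesgue[OF _ 2] by simp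
  finally show ?thesis .
qed

section \<open>Spectral estimates\<close>

text \<open>\<open>weight\<close> splits \<open>\<bar>e\<^bsup>i\<theta>\<^esup> - 1\<bar> \<le> min 2 \<bar>\<theta>\<bar>\<close> between the two ends of the frequency range: it keeps
  the vanishing at the origin and gives up the exponent \<open>g\<close> at infinity.\<close>

definition weight :: "real \<Rightarrow> real \<Rightarrow> real" where
  "weight g r = (if r \<le> 1 then r else r powr g)"

definition integrand :: "(real ^ 2 \<Rightarrow> real) \<Rightarrow> real ^ 2 \<Rightarrow> real ^ 2 \<Rightarrow> complex" where
  "integrand s x = (\<lambda>\<xi>. (exp (\<i> * of_real (x \<bullet> \<xi>)) - 1) * of_real (s \<xi>))"

definition weighted_norm2 :: "real \<Rightarrow> (real ^ 2 \<Rightarrow> real) \<Rightarrow> ennreal" where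
  "weighted_norm2 g s = (\<integral>\<^sup>+\<xi>. ennreal ((weight g (norm \<xi>))\<^sup>2 * (s \<xi>)\<^sup>2) \<partial>lborel)"

abbreviation sq_norm :: "(real ^ 2 \<Rightarrow> complex) \<Rightarrow> ennreal" where
  "sq_norm f \<equiv> (\<integral>\<^sup>+\<xi>. ennreal ((cmod (f \<xi>))\<^sup>2) \<partial>lborel)"

lemma harmonizable_integrand: "harmonizable W s x = W (integrand s x)"
  by (simp add: harmonizable_def integrand_def)

lemma borel_measurable_weight [measurable]: "weight g \<in> borel_measurable borel"
  unfolding weight_def[abs_def] by measurable

lemma borel_measurable_integrand [measurable (raw)]:
  assumes [measurable]: "s \<in> borel_measurable borel"
  shows "integrand s x \<in> borel_measurable borel"
  unfolding integrand_def by measurable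

lemma weight_nonneg: "0 \<le> r \<Longrightarrow> 0 \<le> weight g r"
  by (simp add: weight_def)

lemma cmod_iexp_minus_1_le: "cmod (exp (\<i> * of_real t) - 1) \<le> \<bar>t\<bar>" "cmod (exp (\<i> * of_real t) - 1) \<le> 2"
proof -
  show "cmod (exp (\<i> * of_real t) - 1) \<le> \<bar>t\<bar>"
    using iexp_approx1[of t 0] by simp
  have "cmod (exp (\<i> * of_real t) - 1) \<le> cmod (exp (\<i> * of_real t)) + cmod 1" by (rule norm_triangle_ineq4)
  then show "cmod (exp (\<i> * of_real t) - 1) \<le> 2" by simp
qed

lemma cmod_iexp_minus_1_le_weight:
  assumes D: "1 \<le> D" "norm x \<le> D" and g: "0 < g"
  shows "cmod (exp (\<i> * of_real (x \<bullet> \<xi>)) - 1) \<le> 2 * D * weight g (norm \<xi>)"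
proof (cases "norm \<xi> \<le> 1")
  case True
  have "cmod (exp (\<i> * of_real (x \<bullet> \<xi>)) - 1) \<le> \<bar>x \<bullet> \<xi>\<bar>" by (rule cmod_iexp_minus_1_le)
  also have "\<dots> \<le> norm x * norm \<xi>" by (rule Cauchy_Schwarz_ineq2)
  also have "\<dots> \<le> (2 * D) * norm \<xi>" using D by (intro mult_right_mono) auto
  finally show ?thesis using True by (simp add: weight_def)
next
  case False
  then have "1 \<le> norm \<xi> powr g" using g by (simp add: ge_one_powr_ge_zero)
  then have "1 * 1 \<le> D * norm \<xi> powr g" using D by (intro mult_mono) auto
  then show ?thesis using False cmod_iexp_minus_1_le(2)[of "x \<bullet> \<xi>"] by (simp add: weight_def)
qed

text \<open>For high frequencies \<open>min 2 \<bar>\<theta>\<bar> \<le> 2 * \<bar>\<theta>\<bar>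
  powr g\<close> is applied to the product of the norms, and the power splits. For low frequencies
  the linear bound is kept, and \<open>norm x \<le> D * norm x powr g\<close> because
  \<open>norm x \<le> D\<close> with \<open>1 \<le> D\<close>.\<close>

lemma cmod_iexp_minus_1_le_powr_weight:
  assumes D: "1 \<le> D" "norm x \<le> D" and g: "0 < g" "g \<le> 1"
  shows "cmod (exp (\<i> * of_real (x \<bullet> \<xi>)) - 1) \<le> 2 * D * norm x powr g * weight g (norm \<xi>)"
proof (cases "x = 0")
  case False
  then have nx: "0 < norm x" by simp
  have le: "cmod (exp (\<i> * of_real (x \<bullet> \<xi>)) - 1) \<le> norm x * norm \<xi>"
    using cmod_iexp_minus_1_le(1)[of "x \<bullet> \<xi>"] Cauchy_Schwarz_ineq2[of x \<xi>] by linarith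
  show ?thesis
  proof (cases "norm \<xi> \<le> 1")
    case True
    have "norm x = norm x powr g * norm x powr (1 - g)" using nx by (simp flip: powr_add)
    also have "norm x powr (1 - g) \<le> D powr (1 - g)" using D g by (intro powr_mono2) auto
    also have "D powr (1 - g) \<le> D powr 1" using D g by (intro powr_mono) auto
    finally have "norm x \<le> norm x powr g * D" using D by (simp add: mult_left_mono)
    then have "norm x * norm \<xi> \<le> (norm x powr g * D) * norm \<xi>" by (intro mult_right_mono) auto
    also have "\<dots> \<le> 2 * D * norm x powr g * norm \<xi>" using D by (simp add: mult_ac)
    finally show ?thesis using le True by (simp add: weight_def)
  next
    case False
    have p: "norm x powr g * norm \<xi> powr g = (norm x * norm \<xi>) powr g" by (simp add: powr_mult)
    have "cmod (exp (\<i> * of_real (x \<bullet> \<xi>)) - 1) \<le> 2 * (norm x * norm \<xi>) powr g"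
    proof (cases "norm x * norm \<xi> \<le> 1")
      case True
      have "(norm x * norm \<xi>) powr 1 \<le> (norm x * norm \<xi>) powr g"
        using True g nx False by (intro powr_mono') auto
      moreover have "0 \<le> (norm x * norm \<xi>) powr g" by simp
      moreover have "(norm x * norm \<xi>) powr 1 = norm x * norm \<xi>" by simp
      ultimately show ?thesis using le by linarith
    next
      case False
      then have "1 \<le> (norm x * norm \<xi>) powr g" using g by (intro ge_one_powr_ge_zero) auto
      then show ?thesis using cmod_iexp_minus_1_le(2)[of "x \<bullet> \<xi>"] by linarith
    qed
    also have "\<dots> \<le> 2 * D * (norm x * norm \<xi>) powr g" using D by (intro mult_right_mono) auto
    finally show ?thesis using False by (simp add: weight_def p mult.assoc)
  qed
qed (use D in \<open>simp add: weight_nonneg\<close>)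

lemma cmod_add_power2_le: "(cmod (a + b))\<^sup>2 \<le> 2 * (cmod a)\<^sup>2 + 2 * (cmod b)\<^sup>2"
proof -
  have "(cmod (a + b))\<^sup>2 \<le> (cmod a + cmod b)\<^sup>2" by (intro power_mono norm_triangle_ineq) auto
  also have "\<dots> \<le> 2 * (cmod a)\<^sup>2 + 2 * (cmod b)\<^sup>2"
    using sum_squares_bound[of "cmod a" "cmod b"] by (simp add: power2_sum)
  finally show ?thesis .
qed

text \<open>Adding and subtracting separates a translation of \<open>x\<close> to \<open>y\<close>
  under the density \<open>s\<close>, which gains a power of \<open>norm (x - y)\<close>, from the
  change of density at the bounded point \<open>y\<close>, which gains nothing from the exponential
  factor. The constant is twice the square of \<open>2 * D\<close>.\<close>

lemma nn_integral_integrand_diff_le: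
  assumes [measurable]: "s \<in> borel_measurable borel" "s' \<in> borel_measurable borel"
    and D: "1 \<le> D" "norm y \<le> D" "norm (x - y) \<le> D" and g: "0 < g" "g \<le> 1"
  shows "sq_norm (\<lambda>\<xi>. integrand s x \<xi> - integrand s' y \<xi>) \<le>
    ennreal (8 * D\<^sup>2) * (ennreal (norm (x - y) powr (2 * g)) * weighted_norm2 g s + weighted_norm2 g (\<lambda>\<xi>. s \<xi> - s' \<xi>))"
proof -
  let ?w = "\<lambda>\<xi> :: real ^ 2. weight g (norm \<xi>)"
  have "sq_norm (\<lambda>\<xi>. integrand s x \<xi> - integrand s' y \<xi>) \<le>
     (\<integral>\<^sup>+\<xi>. ennreal (8 * D\<^sup>2) * (ennreal (norm (x - y) powr (2 * g)) * ennreal ((?w \<xi>)\<^sup>2 * (s \<xi>)\<^sup>2) + ennreal ((?w \<xi>)\<^sup>2 * (s \<xi> - s' \<xi>)\<^sup>2)) \<partial>lborel)"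
  proof (rule nn_integral_mono)
    fix \<xi>
    let ?e = "\<lambda>x :: real ^ 2. exp (\<i> * of_real (x \<bullet> \<xi>))"
    have e: "?e x = ?e y * ?e (x - y)" by (simp add: inner_diff_left algebra_simps flip: exp_add)
    have "integrand s x \<xi> - integrand s' y \<xi> = (?e y * (?e (x - y) - 1)) * of_real (s \<xi>) + (?e y - 1) * of_real (s \<xi> - s' \<xi>)"
      unfolding integrand_def e by (simp add: algebra_simps)
    then have "(cmod (integrand s x \<xi> - integrand s' y \<xi>))\<^sup>2 \<le>
        2 * (cmod ((?e y * (?e (x - y) - 1)) * of_real (s \<xi>)))\<^sup>2 + 2 * (cmod ((?e y - 1) * of_real (s \<xi> - s' \<xi>)))\<^sup>2"
      using cmod_add_power2_le by simp
    also have "\<dots> = 2 * ((cmod (?e (x - y) - 1))\<^sup>2 * (s \<xi>)\<^sup>2) + 2 * ((cmod (?e y - 1))\<^sup>2 * (s \<xi> - s' \<xi>)\<^sup>2)"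
      by (simp only: norm_mult norm_of_real norm_exp_i_times power_mult_distrib mult_1 power2_abs)
    also have "\<dots> \<le> 2 * ((2 * D * norm (x - y) powr g * ?w \<xi>)\<^sup>2 * (s \<xi>)\<^sup>2) + 2 * ((2 * D * ?w \<xi>)\<^sup>2 * (s \<xi> - s' \<xi>)\<^sup>2)"
      using D g by (intro add_mono mult_left_mono mult_right_mono power_mono cmod_iexp_minus_1_le_weight cmod_iexp_minus_1_le_powr_weight) auto
    also have "\<dots> = (8 * D\<^sup>2) * ((norm (x - y) powr g)\<^sup>2 * ((?w \<xi>)\<^sup>2 * (s \<xi>)\<^sup>2) + (?w \<xi>)\<^sup>2 * (s \<xi> - s' \<xi>)\<^sup>2)"
      by (simp add: power_mult_distrib algebra_simps)
    also have "(norm (x - y) powr g)\<^sup>2 = norm (x - y) powr (2 * g)"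
      by (simp add: power2_eq_square flip: powr_add)
    finally have "(cmod (integrand s x \<xi> - integrand s' y \<xi>))\<^sup>2 \<le>
       (8 * D\<^sup>2) * (norm (x - y) powr (2 * g) * ((?w \<xi>)\<^sup>2 * (s \<xi>)\<^sup>2) + (?w \<xi>)\<^sup>2 * (s \<xi> - s' \<xi>)\<^sup>2)" .
    then show "ennreal ((cmod (integrand s x \<xi> - integrand s' y \<xi>))\<^sup>2) \<le>
      ennreal (8 * D\<^sup>2) * (ennreal (norm (x - y) powr (2 * g)) * ennreal ((?w \<xi>)\<^sup>2 * (s \<xi>)\<^sup>2) + ennreal ((?w \<xi>)\<^sup>2 * (s \<xi> - s' \<xi>)\<^sup>2))"
      by (simp add: ennreal_leI flip: ennreal_mult ennreal_plus)
  qed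
  also have "\<dots> = ennreal (8 * D\<^sup>2) * (ennreal (norm (x - y) powr (2 * g)) * weighted_norm2 g s + weighted_norm2 g (\<lambda>\<xi>. s \<xi> - s' \<xi>))"
    unfolding weighted_norm2_def by (simp add: nn_integral_add nn_integral_cmult)
  finally show ?thesis .
qed

lemma integrand_hermitian_L2:
  assumes [measurable]: "s \<in> borel_measurable borel" and even: "\<And>\<xi>. s (- \<xi>) = s \<xi>"
    and fin: "weighted_norm2 g s < \<infinity>" and g: "0 < g" "g \<le> 1"
  shows "integrand s x \<in> hermitian_L2"
proof -
  \<comment> \<open>The integrand vanishes at the origin, so its norm is that of an increment with
    unchanged density.\<close>
  have "sq_norm (integrand s x) = sq_norm (\<lambda>\<xi>. integrand s x \<xi> - integrand s 0 \<xi>)" by (simp add: integrand_def)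
  also have "\<dots> \<le> ennreal (8 * (1 + norm x)\<^sup>2) *
      (ennreal (norm (x - 0) powr (2 * g)) * weighted_norm2 g s + weighted_norm2 g (\<lambda>\<xi>. s \<xi> - s \<xi>))"
    by (rule nn_integral_integrand_diff_le) (use g in auto)
  also have "\<dots> < \<infinity>" using fin by (simp add: ennreal_mult_less_top weighted_norm2_def)
  finally have "integrable lborel (\<lambda>\<xi>. (cmod (integrand s x \<xi>))\<^sup>2)"
    by (intro integrableI_nonneg) auto
  moreover have "integrand s x (- \<xi>) = cnj (integrand s x \<xi>)" for \<xi>
    by (simp add: integrand_def even exp_cnj)
  ultimately show ?thesis by (simp add: hermitian_L2_def)
qed

text \<open>This is the mean value estimate for \<open>p\<close> in \<open>exp (p * ln r)\<close>,
  obtained from \<open>1 + x \<le> exp x\<close>. The price of varying the exponent is the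
  logarithm.\<close>

lemma abs_powr_diff_le:
  fixes r p q :: real
  assumes "0 < r"
  shows "\<bar>r powr p - r powr q\<bar> \<le> \<bar>p - q\<bar> * \<bar>ln r\<bar> * max (r powr p) (r powr q)"
proof -
  have *: "exp s - exp t \<le> (s - t) * exp s" for s t :: real
  proof -
    have "1 + (t - s) \<le> exp (t - s)" by (rule exp_ge_add_one_self)
    then have "exp s * (1 + (t - s)) \<le> exp s * exp (t - s)" by (intro mult_left_mono) auto
    then show ?thesis by (simp add: algebra_simps flip: exp_add)
  qed
  have **: "\<bar>exp s - exp t\<bar> \<le> \<bar>s - t\<bar> * max (exp s) (exp t)" for s t :: real
  proof (cases "t \<le> s")
    case True
    then show ?thesis using *[of s t] by (simp add: max_def)
  next
    case False
    then show ?thesis using *[of t s] by (simp add: max_def)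
  qed
  have "\<bar>p * ln r - q * ln r\<bar> = \<bar>p - q\<bar> * \<bar>ln r\<bar>" by (simp add: abs_mult flip: left_diff_distrib)
  then show ?thesis using **[of "p * ln r" "q * ln r"] assms by (simp add: powr_def)
qed

lemma abs_ln_le_powr:
  fixes r e :: real
  assumes "0 < r" "0 < e"
  shows "r \<le> 1 \<Longrightarrow> \<bar>ln r\<bar> \<le> r powr (- e) / e" "1 \<le> r \<Longrightarrow> \<bar>ln r\<bar> \<le> r powr e / e"
proof -
  show "1 \<le> r \<Longrightarrow> \<bar>ln r\<bar> \<le> r powr e / e" using ln_powr_bound[of r e] assms by simp
  assume "r \<le> 1"
  then have "ln (1 / r) \<le> (1 / r) powr e / e" using assms by (intro ln_powr_bound) auto
  then show "\<bar>ln r\<bar> \<le> r powr (- e) / e" using assms \<open>r \<le> 1\<close> by (simp add: ln_div powr_minus powr_divide inverse_eq_divide)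
qed

lemma emeasure_arc_length: "emeasure arc_length (space arc_length) = ennreal (2 * pi)"
  unfolding arc_length_def
  by (subst emeasure_distr) (auto simp: emeasure_restrict_space space_restrict_space intro!: measurable_restrict_space1)

lemma sets_arc_length [simp, measurable_cong]: "sets arc_length = sets borel"
  by (simp add: arc_length_def)


section \<open>The spectral density of the field and its dependence on the base point\<close>

locale gafbf_spectrum =
  fixes h :: "real ^ 2 \<Rightarrow> real" and C :: "real ^ 2 \<Rightarrow> real ^ 2 \<Rightarrow> real"
    and a b \<beta> \<Lambda> M \<eta> :: real and A :: "real ^ 2 \<Rightarrow> real"
  assumes h_bounds: "0 < a" "b < 1" "\<And>x. a \<le> h x" "\<And>x. h x \<le> b"
    and hoelder: "\<And>x y. \<bar>h x - h y\<bar> \<le> \<Lambda> * norm (x - y) powr \<beta>"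
    and exponents: "b < \<beta>" "b < \<eta>"
    and C_nonneg: "\<And>x \<xi>. 0 \<le> C x \<xi>"
    and C_measurable: "\<And>x. C x \<in> borel_measurable borel"
    and C_bounded: "\<And>x \<xi>. C x \<xi> \<le> M"
    and C_even: "\<And>x \<xi>. C x (- \<xi>) = C x \<xi>"
    and C_homogeneous: "\<And>x \<xi> \<rho>. 0 < \<rho> \<Longrightarrow> C x (\<rho> *\<^sub>R \<xi>) = C x \<xi>"
    and C_increments: "\<And>x z. z \<in> ball 0 1 \<Longrightarrow>
      norm z powr (- 2 * \<eta>) * (LINT \<Theta>|arc_length. (C (x + z) \<Theta> - C x \<Theta>)\<^sup>2) \<le> A x"
    and A_bounded: "\<And>K. compact K \<Longrightarrow> bounded (A ` K)"
begin

declare C_measurable [measurable]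

abbreviation s where "s \<equiv> sqrt_density h C"
abbreviation arc_sq where "arc_sq x y \<equiv> (\<integral>\<^sup>+\<Theta>. ennreal ((C x \<Theta> - C y \<Theta>)\<^sup>2) \<partial>arc_length)"

text \<open>The loss \<open>\<epsilon>\<close> absorbs the logarithm caused by the varying exponent.
  The bound \<open>(1 - b) / 2\<close> keeps \<open>b + \<epsilon> < 1\<close> for integrability at
  the origin; the bound \<open>a / 4\<close> together with \<open>\<gamma> = a / 2\<close> keeps
  \<open>\<gamma> < a - \<epsilon>\<close> for integrability at infinity.\<close>

definition \<epsilon> where "\<epsilon> = min (a / 4) ((1 - b) / 2)"
definition \<gamma> where "\<gamma> = a / 2"
text \<open>The exponent at which the density varies with the base point: \<open>\<eta>\<close>
  comes from the anisotropy, \<open>\<beta>\<close> from the Hurst function.\<close>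

definition \<kappa> where "\<kappa> = min \<eta> \<beta>"
text \<open>A radial majorant, uniform in the base point, of the squared weight times the squared
  radial part of the density, with room for the square of a logarithm. It is integrable against
  \<open>r dr\<close> by the choice of \<open>\<epsilon>\<close> and
  \<open>\<gamma>\<close>.\<close>

definition \<phi> where "\<phi> r = (if r \<le> 1 then r powr (- 2 * (b + \<epsilon>)) else r powr (2 * \<gamma> - 2 * (a - \<epsilon>) - 2))"
definition I\<phi> where "I\<phi> = enn2real (\<integral>\<^sup>+r. ennreal (\<phi> r) * ennreal r \<partial>lborel)"

lemma a_le_b: "a \<le> b" using h_bounds(3,4)[of 0] by linarith

lemma \<epsilon>: "0 < \<epsilon>" "\<epsilon> \<le> a / 4" "b + \<epsilon> < 1"
proof -
  show "0 < \<epsilon>" using h_bounds by (simp add: \<epsilon>_def)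
  show "\<epsilon> \<le> a / 4" by (simp add: \<epsilon>_def)
  have "\<epsilon> \<le> (1 - b) / 2" unfolding \<epsilon>_def by (rule min.cobounded2)
  then show "b + \<epsilon> < 1" using h_bounds(2) by (simp add: field_simps)
qed

lemma \<gamma>: "0 < \<gamma>" "\<gamma> \<le> 1" "\<gamma> < \<kappa>" "b < \<kappa>"
  using h_bounds(1,2) a_le_b exponents by (auto simp: \<gamma>_def \<kappa>_def)

lemma \<phi>_nonneg: "0 \<le> \<phi> r" by (simp add: \<phi>_def)

lemma borel_measurable_\<phi> [measurable]: "\<phi> \<in> borel_measurable borel"
  unfolding \<phi>_def[abs_def] by measurable

lemma I\<phi>: "(\<integral>\<^sup>+r. ennreal (\<phi> r) * ennreal r \<partial>lborel) = ennreal I\<phi>" "0 \<le> I\<phi>"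
proof -
  have "(\<integral>\<^sup>+r. ennreal (\<phi> r) * ennreal r \<partial>lborel) < \<infinity>"
    unfolding \<phi>_def using \<epsilon> h_bounds(1)
    by (intro nn_integral_powr_powr_finite) (auto simp: \<gamma>_def)
  then show "(\<integral>\<^sup>+r. ennreal (\<phi> r) * ennreal r \<partial>lborel) = ennreal I\<phi>" by (simp add: I\<phi>_def)
qed (simp add: I\<phi>_def)

text \<open>Low and high frequencies differ only in the exponents: \<open>w\<close> belongs to the
  weight and \<open>e\<close> dominates the radial densities for all base points, with or without
  the logarithm. The later estimates can then ignore the distinction.\<close>

lemma frequency_split:
  assumes r: "0 < r"
  obtains w e where "weight \<gamma> r = r powr w" "\<phi> r = r powr (2 * (w + e))"
    "\<And>x. r powr (- (h x + 1)) \<le> r powr e" "\<And>x. \<bar>ln r\<bar> * r powr (- (h x + 1)) \<le> r powr e / \<epsilon>"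
proof (cases "r \<le> 1")
  case True
  have "\<bar>ln r\<bar> * r powr (- (h x + 1)) \<le> r powr (- (b + \<epsilon>) - 1) / \<epsilon>" for x
  proof -
    have "\<bar>ln r\<bar> * r powr (- (h x + 1)) \<le> r powr (- \<epsilon>) / \<epsilon> * r powr (- (b + 1))"
      using abs_ln_le_powr(1)[OF r \<epsilon>(1) True] True r h_bounds(4)[of x] \<epsilon>(1) by (intro mult_mono powr_mono') auto
    also have "\<dots> = r powr (- \<epsilon> + - (b + 1)) / \<epsilon>" by (simp only: powr_add) simp
    also have "- \<epsilon> + - (b + 1) = - (b + \<epsilon>) - 1" by simp
    finally show ?thesis .
  qed
  moreover have "r powr (- (h x + 1)) \<le> r powr (- (b + \<epsilon>) - 1)" for x
    using True r h_bounds(4)[of x] \<epsilon>(1) by (intro powr_mono') auto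
  ultimately show ?thesis using True r by (intro that[of 1 "- (b + \<epsilon>) - 1"]) (auto simp: weight_def \<phi>_def)
next
  case False
  have "\<bar>ln r\<bar> * r powr (- (h x + 1)) \<le> r powr (- (a - \<epsilon>) - 1) / \<epsilon>" for x
  proof -
    have "\<bar>ln r\<bar> * r powr (- (h x + 1)) \<le> r powr \<epsilon> / \<epsilon> * r powr (- (a + 1))"
      using abs_ln_le_powr(2)[OF r \<epsilon>(1)] False h_bounds(3)[of x] \<epsilon>(1) by (intro mult_mono powr_mono) auto
    also have "\<dots> = r powr (\<epsilon> + - (a + 1)) / \<epsilon>" by (simp only: powr_add) simp
    also have "\<epsilon> + - (a + 1) = - (a - \<epsilon>) - 1" by simp
    finally show ?thesis .
  qed
  moreover have "r powr (- (h x + 1)) \<le> r powr (- (a - \<epsilon>) - 1)" for x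
    using False h_bounds(3)[of x] \<epsilon>(1) by (intro powr_mono) auto
  ultimately show ?thesis using False by (intro that[of \<gamma> "- (a - \<epsilon>) - 1"]) (auto simp: weight_def \<phi>_def algebra_simps)
qed

lemma powr_power2: "(r powr p)\<^sup>2 = r powr (2 * p)" for r p :: real
  by (simp add: power2_eq_square flip: powr_add)

lemma weight_powr_le:
  assumes "0 \<le> r"
  shows "(weight \<gamma> r)\<^sup>2 * (r powr (- (h x + 1)))\<^sup>2 \<le> \<phi> r"
proof (cases "r = 0")
  case False
  then have "0 < r" using assms by simp
  then obtain w e where we: "weight \<gamma> r = r powr w" "\<phi> r = r powr (2 * (w + e))" "r powr (- (h x + 1)) \<le> r powr e"
    using frequency_split[of r] by metis
  have "(weight \<gamma> r)\<^sup>2 * (r powr (- (h x + 1)))\<^sup>2 \<le> (r powr w)\<^sup>2 * (r powr e)\<^sup>2"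
    unfolding we(1) by (intro mult_left_mono power_mono we(3)) auto
  also have "\<dots> = \<phi> r" unfolding we(2) powr_power2 by (simp add: distrib_left powr_add)
  finally show ?thesis .
qed (simp add: weight_def \<phi>_nonneg)

lemma weight_powr_diff_le:
  assumes "0 \<le> r"
  shows "(weight \<gamma> r)\<^sup>2 * (r powr (- (h x + 1)) - r powr (- (h y + 1)))\<^sup>2 \<le> ((h x - h y) / \<epsilon>)\<^sup>2 * \<phi> r"
proof (cases "r = 0")
  case False
  then have r: "0 < r" using assms by simp
  then obtain w e where we: "weight \<gamma> r = r powr w" "\<phi> r = r powr (2 * (w + e))"
    "\<And>x. \<bar>ln r\<bar> * r powr (- (h x + 1)) \<le> r powr e / \<epsilon>"
    using frequency_split[of r] by metis
  have "\<bar>r powr (- (h x + 1)) - r powr (- (h y + 1))\<bar> \<le> \<bar>h x - h y\<bar> * \<bar>ln r\<bar> * max (r powr (- (h x + 1))) (r powr (- (h y + 1)))"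
    using abs_powr_diff_le[OF r, of "- (h x + 1)" "- (h y + 1)"] by (simp add: abs_minus_commute)
  also have "\<dots> \<le> \<bar>h x - h y\<bar> * (r powr e / \<epsilon>)"
    unfolding mult.assoc using we(3)[of x] we(3)[of y] by (intro mult_left_mono) (simp_all only: max_def if_split abs_ge_zero, auto)
  finally have "(r powr (- (h x + 1)) - r powr (- (h y + 1)))\<^sup>2 \<le> (\<bar>h x - h y\<bar> * (r powr e / \<epsilon>))\<^sup>2"
    unfolding abs_le_square_iff[symmetric] using \<epsilon>(1) by (simp add: abs_mult)
  then have "(weight \<gamma> r)\<^sup>2 * (r powr (- (h x + 1)) - r powr (- (h y + 1)))\<^sup>2 \<le> (r powr w)\<^sup>2 * (\<bar>h x - h y\<bar> * (r powr e / \<epsilon>))\<^sup>2"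
    unfolding we(1) by (rule mult_left_mono) simp
  also have "\<dots> = ((h x - h y) / \<epsilon>)\<^sup>2 * \<phi> r"
    unfolding we(2) power_mult_distrib power_divide powr_power2 by (simp add: distrib_left powr_add)
  finally show ?thesis .
qed (simp add: weight_def \<phi>_nonneg)

lemma s_eq: "s x \<xi> = C x \<xi> * norm \<xi> powr (- (h x + 1))"
  unfolding sqrt_density_def powr_minus by (simp add: divide_inverse)

lemma borel_measurable_s [measurable]: "s x \<in> borel_measurable borel"
  unfolding s_eq[abs_def] by measurable

lemma s_even: "s x (- \<xi>) = s x \<xi>"
  by (simp add: s_eq C_even)

lemma C_power2_le: "(C x \<xi>)\<^sup>2 \<le> M\<^sup>2"
  using C_nonneg C_bounded by (intro power_mono) auto

lemma C_diff_power2_le: "(C x \<xi> - C y \<xi>)\<^sup>2 \<le> M\<^sup>2"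
  using C_nonneg[of x \<xi>] C_bounded[of x \<xi>] C_nonneg[of y \<xi>] C_bounded[of y \<xi>] by (intro abs_le_square_iff[THEN iffD1]) auto

lemma nn_integral_\<phi>: "(\<integral>\<^sup>+\<xi>. ennreal (\<phi> (norm \<xi>)) \<partial>(lborel :: (real ^ 2) measure)) = ennreal (I\<phi> * (2 * pi))"
  using nn_integral_polar_homogeneous[of "\<lambda>_. 1" "\<lambda>r. ennreal (\<phi> r)"] I\<phi> emeasure_arc_length
  by (simp flip: ennreal_mult)

lemma weighted_norm2_s_le: "weighted_norm2 \<gamma> (s x) \<le> ennreal (M\<^sup>2 * (I\<phi> * (2 * pi)))"
proof -
  have "weighted_norm2 \<gamma> (s x) \<le> (\<integral>\<^sup>+\<xi>. ennreal (M\<^sup>2) * ennreal (\<phi> (norm \<xi>)) \<partial>(lborel :: (real ^ 2) measure))"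
    unfolding weighted_norm2_def
  proof (rule nn_integral_mono)
    fix \<xi>
    have "(weight \<gamma> (norm \<xi>))\<^sup>2 * (s x \<xi>)\<^sup>2 = (C x \<xi>)\<^sup>2 * ((weight \<gamma> (norm \<xi>))\<^sup>2 * (norm \<xi> powr (- (h x + 1)))\<^sup>2)"
      unfolding s_eq power_mult_distrib by (simp only: mult_ac)
    also have "\<dots> \<le> M\<^sup>2 * \<phi> (norm \<xi>)"
      by (intro mult_mono C_power2_le weight_powr_le) auto
    finally show "ennreal ((weight \<gamma> (norm \<xi>))\<^sup>2 * (s x \<xi>)\<^sup>2) \<le> ennreal (M\<^sup>2) * ennreal (\<phi> (norm \<xi>))"
      using \<phi>_nonneg by (simp add: ennreal_leI flip: ennreal_mult)
  qed
  also have "\<dots> = ennreal (M\<^sup>2 * (I\<phi> * (2 * pi)))"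
    using I\<phi>(2) by (subst nn_integral_cmult) (auto simp: nn_integral_\<phi> simp flip: ennreal_mult)
  finally show ?thesis .
qed

text \<open>The product \<open>C x \<xi> * norm \<xi> powr (- (h x + 1))\<close> changes through
  either factor. The squared change of \<open>C\<close> is even and homogeneous of degree 0, so
  polar coordinates turn its share into the arc integral controlled by the hypothesis; the change of
  the exponent costs \<open>(h x - h y) / \<epsilon>\<close>.\<close>

lemma weighted_norm2_diff_le:
  "weighted_norm2 \<gamma> (\<lambda>\<xi>. s x \<xi> - s y \<xi>) \<le> ennreal 2 * (ennreal I\<phi> * arc_sq x y
     + ennreal (M\<^sup>2 * ((h x - h y) / \<epsilon>)\<^sup>2 * (I\<phi> * (2 * pi))))"
proof -
  have "weighted_norm2 \<gamma> (\<lambda>\<xi>. s x \<xi> - s y \<xi>) \<le>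
     (\<integral>\<^sup>+\<xi>. ennreal 2 * (ennreal (\<phi> (norm \<xi>)) * ennreal ((C x \<xi> - C y \<xi>)\<^sup>2) + ennreal (M\<^sup>2 * ((h x - h y) / \<epsilon>)\<^sup>2) * ennreal (\<phi> (norm \<xi>))) \<partial>lborel)"
    unfolding weighted_norm2_def
  proof (rule nn_integral_mono)
    fix \<xi> :: "real ^ 2"
    let ?p = "norm \<xi> powr (- (h x + 1))" and ?q = "norm \<xi> powr (- (h y + 1))" and ?w = "weight \<gamma> (norm \<xi>)"
    have "s x \<xi> - s y \<xi> = (C x \<xi> - C y \<xi>) * ?p + C y \<xi> * (?p - ?q)" unfolding s_eq by (simp add: algebra_simps)
    then have "(s x \<xi> - s y \<xi>)\<^sup>2 \<le> 2 * ((C x \<xi> - C y \<xi>) * ?p)\<^sup>2 + 2 * (C y \<xi> * (?p - ?q))\<^sup>2"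
      using sum_squares_bound[of "(C x \<xi> - C y \<xi>) * ?p" "C y \<xi> * (?p - ?q)"] by (simp add: power2_sum)
    then have "?w\<^sup>2 * (s x \<xi> - s y \<xi>)\<^sup>2 \<le> ?w\<^sup>2 * (2 * ((C x \<xi> - C y \<xi>) * ?p)\<^sup>2 + 2 * (C y \<xi> * (?p - ?q))\<^sup>2)"
      by (intro mult_left_mono) auto
    also have "\<dots> = 2 * ((?w\<^sup>2 * ?p\<^sup>2) * (C x \<xi> - C y \<xi>)\<^sup>2 + (C y \<xi>)\<^sup>2 * (?w\<^sup>2 * (?p - ?q)\<^sup>2))"
      unfolding power_mult_distrib by (simp add: distrib_left mult_ac)
    also have "\<dots> \<le> 2 * (\<phi> (norm \<xi>) * (C x \<xi> - C y \<xi>)\<^sup>2 + M\<^sup>2 * (((h x - h y) / \<epsilon>)\<^sup>2 * \<phi> (norm \<xi>)))"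
      by (intro mult_left_mono add_mono mult_right_mono mult_mono weight_powr_le weight_powr_diff_le C_power2_le) auto
    finally have "?w\<^sup>2 * (s x \<xi> - s y \<xi>)\<^sup>2 \<le> 2 * (\<phi> (norm \<xi>) * (C x \<xi> - C y \<xi>)\<^sup>2 + M\<^sup>2 * ((h x - h y) / \<epsilon>)\<^sup>2 * \<phi> (norm \<xi>))"
      by (simp only: mult.assoc)
    then show "ennreal (?w\<^sup>2 * (s x \<xi> - s y \<xi>)\<^sup>2) \<le> ennreal 2 * (ennreal (\<phi> (norm \<xi>)) * ennreal ((C x \<xi> - C y \<xi>)\<^sup>2) + ennreal (M\<^sup>2 * ((h x - h y) / \<epsilon>)\<^sup>2) * ennreal (\<phi> (norm \<xi>)))"
      using \<phi>_nonneg[of "norm \<xi>"] by (subst ennreal_mult[symmetric] ennreal_plus[symmetric], simp, simp)+ (rule ennreal_leI)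
  qed
  also have "\<dots> = ennreal 2 * ((\<integral>\<^sup>+\<xi>. ennreal (\<phi> (norm \<xi>)) * ennreal ((C x \<xi> - C y \<xi>)\<^sup>2) \<partial>lborel)
      + ennreal (M\<^sup>2 * ((h x - h y) / \<epsilon>)\<^sup>2) * (\<integral>\<^sup>+\<xi>. ennreal (\<phi> (norm \<xi>)) \<partial>(lborel :: (real ^ 2) measure)))"
    by (subst nn_integral_cmult, measurable, subst nn_integral_add, measurable, subst nn_integral_cmult, measurable)
  also have "(\<integral>\<^sup>+\<xi>. ennreal (\<phi> (norm \<xi>)) * ennreal ((C x \<xi> - C y \<xi>)\<^sup>2) \<partial>lborel) =
      ennreal I\<phi> * arc_sq x y"
    unfolding I\<phi>(1)[symmetric]
    by (rule nn_integral_polar_homogeneous) (simp_all add: C_even C_homogeneous)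
  also have "ennreal (M\<^sup>2 * ((h x - h y) / \<epsilon>)\<^sup>2) * (\<integral>\<^sup>+\<xi>. ennreal (\<phi> (norm \<xi>)) \<partial>(lborel :: (real ^ 2) measure)) =
      ennreal (M\<^sup>2 * ((h x - h y) / \<epsilon>)\<^sup>2 * (I\<phi> * (2 * pi)))"
    unfolding nn_integral_\<phi> using I\<phi>(2) by (intro ennreal_mult[symmetric]) auto
  finally show ?thesis .
qed

text \<open>The hypothesis on \<open>C\<close> concerns increments shorter than 1 and a base point
  in a compact set. For longer increments the boundedness of \<open>C\<close> is enough, since the
  right-hand power is then at least 1; \<open>M\<^sup>2 * (2 * pi)\<close> is the resulting
  constant.\<close>

lemma arc_increment_le:
  "\<exists>L\<ge>0. \<forall>x y. norm x \<le> R \<longrightarrow> norm y \<le> R \<longrightarrow>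
    arc_sq x y \<le> ennreal (L * norm (x - y) powr (2 * \<eta>))"
proof -
  have \<eta>: "0 < \<eta>" using exponents(2) a_le_b h_bounds(1) by linarith
  obtain L where "\<forall>v\<in>A ` cball 0 R. norm v \<le> L"
    using A_bounded[OF compact_cball[of 0 R]] unfolding bounded_iff by blast
  then have L: "\<bar>A y\<bar> \<le> L" if "norm y \<le> R" for y using that by simp
  interpret arc: finite_measure arc_length
    by (rule finite_measureI) (simp add: emeasure_arc_length)
  have int: "integrable arc_length (\<lambda>\<Theta>. (C x \<Theta> - C y \<Theta>)\<^sup>2)" for x y
    by (rule arc.integrable_const_bound[where B="M\<^sup>2"]) (auto simp: C_diff_power2_le)
  define L' where "L' = max (max L 0) (M\<^sup>2 * (2 * pi))"
  show ?thesis
  proof (intro exI[of _ L'] conjI allI impI)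
    show "0 \<le> L'" by (simp add: L'_def)
    fix x y :: "real ^ 2" assume "norm x \<le> R" and y: "norm y \<le> R"
    let ?I = "LINT \<Theta>|arc_length. (C x \<Theta> - C y \<Theta>)\<^sup>2"
    have "?I \<le> L' * norm (x - y) powr (2 * \<eta>)"
    proof (cases "x = y \<or> 1 \<le> norm (x - y)")
      case True
      then show ?thesis
      proof
        assume big: "1 \<le> norm (x - y)"
        have "?I \<le> (LINT \<Theta>|arc_length. M\<^sup>2)"
          by (intro integral_mono int) (auto simp: C_diff_power2_le)
        also have "\<dots> = M\<^sup>2 * (2 * pi)" using emeasure_arc_length by (simp add: measure_def mult.commute)
        also have "\<dots> \<le> L' * 1" by (simp add: L'_def)
        also have "\<dots> \<le> L' * norm (x - y) powr (2 * \<eta>)"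
          using big \<eta> by (intro mult_left_mono ge_one_powr_ge_zero) (auto simp: L'_def)
        finally show ?thesis .
      qed (use \<eta> in simp)
    next
      case False
      then have n: "0 < norm (x - y)" "x - y \<in> ball 0 1" by auto
      have "norm (x - y) powr (- 2 * \<eta>) * ?I \<le> A y" using C_increments[OF n(2), of y] by simp
      also have "\<dots> \<le> L'" using L[OF y] by (simp add: L'_def)
      finally have "norm (x - y) powr (2 * \<eta>) * (norm (x - y) powr (- 2 * \<eta>) * ?I) \<le> norm (x - y) powr (2 * \<eta>) * L'"
        by (intro mult_left_mono) auto
      moreover have "norm (x - y) powr (2 * \<eta>) * norm (x - y) powr (- 2 * \<eta>) = 1"
        using n(1) by (simp flip: powr_add)
      ultimately show ?thesis by (simp add: mult.assoc[symmetric] mult.commute[of L'])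
    qed
    then have "ennreal ?I \<le> ennreal (L' * norm (x - y) powr (2 * \<eta>))" by (rule ennreal_leI)
    then show "arc_sq x y \<le> ennreal (L' * norm (x - y) powr (2 * \<eta>))"
      by (subst nn_integral_eq_integral[OF int]) auto
  qed
qed

lemma powr_le_on_bounded:
  fixes d D p q :: real
  assumes "0 \<le> d" "d \<le> D" "1 \<le> D" "p \<le> q"
  shows "d powr q \<le> D powr (q - p) * d powr p"
proof (cases "d = 0")
  case False
  have "d powr q = d powr (q - p) * d powr p" by (simp only: powr_add[symmetric]) simp
  also have "\<dots> \<le> D powr (q - p) * d powr p" using assms by (intro mult_right_mono powr_mono2) auto
  finally show ?thesis .
qed simp

text \<open>On a bounded set a Hoelder estimate with exponent \<open>\<eta>\<close> or
  \<open>\<beta>\<close> implies one with their minimum \<open>\<kappa>\<close>, at the cost of a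
  power of the diameter bound \<open>D\<close>.\<close>

lemma weighted_norm2_increment_le:
  "\<exists>L. \<forall>N. 0 \<le> L N \<and> (\<forall>x y. norm x \<le> real N \<longrightarrow> norm y \<le> real N \<longrightarrow>
    weighted_norm2 \<gamma> (\<lambda>\<xi>. s x \<xi> - s y \<xi>) \<le> ennreal (L N * norm (x - y) powr (2 * \<kappa>)))"
proof (rule choice, rule allI)
  fix N
  define R where "R = real N"
  obtain L where L: "0 \<le> L" "\<And>x y. norm x \<le> R \<Longrightarrow> norm y \<le> R \<Longrightarrow>
    arc_sq x y \<le> ennreal (L * norm (x - y) powr (2 * \<eta>))"
    using arc_increment_le[of R] by blast
  define D where "D = max 1 (2 * R)"
  define L1 where "L1 = I\<phi> * (L * D powr (2 * \<eta> - 2 * \<kappa>))"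
  define L2 where "L2 = M\<^sup>2 * ((\<Lambda>\<^sup>2 * D powr (2 * \<beta> - 2 * \<kappa>)) / \<epsilon>\<^sup>2) * (I\<phi> * (2 * pi))"
  have L12: "0 \<le> L1" "0 \<le> L2" using L(1) I\<phi>(2) by (auto simp: L1_def L2_def)
  show "\<exists>L\<ge>0. \<forall>x y. norm x \<le> real N \<longrightarrow> norm y \<le> real N \<longrightarrow>
    weighted_norm2 \<gamma> (\<lambda>\<xi>. s x \<xi> - s y \<xi>) \<le> ennreal (L * norm (x - y) powr (2 * \<kappa>))"
    unfolding R_def[symmetric]
  proof (intro exI[of _ "2 * (L1 + L2)"] conjI allI impI)
    show "0 \<le> 2 * (L1 + L2)" using L12 by simp
    fix x y :: "real ^ 2" assume xy: "norm x \<le> R" "norm y \<le> R"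
    let ?d = "norm (x - y)"
    have d: "?d \<le> D" using norm_triangle_ineq4[of x y] xy by (simp add: D_def)
    have "L * ?d powr (2 * \<eta>) \<le> L * (D powr (2 * \<eta> - 2 * \<kappa>) * ?d powr (2 * \<kappa>))"
      using L(1) d by (intro mult_left_mono powr_le_on_bounded) (auto simp: D_def \<kappa>_def)
    then have 1: "ennreal I\<phi> * arc_sq x y \<le> ennreal I\<phi> * ennreal (L * (D powr (2 * \<eta> - 2 * \<kappa>) * ?d powr (2 * \<kappa>)))"
      by (rule mult_left_mono[OF order_trans[OF L(2)[OF xy] ennreal_leI]]) simp
    also have "\<dots> = ennreal (L1 * ?d powr (2 * \<kappa>))"
      using L(1) I\<phi>(2) by (simp add: L1_def mult.assoc flip: ennreal_mult)
    finally have 1: "ennreal I\<phi> * arc_sq x y \<le> ennreal (L1 * ?d powr (2 * \<kappa>))" .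
    have "(h x - h y)\<^sup>2 \<le> (\<Lambda> * ?d powr \<beta>)\<^sup>2"
      using hoelder[of x y] by (metis abs_ge_zero power2_abs power_mono)
    also have "\<dots> = \<Lambda>\<^sup>2 * ?d powr (2 * \<beta>)" by (simp add: power_mult_distrib) (simp add: power2_eq_square flip: powr_add)
    also have "\<dots> \<le> \<Lambda>\<^sup>2 * (D powr (2 * \<beta> - 2 * \<kappa>) * ?d powr (2 * \<kappa>))"
      using d by (intro mult_left_mono powr_le_on_bounded) (auto simp: D_def \<kappa>_def)
    finally have "((h x - h y) / \<epsilon>)\<^sup>2 \<le> \<Lambda>\<^sup>2 * (D powr (2 * \<beta> - 2 * \<kappa>) * ?d powr (2 * \<kappa>)) / \<epsilon>\<^sup>2"
      unfolding power_divide by (intro divide_right_mono) auto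
    then have "M\<^sup>2 * ((h x - h y) / \<epsilon>)\<^sup>2 * (I\<phi> * (2 * pi)) \<le> M\<^sup>2 * (\<Lambda>\<^sup>2 * (D powr (2 * \<beta> - 2 * \<kappa>) * ?d powr (2 * \<kappa>)) / \<epsilon>\<^sup>2) * (I\<phi> * (2 * pi))"
      using I\<phi>(2) by (intro mult_right_mono mult_left_mono) auto
    also have "\<dots> = L2 * ?d powr (2 * \<kappa>)" by (simp add: L2_def)
    finally have 2: "ennreal (M\<^sup>2 * ((h x - h y) / \<epsilon>)\<^sup>2 * (I\<phi> * (2 * pi))) \<le> ennreal (L2 * ?d powr (2 * \<kappa>))" by (rule ennreal_leI)
    have "weighted_norm2 \<gamma> (\<lambda>\<xi>. s x \<xi> - s y \<xi>) \<le> ennreal 2 * (ennreal (L1 * ?d powr (2 * \<kappa>)) + ennreal (L2 * ?d powr (2 * \<kappa>)))"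
      by (rule order_trans[OF weighted_norm2_diff_le mult_left_mono[OF add_mono[OF 1 2]]]) simp
    also have "\<dots> = ennreal (2 * (L1 * ?d powr (2 * \<kappa>) + L2 * ?d powr (2 * \<kappa>)))"
      using L12 by (subst ennreal_plus[symmetric], simp, simp, subst ennreal_mult[symmetric], simp_all)
    also have "2 * (L1 * ?d powr (2 * \<kappa>) + L2 * ?d powr (2 * \<kappa>)) = 2 * (L1 + L2) * ?d powr (2 * \<kappa>)" by (simp add: algebra_simps)
    finally show "weighted_norm2 \<gamma> (\<lambda>\<xi>. s x \<xi> - s y \<xi>) \<le> ennreal (2 * (L1 + L2) * ?d powr (2 * \<kappa>))" .
  qed
qed

lemma weighted_norm2_s_finite: "weighted_norm2 \<gamma> (s x) < \<infinity>"
  by (rule le_less_trans[OF weighted_norm2_s_le]) simp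

lemma integrand_s_hermitian_L2: "integrand (s x) y \<in> hermitian_L2"
  by (rule integrand_hermitian_L2[OF _ s_even weighted_norm2_s_finite \<gamma>(1,2)]) simp

end

section \<open>Perturbation and dilation\<close>

text \<open>The fields \<open>T \<rho>\<close> are selected separately for each
  \<open>\<rho>\<close>, so almost sure convergence is sought along sequences only. If the limit
  failed, a sequence staying away from it could be chosen to decrease so fast that the bounds on the
  perturbations have summable expectations; the perturbations then vanish locally uniformly, almost
  surely, and dominated convergence contradicts the choice.\<close>

lemma (in prob_space) tendsto_perturbed_functional:
  fixes Y :: "real ^ 2 \<Rightarrow> 'a \<Rightarrow> real" and T :: "real \<Rightarrow> real ^ 2 \<Rightarrow> 'a \<Rightarrow> real"
  assumes \<Phi>: "continuous_map compact_open euclideanreal \<Phi>" and bd: "bounded (\<Phi> ` topspace compact_open)"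
    and Y: "\<And>u. Y u \<in> borel_measurable M" "\<And>\<omega>. \<omega> \<in> space M \<Longrightarrow> continuous_on UNIV (\<lambda>u. Y u \<omega>)"
    and T: "\<And>\<rho> u. 0 < \<rho> \<Longrightarrow> \<rho> \<le> 1 \<Longrightarrow> T \<rho> u \<in> borel_measurable M"
      "\<And>\<rho> \<omega>. 0 < \<rho> \<Longrightarrow> \<rho> \<le> 1 \<Longrightarrow> \<omega> \<in> space M \<Longrightarrow> continuous_on UNIV (\<lambda>u. T \<rho> u \<omega>)"
    and B: "\<And>\<rho> N. 0 < \<rho> \<Longrightarrow> \<rho> \<le> 1 \<Longrightarrow> \<exists>B \<in> borel_measurable M.
      (\<forall>\<omega>\<in>space M. \<forall>u. norm u \<le> real N \<longrightarrow> ennreal \<bar>T \<rho> u \<omega>\<bar> \<le> B \<omega>) \<and> (\<integral>\<^sup>+\<omega>. B \<omega> \<partial>M) \<le> ennreal (c N)"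
    and \<delta>: "0 < \<delta>"
  shows "((\<lambda>\<rho>. LINT \<omega>|M. \<Phi> (\<lambda>u. Y u \<omega> + \<rho> powr \<delta> * T \<rho> u \<omega>)) \<longlongrightarrow> (LINT \<omega>|M. \<Phi> (\<lambda>u. Y u \<omega>))) (at_right 0)"
proof (rule ccontr)
  let ?V = "\<lambda>\<rho> \<omega> u. Y u \<omega> + \<rho> powr \<delta> * T \<rho> u \<omega>"
  assume "\<not> ?thesis"
  then obtain e where e: "0 < e" "\<not> (\<forall>\<^sub>F \<rho> in at_right 0. dist (LINT \<omega>|M. \<Phi> (?V \<rho> \<omega>)) (LINT \<omega>|M. \<Phi> (\<lambda>u. Y u \<omega>)) < e)"
    unfolding tendsto_iff by blast
  \<comment> \<open>One index \<open>N\<close> counts the sequence and gives the radius of the ball.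
    Each compact set is inside these balls from some index on, so a single series controls all of
    them.\<close>
  have "\<exists>\<rho>. 0 < \<rho> \<and> \<rho> \<le> 1 \<and> \<rho> powr \<delta> * c N \<le> (1 / 2) ^ N \<and> \<not> dist (LINT \<omega>|M. \<Phi> (?V \<rho> \<omega>)) (LINT \<omega>|M. \<Phi> (\<lambda>u. Y u \<omega>)) < e" for N
  proof (rule ccontr)
    assume no: "\<not> ?thesis"
    have "((\<lambda>\<rho>. \<rho> powr \<delta> * c N) \<longlongrightarrow> 0 powr \<delta> * c N) (at_right 0)"
      using \<delta> by (intro tendsto_intros tendsto_powr') (auto intro: eventually_mono[OF eventually_at_right_less])
    then have "\<forall>\<^sub>F \<rho> in at_right 0. \<rho> powr \<delta> * c N < (1 / 2) ^ N" by (intro order_tendstoD(2)) auto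
    moreover have "\<forall>\<^sub>F \<rho> in at_right (0::real). 0 < \<rho> \<and> \<rho> < 1"
      using eventually_at_right[of 0 1] by (auto simp: eventually_at_right_field intro!: exI[of _ 1])
    ultimately have "\<forall>\<^sub>F \<rho> in at_right 0. dist (LINT \<omega>|M. \<Phi> (?V \<rho> \<omega>)) (LINT \<omega>|M. \<Phi> (\<lambda>u. Y u \<omega>)) < e"
      by eventually_elim (use no in fastforce)
    then show False using e(2) by simp
  qed
  then have "\<exists>\<rho>. \<forall>N. 0 < \<rho> N \<and> \<rho> N \<le> 1 \<and> \<rho> N powr \<delta> * c N \<le> (1 / 2) ^ N \<and>
      \<not> dist (LINT \<omega>|M. \<Phi> (?V (\<rho> N) \<omega>)) (LINT \<omega>|M. \<Phi> (\<lambda>u. Y u \<omega>)) < e"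
    by (intro choice allI)
  then obtain \<rho> where \<rho>: "\<And>N. 0 < \<rho> N" "\<And>N. \<rho> N \<le> 1" "\<And>N. \<rho> N powr \<delta> * c N \<le> (1 / 2) ^ N"
     "\<And>N. \<not> dist (LINT \<omega>|M. \<Phi> (?V (\<rho> N) \<omega>)) (LINT \<omega>|M. \<Phi> (\<lambda>u. Y u \<omega>)) < e"
    by blast
  have "\<exists>B. \<forall>N. B N \<in> borel_measurable M \<and>
      (\<forall>\<omega>\<in>space M. \<forall>u. norm u \<le> real N \<longrightarrow> ennreal \<bar>T (\<rho> N) u \<omega>\<bar> \<le> B N \<omega>) \<and> (\<integral>\<^sup>+\<omega>. B N \<omega> \<partial>M) \<le> ennreal (c N)"
    using B[OF \<rho>(1,2)] by (intro choice allI) blast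
  then obtain B where [measurable]: "\<And>N. B N \<in> borel_measurable M"
      and BT: "\<And>N \<omega> u. \<omega> \<in> space M \<Longrightarrow> norm u \<le> real N \<Longrightarrow> ennreal \<bar>T (\<rho> N) u \<omega>\<bar> \<le> B N \<omega>"
      and EB: "\<And>N. (\<integral>\<^sup>+\<omega>. B N \<omega> \<partial>M) \<le> ennreal (c N)"
    by blast
  define b where "b N \<omega> = ennreal (\<rho> N powr \<delta>) * B N \<omega>" for N \<omega>
  have [measurable]: "b N \<in> borel_measurable M" for N unfolding b_def[abs_def] by measurable
  have bT: "ennreal \<bar>\<rho> N powr \<delta> * T (\<rho> N) u \<omega>\<bar> \<le> b N \<omega>" if "\<omega> \<in> space M" "norm u \<le> real N" for N u \<omega>
    unfolding b_def abs_mult using BT[OF that] by (simp add: ennreal_mult mult_left_mono)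
  have "(\<integral>\<^sup>+\<omega>. (\<Sum>N. b N \<omega>) \<partial>M) = (\<Sum>N. \<integral>\<^sup>+\<omega>. b N \<omega> \<partial>M)" by (rule nn_integral_suminf) measurable
  also have "\<dots> \<le> (\<Sum>N. ennreal ((1 / 2) ^ N))"
  proof (rule suminf_le)
    fix N
    have "(\<integral>\<^sup>+\<omega>. b N \<omega> \<partial>M) \<le> ennreal (\<rho> N powr \<delta>) * ennreal (c N)"
      unfolding b_def using EB[of N] by (subst nn_integral_cmult) (auto intro: mult_left_mono)
    also have "\<dots> = ennreal (\<rho> N powr \<delta> * c N)" by (simp add: ennreal_mult')
    also have "\<dots> \<le> ennreal ((1 / 2) ^ N)" by (rule ennreal_leI[OF \<rho>(3)])
    finally show "(\<integral>\<^sup>+\<omega>. b N \<omega> \<partial>M) \<le> ennreal ((1 / 2) ^ N)" .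
  qed auto
  also have "\<dots> < \<infinity>" by (subst suminf_ennreal2) (auto intro: summable_geometric)
  finally have "AE \<omega> in M. (\<Sum>N. b N \<omega>) \<noteq> \<infinity>"
    by (intro nn_integral_noteq_infinite) (auto simp: less_top)
  then have conv: "AE \<omega> in M. (\<lambda>N. \<Phi> (?V (\<rho> N) \<omega>)) \<longlonglongrightarrow> \<Phi> (\<lambda>u. Y u \<omega>)"
    using AE_space
  proof eventually_elim
    case (elim \<omega>)
    have fin: "b N \<omega> < top" for N
    proof -
      have "b N \<omega> \<le> (\<Sum>N. b N \<omega>)" using sum_le_suminf[of "\<lambda>N. b N \<omega>" "{N}"] by simp
      then show ?thesis using elim(1) by (auto simp: less_top[symmetric] top_unique)
    qed
    define d where "d N = enn2real (b N \<omega>)" for N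
    have bd: "b N \<omega> = ennreal (d N)" "0 \<le> d N" for N using fin[of N] by (auto simp: d_def)
    have "summable d" using elim(1) bd by (intro summable_suminf_not_top) auto
    then have d0: "d \<longlonglongrightarrow> 0" by (rule summable_LIMSEQ_zero)
    show ?case
    proof (rule tendsto_compact_open_functional[OF \<Phi> Y(2)[OF elim(2)]])
      show "\<forall>\<^sub>F N in sequentially. continuous_on UNIV (?V (\<rho> N) \<omega>)"
        using \<rho>(1,2) elim(2) by (intro always_eventually allI continuous_intros Y(2) T(2)) auto
      fix K :: "(real ^ 2) set" assume K: "compact K"
      obtain R where R: "\<And>u. u \<in> K \<Longrightarrow> norm u \<le> R" using compact_imp_bounded[OF K] by (auto simp: bounded_iff)
      obtain N0 :: nat where N0: "R \<le> real N0" using real_arch_simple by blast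
      show "uniform_limit K (\<lambda>N. ?V (\<rho> N) \<omega>) (\<lambda>u. Y u \<omega>) sequentially"
      proof (rule uniform_limitI)
        fix e' :: real assume e': "0 < e'"
        have "\<forall>\<^sub>F N in sequentially. d N < e'" using d0 e' by (intro order_tendstoD(2)) auto
        then show "\<forall>\<^sub>F N in sequentially. \<forall>u\<in>K. dist (?V (\<rho> N) \<omega> u) (Y u \<omega>) < e'"
          using eventually_ge_at_top[of N0]
        proof eventually_elim
          case (elim N)
          show ?case
          proof
            fix u assume "u \<in> K"
            then have "norm u \<le> real N" using R[of u] N0 elim(2) by (meson of_nat_mono order_trans)
            then have "\<bar>\<rho> N powr \<delta> * T (\<rho> N) u \<omega>\<bar> \<le> d N"
              using bT[OF \<open>\<omega> \<in> space M\<close>] bd by (metis ennreal_le_iff)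
            then show "dist (?V (\<rho> N) \<omega> u) (Y u \<omega>) < e'" using elim(1) by (simp add: dist_real_def)
          qed
        qed
      qed
    qed
  qed
  obtain b where b: "\<And>f. continuous_on UNIV f \<Longrightarrow> norm (\<Phi> f) \<le> b"
    using bd by (auto simp: bounded_iff topspace_compact_open)
  have cV: "continuous_on UNIV (?V (\<rho> N) \<omega>)" if "\<omega> \<in> space M" for N \<omega>
    using \<rho>(1,2) that by (intro continuous_intros Y(2) T(2)) auto
  have "(\<lambda>N. LINT \<omega>|M. \<Phi> (?V (\<rho> N) \<omega>)) \<longlonglongrightarrow> (LINT \<omega>|M. \<Phi> (\<lambda>u. Y u \<omega>))"
  proof (rule integral_dominated_convergence[where w="\<lambda>_. b"])
    show "(\<lambda>\<omega>. \<Phi> (\<lambda>u. Y u \<omega>)) \<in> borel_measurable M" by (rule measurable_path_functional[OF \<Phi> Y])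
    show "(\<lambda>\<omega>. \<Phi> (?V (\<rho> N) \<omega>)) \<in> borel_measurable M" for N
      by (rule measurable_path_functional[OF \<Phi>])
        (use \<rho>(1,2) Y(1) T(1) cV in \<open>auto intro!: borel_measurable_add borel_measurable_times\<close>)
    show "AE \<omega> in M. norm (\<Phi> (?V (\<rho> N) \<omega>)) \<le> b" for N by (rule AE_I2, rule b, rule cV)
  qed (use conv in auto)
  then have "\<forall>\<^sub>F N in sequentially. dist (LINT \<omega>|M. \<Phi> (?V (\<rho> N) \<omega>)) (LINT \<omega>|M. \<Phi> (\<lambda>u. Y u \<omega>)) < e"
    using e(1) by (rule tendstoD)
  then show False using \<rho>(4) by (simp add: eventually_sequentially)
qed

text \<open>A unitary map of the Hermitian functions: the modulation turns the spectral side of an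
  increment based at \<open>z\<close> into one based at the origin, and the dilation undoes the zoom by \<open>\<rho>\<close>.\<close>

definition modulate :: "real \<Rightarrow> real ^ 2 \<Rightarrow> (real ^ 2 \<Rightarrow> complex) \<Rightarrow> real ^ 2 \<Rightarrow> complex" where
  "modulate \<rho> z f = (\<lambda>\<xi>. exp (- (\<i> * of_real (z \<bullet> (\<xi> /\<^sub>R \<rho>)))) / of_real \<rho> * f (\<xi> /\<^sub>R \<rho>))"

lemma lborel_dilate:
  assumes "0 < \<rho>"
  shows "(lborel :: (real ^ 2) measure) = density (distr lborel borel (\<lambda>\<xi>. \<xi> /\<^sub>R \<rho>)) (\<lambda>_. ennreal (1 / \<rho>\<^sup>2))"
  using lborel_affine[of "inverse \<rho>" "0 :: real ^ 2"] assms by (simp add: power_divide inverse_eq_divide)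

lemma nn_integral_dilate:
  assumes \<rho>: "0 < \<rho>" and [measurable]: "F \<in> borel_measurable borel"
  shows "(\<integral>\<^sup>+\<xi>. ennreal (1 / \<rho>\<^sup>2) * F (\<xi> /\<^sub>R \<rho>) \<partial>lborel) = (\<integral>\<^sup>+\<xi>. F \<xi> \<partial>(lborel :: (real ^ 2) measure))"
proof -
  have "(\<integral>\<^sup>+\<xi>. F \<xi> \<partial>(lborel :: (real ^ 2) measure)) = (\<integral>\<^sup>+\<xi>. F \<xi> \<partial>density (distr lborel borel (\<lambda>\<xi>. \<xi> /\<^sub>R \<rho>)) (\<lambda>_. ennreal (1 / \<rho>\<^sup>2)))"
    using lborel_dilate[OF \<rho>] by simp
  then show ?thesis by (simp add: nn_integral_density nn_integral_distr)
qed

lemma integral_dilate: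
  fixes F :: "real ^ 2 \<Rightarrow> complex"
  assumes \<rho>: "0 < \<rho>" and [measurable]: "F \<in> borel_measurable borel"
  shows "(LINT \<xi>|lborel. of_real (1 / \<rho>\<^sup>2) * F (\<xi> /\<^sub>R \<rho>)) = (LINT \<xi>|lborel. F \<xi>)"
proof -
  have "(LINT \<xi>|lborel. F \<xi>) = (LINT \<xi>|density (distr lborel borel (\<lambda>\<xi>. \<xi> /\<^sub>R \<rho>)) (\<lambda>_. ennreal (1 / \<rho>\<^sup>2)). F \<xi>)"
    using lborel_dilate[OF \<rho>] by simp
  also have "\<dots> = (LINT \<xi>|distr lborel borel (\<lambda>\<xi>. \<xi> /\<^sub>R \<rho>). (1 / \<rho>\<^sup>2) *\<^sub>R F \<xi>)"
    by (rule integral_density) auto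
  also have "\<dots> = (LINT \<xi>|lborel. (1 / \<rho>\<^sup>2) *\<^sub>R F (\<xi> /\<^sub>R \<rho>))"
    by (rule integral_distr) auto
  finally show ?thesis by (simp add: scaleR_conv_of_real)
qed

lemma borel_measurable_modulate:
  assumes [measurable]: "f \<in> borel_measurable borel"
  shows "modulate \<rho> z f \<in> borel_measurable borel"
  unfolding modulate_def by measurable

lemma integral_modulate:
  assumes \<rho>: "0 < \<rho>" and [measurable]: "f \<in> borel_measurable borel" "g \<in> borel_measurable borel"
  shows "(LINT \<xi>|lborel. modulate \<rho> z f \<xi> * cnj (modulate \<rho> z g \<xi>)) = (LINT \<xi>|lborel. f \<xi> * cnj (g \<xi>))"
proof -
  have "modulate \<rho> z f \<xi> * cnj (modulate \<rho> z g \<xi>) = of_real (1 / \<rho>\<^sup>2) * (f (\<xi> /\<^sub>R \<rho>) * cnj (g (\<xi> /\<^sub>R \<rho>)))" for \<xi>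
  proof -
    let ?E = "exp (- (\<i> * of_real (z \<bullet> (\<xi> /\<^sub>R \<rho>))))"
    have "cnj ?E = exp (\<i> * of_real (z \<bullet> (\<xi> /\<^sub>R \<rho>)))" by (simp add: exp_cnj)
    then have "?E * cnj ?E = 1" by (metis exp_minus_inverse mult.commute)
    then show ?thesis unfolding modulate_def by (simp add: power2_eq_square field_simps)
  qed
  then show ?thesis using integral_dilate[OF \<rho>, of "\<lambda>\<xi>. f \<xi> * cnj (g \<xi>)"] by simp
qed

lemma nn_integral_modulate_diff:
  assumes \<rho>: "0 < \<rho>" and [measurable]: "f \<in> borel_measurable borel" "g \<in> borel_measurable borel"
  shows "sq_norm (\<lambda>\<xi>. modulate \<rho> z f \<xi> - modulate \<rho> z g \<xi>) = sq_norm (\<lambda>\<xi>. f \<xi> - g \<xi>)"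
proof -
  have "ennreal ((cmod (modulate \<rho> z f \<xi> - modulate \<rho> z g \<xi>))\<^sup>2) = ennreal (1 / \<rho>\<^sup>2) * ennreal ((cmod (f (\<xi> /\<^sub>R \<rho>) - g (\<xi> /\<^sub>R \<rho>)))\<^sup>2)" for \<xi>
  proof -
    have "modulate \<rho> z f \<xi> - modulate \<rho> z g \<xi> = exp (- (\<i> * of_real (z \<bullet> (\<xi> /\<^sub>R \<rho>)))) / of_real \<rho> * (f (\<xi> /\<^sub>R \<rho>) - g (\<xi> /\<^sub>R \<rho>))"
      unfolding modulate_def by (simp add: algebra_simps diff_divide_distrib)
    also have "cmod \<dots> = 1 / \<rho> * cmod (f (\<xi> /\<^sub>R \<rho>) - g (\<xi> /\<^sub>R \<rho>))"
      using \<rho> by (simp add: norm_mult norm_divide)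
    finally show ?thesis by (simp add: power_mult_distrib power_divide flip: ennreal_mult)
  qed
  then show ?thesis using nn_integral_dilate[OF \<rho>, of "\<lambda>\<xi>. ennreal ((cmod (f \<xi> - g \<xi>))\<^sup>2)"] by simp
qed

lemma modulate_hermitian_L2:
  assumes \<rho>: "0 < \<rho>" and f: "f \<in> hermitian_L2"
  shows "modulate \<rho> z f \<in> hermitian_L2"
proof -
  note [measurable] = hermitian_L2_D(1)[OF f] borel_measurable_modulate[OF hermitian_L2_D(1)[OF f]]
  have "sq_norm (modulate \<rho> z f) = sq_norm f"
    using nn_integral_modulate_diff[OF \<rho>, of f "\<lambda>_. 0"] by (simp add: modulate_def)
  also have "\<dots> < \<infinity>" using hermitian_L2_D(2)[OF f] by (simp add: integrable_iff_bounded)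
  finally have "integrable lborel (\<lambda>\<xi>. (cmod (modulate \<rho> z f \<xi>))\<^sup>2)" by (intro integrableI_nonneg) auto
  moreover have "modulate \<rho> z f (- \<xi>) = cnj (modulate \<rho> z f \<xi>)" for \<xi>
    unfolding modulate_def using hermitian_L2_D(3)[OF f, of "\<xi> /\<^sub>R \<rho>"] by (simp add: exp_cnj)
  ultimately show ?thesis by (simp add: hermitian_L2_def)
qed

section \<open>Continuous modifications of white noise integrals\<close>

context fourier_white_noise
begin

lemma zero_hermitian_L2: "(\<lambda>_. 0) \<in> hermitian_L2"
  by (simp add: hermitian_L2_def)

lemma W_zero: "AE \<omega> in P. W (\<lambda>_. 0) \<omega> = 0"
  using W_lincomb2(2)[OF zero_hermitian_L2 zero_hermitian_L2, of 0 0] by simp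

abbreviation sq_modulus :: "(nat \<Rightarrow> real) \<Rightarrow> real \<Rightarrow> (real ^ 2 \<Rightarrow> real ^ 2 \<Rightarrow> complex) \<Rightarrow> bool" where
  "sq_modulus c g G \<equiv> (\<forall>N u v. norm u \<le> real N \<longrightarrow> norm v \<le> real N \<longrightarrow>
    sq_norm (\<lambda>\<xi>. G u \<xi> - G v \<xi>) \<le> ennreal (c N * norm (u - v) powr (2 * g)))"

text \<open>The moment of order \<open>2 * p\<close> of a Gaussian increment is a constant times the
  p-th power of its variance, so a variance of order \<open>norm (u - v) powr (2 * g)\<close> gives
  the exponent \<open>2 * g * p\<close>. Any \<open>p\<close> above \<open>1 / g\<close> lifts it
  over the dimension 2. The constants \<open>c'\<close> precede the family \<open>G\<close>, which
  makes them usable uniformly in a parameter.\<close>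

lemma W_continuous_modification:
  assumes g: "0 < g" and c: "\<forall>N. 0 \<le> c N"
  shows "\<exists>c'. \<forall>G. (\<forall>u. G u \<in> hermitian_L2) \<longrightarrow> G 0 = (\<lambda>_. 0) \<longrightarrow> sq_modulus c g G \<longrightarrow>
    (\<exists>Z'. dominated_modification P (\<lambda>u. W (G u)) Z' c')"
proof -
  obtain p :: nat where p: "1 / g < real p" using reals_Archimedean2 by blast
  then have p0: "0 < p" using g by (metis divide_pos_pos gr0I less_asym of_nat_0 zero_less_one)
  define \<tau> where "\<tau> = 2 * g * real p - 2"
  have \<tau>: "0 < \<tau>" using p g by (simp add: \<tau>_def pos_divide_less_eq mult.commute)
  define F :: real where "F = fact (2 * p) / (2 ^ p * fact p)"
  have F: "0 \<le> F" by (simp add: F_def)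
  have "1 \<le> 2 * p" "\<And>N. 0 \<le> F * c N ^ p" using p0 F c by auto
  from kolmogorov_continuity[where K="\<lambda>N. F * c N ^ p", OF this(1) \<tau> this(2)] obtain c' where
    c': "\<And>Z. \<forall>u. Z u \<in> borel_measurable P \<Longrightarrow> AE \<omega> in P. Z 0 \<omega> = 0 \<Longrightarrow>
      moment_modulus P (2 * p) (\<lambda>N. F * c N ^ p) \<tau> Z \<Longrightarrow> \<exists>Z'. dominated_modification P Z Z' c'"
    by blast
  show ?thesis
  proof (rule exI[of _ c'], intro allI impI, rule c')
    fix G assume G: "\<forall>u. G u \<in> hermitian_L2" and G0: "G 0 = (\<lambda>_. 0)" and inc: "sq_modulus c g G"
    show "\<forall>u. W (G u) \<in> borel_measurable P" using G measurable_W by blast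
    show "AE \<omega> in P. W (G 0) \<omega> = 0" unfolding G0 by (rule W_zero)
    show "moment_modulus P (2 * p) (\<lambda>N. F * c N ^ p) \<tau> (\<lambda>u. W (G u))"
    proof (intro allI impI)
      fix N and u v :: "real ^ 2" assume uv: "norm u \<le> real N" "norm v \<le> real N"
      have Gu: "G u \<in> hermitian_L2" and Gv: "G v \<in> hermitian_L2" using G by auto
      note [measurable] = hermitian_L2_D(1)[OF Gu] hermitian_L2_D(1)[OF Gv]
      let ?I = "LINT \<xi>|lborel. (cmod (G u \<xi> - G v \<xi>))\<^sup>2"
      have "?I = enn2real (sq_norm (\<lambda>\<xi>. G u \<xi> - G v \<xi>))"
        by (rule integral_eq_nn_integral) auto
      also have "\<dots> \<le> c N * norm (u - v) powr (2 * g)"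
        using inc[rule_format, OF uv] c by (intro enn2real_leI) auto
      finally have "?I ^ p \<le> (c N * norm (u - v) powr (2 * g)) ^ p" by (intro power_mono integral_nonneg_AE) auto
      also have "\<dots> = c N ^ p * (norm (u - v) powr (2 * g)) ^ p" by (rule power_mult_distrib)
      also have "(norm (u - v) powr (2 * g)) ^ p = norm (u - v) powr (2 + \<tau>)"
      proof (cases "u = v")
        case False
        then have "(norm (u - v) powr (2 * g)) ^ p = (norm (u - v) powr (2 * g)) powr real p" by (simp add: powr_realpow)
        also have "\<dots> = norm (u - v) powr (2 + \<tau>)" unfolding powr_powr \<tau>_def by simp
        finally show ?thesis .
      qed (use p0 in simp)
      finally have "F * ?I ^ p \<le> F * (c N ^ p * norm (u - v) powr (2 + \<tau>))" using F by (rule mult_left_mono)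
      then show "(\<integral>\<^sup>+\<omega>. ennreal (\<bar>W (G u) \<omega> - W (G v) \<omega>\<bar> ^ (2 * p)) \<partial>P) \<le> ennreal (F * c N ^ p * norm (u - v) powr (2 + \<tau>))"
        unfolding moment_W_diff[OF Gu Gv] F_def by (simp add: ennreal_leI mult.assoc)
    qed
  qed
qed

end

section \<open>The tangent field\<close>

lemma weighted_norm2_0: "weighted_norm2 g (\<lambda>_. 0) = 0"
  by (simp add: weighted_norm2_def)

lemma integrand_0: "integrand s 0 = (\<lambda>_. 0)" "integrand (\<lambda>_. 0) x = (\<lambda>_. 0)"
  by (simp_all add: integrand_def)

locale gafbf_field = fourier_white_noise P W + gafbf_spectrum h C a b \<beta> \<Lambda> M \<eta> A
  for P :: "'w measure" and W h C a b \<beta> \<Lambda> M \<eta> A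
begin

lemma s_dilate:
  assumes "0 < \<rho>"
  shows "s x (\<xi> /\<^sub>R \<rho>) = \<rho> powr (h x + 1) * s x \<xi>"
proof -
  have "norm (\<xi> /\<^sub>R \<rho>) powr (- (h x + 1)) = (norm \<xi> / \<rho>) powr (- (h x + 1))"
    using assms by (simp add: divide_inverse mult.commute)
  also have "\<dots> = norm \<xi> powr (- (h x + 1)) * \<rho> powr (h x + 1)"
    unfolding powr_divide powr_minus[of \<rho>] by (simp add: divide_inverse)
  finally show ?thesis unfolding s_eq using assms by (simp add: C_homogeneous)
qed

lemma weighted_norm2_diff_finite: "weighted_norm2 \<gamma> (\<lambda>\<xi>. s x \<xi> - s y \<xi>) < \<infinity>"
proof -
  obtain N :: nat where "max (norm x) (norm y) \<le> real N" using real_arch_simple by blast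
  then obtain L where "weighted_norm2 \<gamma> (\<lambda>\<xi>. s x \<xi> - s y \<xi>) \<le> ennreal L"
    using weighted_norm2_increment_le by (meson max.boundedE)
  then show ?thesis by (rule le_less_trans) simp
qed

lemma integrand_s_diff_hermitian_L2: "integrand (\<lambda>\<xi>. s x \<xi> - s y \<xi>) z \<in> hermitian_L2"
  by (rule integrand_hermitian_L2[OF _ _ weighted_norm2_diff_finite \<gamma>(1,2)]) (auto simp: s_even)

lemma integrand_increment_le:
  assumes uv: "norm u \<le> R" "norm v \<le> R" and D: "D = max 1 (2 * R)"
  shows "sq_norm (\<lambda>\<xi>. integrand (s x) u \<xi> - integrand (s y) v \<xi>) \<le>
    ennreal (8 * D\<^sup>2) * (ennreal (norm (u - v) powr (2 * \<gamma>) * (M\<^sup>2 * (I\<phi> * (2 * pi)))) + weighted_norm2 \<gamma> (\<lambda>\<xi>. s x \<xi> - s y \<xi>))"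
proof -
  have D: "1 \<le> D" "norm v \<le> D" "norm (u - v) \<le> D"
    using uv norm_triangle_ineq4[of u v] norm_ge_zero[of v] by (auto simp: D)
  have "sq_norm (\<lambda>\<xi>. integrand (s x) u \<xi> - integrand (s y) v \<xi>) \<le>
      ennreal (8 * D\<^sup>2) * (ennreal (norm (u - v) powr (2 * \<gamma>)) * weighted_norm2 \<gamma> (s x) + weighted_norm2 \<gamma> (\<lambda>\<xi>. s x \<xi> - s y \<xi>))"
    by (rule nn_integral_integrand_diff_le[OF _ _ D \<gamma>(1,2)]) auto
  also have "\<dots> \<le> ennreal (8 * D\<^sup>2) * (ennreal (norm (u - v) powr (2 * \<gamma>)) * ennreal (M\<^sup>2 * (I\<phi> * (2 * pi))) + weighted_norm2 \<gamma> (\<lambda>\<xi>. s x \<xi> - s y \<xi>))"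
    by (intro mult_left_mono add_mono weighted_norm2_s_le order_refl) auto
  finally show ?thesis by (simp add: ennreal_mult')
qed

lemma tangent_modulus: "\<exists>c. (\<forall>N. 0 \<le> c N) \<and> sq_modulus c \<gamma> (integrand (s x))"
proof (intro exI[of _ "\<lambda>N. 8 * (max 1 (2 * real N))\<^sup>2 * (M\<^sup>2 * (I\<phi> * (2 * pi)))"] conjI allI impI)
  fix N and u v :: "real ^ 2" assume uv: "norm u \<le> real N" "norm v \<le> real N"
  show "sq_norm (\<lambda>\<xi>. integrand (s x) u \<xi> - integrand (s x) v \<xi>) \<le> ennreal (8 * (max 1 (2 * real N))\<^sup>2 * (M\<^sup>2 * (I\<phi> * (2 * pi))) * norm (u - v) powr (2 * \<gamma>))"
    using integrand_increment_le[OF uv refl, of x x] I\<phi>(2) by (simp add: weighted_norm2_0 mult_ac flip: ennreal_mult)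
qed (use I\<phi>(2) in simp)

text \<open>Both the argument and the density move here. Since \<open>\<gamma> < \<kappa>\<close>,
  the change of density is locally dominated by the same power as the increment with frozen
  density.\<close>

lemma field_modulus: "\<exists>c. (\<forall>N. 0 \<le> c N) \<and> sq_modulus c \<gamma> (\<lambda>u. integrand (s u) u)"
proof -
  obtain L where L: "\<And>N. 0 \<le> L N" "\<And>N x y. norm x \<le> real N \<Longrightarrow> norm y \<le> real N \<Longrightarrow>
      weighted_norm2 \<gamma> (\<lambda>\<xi>. s x \<xi> - s y \<xi>) \<le> ennreal (L N * norm (x - y) powr (2 * \<kappa>))"
    using weighted_norm2_increment_le by blast
  define D where "D N = max 1 (2 * real N)" for N
  define Q where "Q = M\<^sup>2 * (I\<phi> * (2 * pi))"
  define E where "E N = D N powr (2 * \<kappa> - 2 * \<gamma>)" for N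
  have QE: "0 \<le> Q" "0 \<le> E N" for N using I\<phi>(2) by (auto simp: Q_def E_def)
  show ?thesis
  proof (intro exI[of _ "\<lambda>N. 8 * (D N)\<^sup>2 * (Q + L N * E N)"] conjI allI impI)
    show "0 \<le> 8 * (D N)\<^sup>2 * (Q + L N * E N)" for N using QE L(1) by simp
    fix N and u v :: "real ^ 2" assume uv: "norm u \<le> real N" "norm v \<le> real N"
    let ?d = "norm (u - v)"
    have d: "?d \<le> D N" using uv norm_triangle_ineq4[of u v] by (simp add: D_def)
    have "L N * ?d powr (2 * \<kappa>) \<le> L N * (E N * ?d powr (2 * \<gamma>))"
      unfolding E_def using L(1) d \<gamma>(3) by (intro mult_left_mono powr_le_on_bounded) (auto simp: D_def)
    then have w: "weighted_norm2 \<gamma> (\<lambda>\<xi>. s u \<xi> - s v \<xi>) \<le> ennreal (L N * (E N * ?d powr (2 * \<gamma>)))"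
      by (rule order_trans[OF L(2)[OF uv] ennreal_leI])
    have "sq_norm (\<lambda>\<xi>. integrand (s u) u \<xi> - integrand (s v) v \<xi>) \<le>
        ennreal (8 * (D N)\<^sup>2) * (ennreal (?d powr (2 * \<gamma>) * Q) + ennreal (L N * (E N * ?d powr (2 * \<gamma>))))"
      by (rule order_trans[OF integrand_increment_le[OF uv D_def, folded Q_def] mult_left_mono[OF add_left_mono[OF w]]]) simp
    also have "\<dots> = ennreal (8 * (D N)\<^sup>2 * (?d powr (2 * \<gamma>) * Q + L N * (E N * ?d powr (2 * \<gamma>))))"
      using QE L(1) by (simp flip: ennreal_mult ennreal_plus)
    finally show "sq_norm (\<lambda>\<xi>. integrand (s u) u \<xi> - integrand (s v) v \<xi>) \<le> ennreal (8 * (D N)\<^sup>2 * (Q + L N * E N) * ?d powr (2 * \<gamma>))"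
      by (simp add: algebra_simps)
  qed
qed

text \<open>The normalisation by \<open>\<rho> powr - \<kappa>\<close> makes the modulus of
  continuity uniform in \<open>\<rho>\<close>; the actual perturbation of the tangent field is
  \<open>\<rho> powr (\<kappa> - h z)\<close> times this function.\<close>

definition remainder :: "real ^ 2 \<Rightarrow> real \<Rightarrow> real ^ 2 \<Rightarrow> real ^ 2 \<Rightarrow> complex" where
  "remainder z \<rho> u = (\<lambda>\<xi>. of_real (\<rho> powr - \<kappa>) * modulate \<rho> z (integrand (\<lambda>\<xi>. s (z + \<rho> *\<^sub>R u) \<xi> - s z \<xi>) (z + \<rho> *\<^sub>R u)) \<xi>)"

lemma remainder_hermitian_L2:
  assumes "0 < \<rho>"
  shows "remainder z \<rho> u \<in> hermitian_L2"
  using W_lincomb2(1)[OF modulate_hermitian_L2[OF assms integrand_s_diff_hermitian_L2] zero_hermitian_L2, of "\<rho> powr - \<kappa>" z "z + \<rho> *\<^sub>R u" z "z + \<rho> *\<^sub>R u" 0]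
  by (simp add: remainder_def)

lemma remainder_0: "remainder z \<rho> 0 = (\<lambda>_. 0)"
  by (simp add: remainder_def modulate_def integrand_0)

text \<open>An increment in \<open>u\<close> splits into a translation under the density difference
  between \<open>z + \<rho> *\<^sub>R u\<close> and \<open>z\<close>, and a density difference
  between \<open>z + \<rho> *\<^sub>R u\<close> and \<open>z + \<rho> *\<^sub>R v\<close>. Each
  contributes the factor \<open>\<rho> powr (2 * \<kappa>)\<close>, which the normalisation
  cancels.\<close>

lemma remainder_modulus:
  "\<exists>c. (\<forall>N. 0 \<le> c N) \<and> (\<forall>\<rho>. 0 < \<rho> \<longrightarrow> \<rho> \<le> 1 \<longrightarrow> sq_modulus c \<gamma> (remainder z \<rho>))"
proof -
  obtain n :: nat where n: "norm z \<le> real n" using real_arch_simple by blast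
  \<comment> \<open>For \<open>\<rho> \<le> 1\<close> the points
    \<open>z + \<rho> *\<^sub>R u\<close> stay in this ball, so the constant of the density
    increments does not depend on \<open>\<rho>\<close>.\<close>
  define R where "R N = real (n + N)" for N
  obtain L' where L': "\<And>N. 0 \<le> L' N" "\<And>N x y. norm x \<le> real N \<Longrightarrow> norm y \<le> real N \<Longrightarrow>
      weighted_norm2 \<gamma> (\<lambda>\<xi>. s x \<xi> - s y \<xi>) \<le> ennreal (L' N * norm (x - y) powr (2 * \<kappa>))"
    using weighted_norm2_increment_le by blast
  define D' where "D' N = max 1 (2 * R N)" for N
  define c where "c N = 8 * (D' N)\<^sup>2 * L' (n + N) * (D' N powr (2 * \<kappa>) + D' N powr (2 * \<kappa> - 2 * \<gamma>))" for N
  show ?thesis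
  proof (intro exI[of _ c] conjI allI impI)
    show "0 \<le> c N" for N using L'(1) by (simp add: c_def)
    fix \<rho> :: real and N and u v :: "real ^ 2"
    assume \<rho>: "0 < \<rho>" "\<rho> \<le> 1" and uv: "norm u \<le> real N" "norm v \<le> real N"
    define D L E where "D = D' N" and "L = L' (n + N)" and "E = D powr (2 * \<kappa>) + D powr (2 * \<kappa> - 2 * \<gamma>)"
    note L = L'(1)[of "n + N", folded L_def] L'(2)[of _ "n + N", folded L_def R_def]
    have E: "0 \<le> E" by (simp add: E_def)
    have c: "c N = 8 * D\<^sup>2 * L * E" by (simp add: c_def D_def L_def E_def)
    let ?d = "norm (u - v)"
    let ?x = "z + \<rho> *\<^sub>R u" and ?y = "z + \<rho> *\<^sub>R v"
    have sm: "norm (\<rho> *\<^sub>R w) \<le> norm w" for w :: "real ^ 2" using \<rho> by (simp add: mult_left_le_one_le)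
    have D1: "1 \<le> D" "2 * R N \<le> D" by (auto simp: D_def D'_def)
    have RN: "R N = real n + real N" by (simp add: R_def)
    have nx: "norm ?x \<le> R N" "norm ?y \<le> R N" "norm z \<le> R N"
      using norm_triangle_ineq[of z "\<rho> *\<^sub>R u"] norm_triangle_ineq[of z "\<rho> *\<^sub>R v"] sm[of u] sm[of v] uv n unfolding RN by linarith+
    have dd: "?d \<le> D" and uD: "norm u \<le> D" using norm_triangle_ineq4[of u v] uv D1 RN by linarith+
    have xy: "?x - ?y = \<rho> *\<^sub>R (u - v)" by (simp add: algebra_simps)
    have D: "norm ?y \<le> D" "norm (?x - ?y) \<le> D"
      unfolding xy using nx D1 sm[of "u - v"] dd norm_ge_zero[of ?y] by linarith+
    have split: "(norm (\<rho> *\<^sub>R w)) powr t = \<rho> powr t * norm w powr t" for w :: "real ^ 2" and t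
      using \<rho> by (simp add: powr_mult)
    have w1: "weighted_norm2 \<gamma> (\<lambda>\<xi>. s ?x \<xi> - s z \<xi>) \<le> ennreal (L * (\<rho> powr (2 * \<kappa>) * D powr (2 * \<kappa>)))"
    proof (rule order_trans[OF L(2)[OF nx(1,3)] ennreal_leI])
      have "norm (?x - z) powr (2 * \<kappa>) = \<rho> powr (2 * \<kappa>) * norm u powr (2 * \<kappa>)" by (simp only: add_diff_cancel_left' split)
      also have "\<dots> \<le> \<rho> powr (2 * \<kappa>) * D powr (2 * \<kappa>)"
        using uD \<gamma> by (intro mult_left_mono powr_mono2) auto
      finally show "L * norm (?x - z) powr (2 * \<kappa>) \<le> L * (\<rho> powr (2 * \<kappa>) * D powr (2 * \<kappa>))" using L(1) by (rule mult_left_mono)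
    qed
    have w2: "weighted_norm2 \<gamma> (\<lambda>\<xi>. s ?x \<xi> - s ?y \<xi>) \<le> ennreal (L * (\<rho> powr (2 * \<kappa>) * (D powr (2 * \<kappa> - 2 * \<gamma>) * ?d powr (2 * \<gamma>))))"
    proof (rule order_trans[OF L(2)[OF nx(1,2)] ennreal_leI])
      have "norm (?x - ?y) powr (2 * \<kappa>) = \<rho> powr (2 * \<kappa>) * ?d powr (2 * \<kappa>)" by (simp only: xy split)
      also have "\<dots> \<le> \<rho> powr (2 * \<kappa>) * (D powr (2 * \<kappa> - 2 * \<gamma>) * ?d powr (2 * \<gamma>))"
        using D1 dd \<gamma>(3) by (intro mult_left_mono powr_le_on_bounded) auto
      finally show "L * norm (?x - ?y) powr (2 * \<kappa>) \<le> L * (\<rho> powr (2 * \<kappa>) * (D powr (2 * \<kappa> - 2 * \<gamma>) * ?d powr (2 * \<gamma>)))"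
        using L(1) by (rule mult_left_mono)
    qed
    have pd: "norm (?x - ?y) powr (2 * \<gamma>) \<le> ?d powr (2 * \<gamma>)"
      unfolding xy using sm[of "u - v"] \<gamma>(1) by (intro powr_mono2) auto
    let ?Kx = "integrand (\<lambda>\<xi>. s ?x \<xi> - s z \<xi>) ?x" and ?Ky = "integrand (\<lambda>\<xi>. s ?y \<xi> - s z \<xi>) ?y"
    have [measurable]: "?Kx \<in> borel_measurable borel" "?Ky \<in> borel_measurable borel"
      "modulate \<rho> z ?Kx \<in> borel_measurable borel" "modulate \<rho> z ?Ky \<in> borel_measurable borel"
      by (intro borel_measurable_modulate borel_measurable_integrand; measurable)+
    have "sq_norm (\<lambda>\<xi>. ?Kx \<xi> - ?Ky \<xi>) \<le>
        ennreal (8 * D\<^sup>2) * (ennreal (norm (?x - ?y) powr (2 * \<gamma>)) * weighted_norm2 \<gamma> (\<lambda>\<xi>. s ?x \<xi> - s z \<xi>)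
          + weighted_norm2 \<gamma> (\<lambda>\<xi>. s ?x \<xi> - s z \<xi> - (s ?y \<xi> - s z \<xi>)))"
      by (rule nn_integral_integrand_diff_le[OF _ _ D1(1) D \<gamma>(1,2)]) auto
    also have "(\<lambda>\<xi>. s ?x \<xi> - s z \<xi> - (s ?y \<xi> - s z \<xi>)) = (\<lambda>\<xi>. s ?x \<xi> - s ?y \<xi>)" by auto
    also have "ennreal (8 * D\<^sup>2) * (ennreal (norm (?x - ?y) powr (2 * \<gamma>)) * weighted_norm2 \<gamma> (\<lambda>\<xi>. s ?x \<xi> - s z \<xi>)
          + weighted_norm2 \<gamma> (\<lambda>\<xi>. s ?x \<xi> - s ?y \<xi>)) \<le>
       ennreal (8 * D\<^sup>2) * (ennreal (?d powr (2 * \<gamma>)) * ennreal (L * (\<rho> powr (2 * \<kappa>) * D powr (2 * \<kappa>)))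
          + ennreal (L * (\<rho> powr (2 * \<kappa>) * (D powr (2 * \<kappa> - 2 * \<gamma>) * ?d powr (2 * \<gamma>)))))"
      by (intro mult_left_mono add_mono mult_mono w1 w2 ennreal_leI pd) auto
    also have "\<dots> = ennreal (8 * D\<^sup>2 * (?d powr (2 * \<gamma>) * (L * (\<rho> powr (2 * \<kappa>) * D powr (2 * \<kappa>)))
          + L * (\<rho> powr (2 * \<kappa>) * (D powr (2 * \<kappa> - 2 * \<gamma>) * ?d powr (2 * \<gamma>)))))"
      using L(1) by (simp flip: ennreal_mult ennreal_plus)
    also have "8 * D\<^sup>2 * (?d powr (2 * \<gamma>) * (L * (\<rho> powr (2 * \<kappa>) * D powr (2 * \<kappa>)))
          + L * (\<rho> powr (2 * \<kappa>) * (D powr (2 * \<kappa> - 2 * \<gamma>) * ?d powr (2 * \<gamma>)))) = \<rho> powr (2 * \<kappa>) * (8 * D\<^sup>2 * L * E * ?d powr (2 * \<gamma>))"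
      by (simp add: E_def algebra_simps)
    finally have k: "sq_norm (\<lambda>\<xi>. ?Kx \<xi> - ?Ky \<xi>) \<le> ennreal (\<rho> powr (2 * \<kappa>) * (8 * D\<^sup>2 * L * E * ?d powr (2 * \<gamma>)))" .
    have "sq_norm (\<lambda>\<xi>. remainder z \<rho> u \<xi> - remainder z \<rho> v \<xi>) =
        (\<integral>\<^sup>+\<xi>. ennreal (\<rho> powr (- 2 * \<kappa>)) * ennreal ((cmod (modulate \<rho> z ?Kx \<xi> - modulate \<rho> z ?Ky \<xi>))\<^sup>2) \<partial>lborel)"
    proof (rule nn_integral_cong)
      fix \<xi>
      have "remainder z \<rho> u \<xi> - remainder z \<rho> v \<xi> = of_real (\<rho> powr - \<kappa>) * (modulate \<rho> z ?Kx \<xi> - modulate \<rho> z ?Ky \<xi>)"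
        by (simp add: remainder_def right_diff_distrib)
      then have "(cmod (remainder z \<rho> u \<xi> - remainder z \<rho> v \<xi>))\<^sup>2 = (\<rho> powr - \<kappa>)\<^sup>2 * (cmod (modulate \<rho> z ?Kx \<xi> - modulate \<rho> z ?Ky \<xi>))\<^sup>2"
        by (simp add: norm_mult power_mult_distrib)
      also have "(\<rho> powr - \<kappa>)\<^sup>2 = \<rho> powr (- 2 * \<kappa>)" by (simp add: power2_eq_square flip: powr_add)
      finally show "ennreal ((cmod (remainder z \<rho> u \<xi> - remainder z \<rho> v \<xi>))\<^sup>2) =
          ennreal (\<rho> powr (- 2 * \<kappa>)) * ennreal ((cmod (modulate \<rho> z ?Kx \<xi> - modulate \<rho> z ?Ky \<xi>))\<^sup>2)"
        by (simp add: ennreal_mult)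
    qed
    also have "\<dots> = ennreal (\<rho> powr (- 2 * \<kappa>)) * sq_norm (\<lambda>\<xi>. ?Kx \<xi> - ?Ky \<xi>)"
      by (subst nn_integral_cmult) (auto simp: nn_integral_modulate_diff[OF \<rho>(1)])
    also have "\<dots> \<le> ennreal (\<rho> powr (- 2 * \<kappa>)) * ennreal (\<rho> powr (2 * \<kappa>) * (8 * D\<^sup>2 * L * E * ?d powr (2 * \<gamma>)))"
      by (intro mult_left_mono k) auto
    also have "\<dots> = ennreal ((\<rho> powr (- 2 * \<kappa>) * \<rho> powr (2 * \<kappa>)) * (8 * D\<^sup>2 * L * E * ?d powr (2 * \<gamma>)))"
      by (simp add: mult.assoc flip: ennreal_mult')
    also have "\<rho> powr (- 2 * \<kappa>) * \<rho> powr (2 * \<kappa>) = 1" using \<rho>(1) by (simp flip: powr_add)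
    finally show "sq_norm (\<lambda>\<xi>. remainder z \<rho> u \<xi> - remainder z \<rho> v \<xi>) \<le> ennreal (c N * ?d powr (2 * \<gamma>))"
      unfolding c by simp
  qed
qed

text \<open>At the dilated frequency the exponential at \<open>z + \<rho> *\<^sub>R u\<close> is the
  product of the exponential at \<open>z\<close>, removed by the modulation, and the exponential of
  \<open>u\<close> at the original frequency. The identity \<open>p1\<close> is the balance of
  powers that makes \<open>h z\<close> the right scaling exponent.\<close>

lemma modulate_rescaled_increment:
  assumes \<rho>: "0 < \<rho>"
  shows "modulate \<rho> z (\<lambda>\<xi>. of_real (\<rho> powr - h z) * integrand (s (z + \<rho> *\<^sub>R u)) (z + \<rho> *\<^sub>R u) \<xi> + of_real (- (\<rho> powr - h z)) * integrand (s z) z \<xi>)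
    = (\<lambda>\<xi>. of_real 1 * integrand (s z) u \<xi> + of_real (\<rho> powr (\<kappa> - h z)) * remainder z \<rho> u \<xi>)"
proof
  fix \<xi> :: "real ^ 2"
  let ?x = "z + \<rho> *\<^sub>R u" and ?\<zeta> = "\<xi> /\<^sub>R \<rho>"
  define ex ez where "ex = exp (\<i> * of_real (?x \<bullet> ?\<zeta>))" and "ez = exp (\<i> * of_real (z \<bullet> ?\<zeta>))"
  define eu em where "eu = exp (\<i> * of_real (u \<bullet> \<xi>))" and "em = exp (- (\<i> * of_real (z \<bullet> ?\<zeta>)))"
  have "?x \<bullet> ?\<zeta> = z \<bullet> ?\<zeta> + u \<bullet> \<xi>" using \<rho> by (simp add: inner_add_left distrib_left)
  then have ex: "ex = ez * eu" unfolding ex_def ez_def eu_def by (simp add: distrib_left exp_add)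
  have em: "em * ez = 1" unfolding em_def ez_def by (simp flip: exp_add)
  have p1: "\<rho> powr - h z / \<rho> * \<rho> powr (h z + 1) = 1"
  proof -
    have "\<rho> powr - h z * \<rho> powr (h z + 1) = \<rho> powr 1" by (simp only: powr_add[symmetric]) simp
    then show ?thesis using \<rho> by simp
  qed
  have p2: "\<rho> powr (\<kappa> - h z) * \<rho> powr - \<kappa> = \<rho> powr - h z" by (simp only: powr_add[symmetric]) simp
  have "modulate \<rho> z (\<lambda>\<xi>. of_real (\<rho> powr - h z) * integrand (s ?x) ?x \<xi> + of_real (- (\<rho> powr - h z)) * integrand (s z) z \<xi>) \<xi>
     = of_real (\<rho> powr - h z / \<rho>) * (em * ((ex - 1) * of_real (s ?x ?\<zeta>) - (ez - 1) * of_real (s z ?\<zeta>)))"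
    by (simp only: modulate_def integrand_def ex_def ez_def em_def) (simp add: algebra_simps add_divide_distrib diff_divide_distrib)
  also have "em * ((ex - 1) * of_real (s ?x ?\<zeta>) - (ez - 1) * of_real (s z ?\<zeta>))
     = (em * ez) * (eu - 1) * of_real (s z ?\<zeta>) + em * ((ex - 1) * of_real (s ?x ?\<zeta> - s z ?\<zeta>))"
    unfolding ex by (simp add: algebra_simps)
  also have "of_real (\<rho> powr - h z / \<rho>) * ((em * ez) * (eu - 1) * of_real (s z ?\<zeta>) + em * ((ex - 1) * of_real (s ?x ?\<zeta> - s z ?\<zeta>)))
     = (eu - 1) * of_real ((\<rho> powr - h z / \<rho> * \<rho> powr (h z + 1)) * s z \<xi>) + of_real (\<rho> powr (\<kappa> - h z) * \<rho> powr - \<kappa> / \<rho>) * (em * ((ex - 1) * of_real (s ?x ?\<zeta> - s z ?\<zeta>)))"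
    unfolding em s_dilate[OF \<rho>] p2 by (simp add: algebra_simps add_divide_distrib diff_divide_distrib)
  also have "\<dots> = of_real 1 * integrand (s z) u \<xi> + of_real (\<rho> powr (\<kappa> - h z)) * remainder z \<rho> u \<xi>"
    unfolding p1 by (simp add: remainder_def modulate_def integrand_def ex_def eu_def em_def)
  finally show "modulate \<rho> z (\<lambda>\<xi>. of_real (\<rho> powr - h z) * integrand (s ?x) ?x \<xi> + of_real (- (\<rho> powr - h z)) * integrand (s z) z \<xi>) \<xi>
     = of_real 1 * integrand (s z) u \<xi> + of_real (\<rho> powr (\<kappa> - h z)) * remainder z \<rho> u \<xi>" .
qed


lemma continuous_modificationD:
  assumes "continuous_modification P Z Z'"
  shows "Z' u \<in> borel_measurable P" "AE \<omega> in P. Z' u \<omega> = Z u \<omega>" "\<omega> \<in> space P \<Longrightarrow> continuous_on UNIV (\<lambda>u. Z' u \<omega>)"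
  using assms by (auto simp: continuous_modification_def)

theorem rescaled_increments_converge_gafbf:
  "rescaled_increments_converge P (gafbf W h C) z (h z) P (harmonizable W (s z))"
proof -
  have X_eq: "gafbf W h C x = W (integrand (s x) x)" for x by (simp add: gafbf_def harmonizable_integrand)
  have Y_eq: "harmonizable W (s z) = (\<lambda>u. W (integrand (s z) u))" by (simp add: harmonizable_integrand fun_eq_iff)
  obtain cX where cX: "\<forall>N. 0 \<le> cX N" "sq_modulus cX \<gamma> (\<lambda>u. integrand (s u) u)" using field_modulus by blast
  obtain X' where X': "continuous_modification P (\<lambda>u. W (integrand (s u) u)) X'"
    using W_continuous_modification[OF \<gamma>(1) cX(1)] cX(2) integrand_s_hermitian_L2 integrand_0(1) by meson
  obtain cY where cY: "\<forall>N. 0 \<le> cY N" "sq_modulus cY \<gamma> (integrand (s z))" using tangent_modulus by blast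
  obtain Y' where Y': "continuous_modification P (\<lambda>u. W (integrand (s z) u)) Y'"
    using W_continuous_modification[OF \<gamma>(1) cY(1)] cY(2) integrand_s_hermitian_L2 integrand_0(1) by meson
  obtain cT where cT: "\<forall>N. 0 \<le> cT N" "\<And>\<rho>. 0 < \<rho> \<Longrightarrow> \<rho> \<le> 1 \<Longrightarrow> sq_modulus cT \<gamma> (remainder z \<rho>)"
    using remainder_modulus by blast
  \<comment> \<open>One sequence \<open>c'\<close> serves all \<open>\<rho>\<close>, because
    \<open>cT\<close> does not depend on \<open>\<rho>\<close>; the perturbation lemma needs exactly
    this uniformity.\<close>
  obtain c' where c': "\<And>G. \<forall>u. G u \<in> hermitian_L2 \<Longrightarrow> G 0 = (\<lambda>_. 0) \<Longrightarrow> sq_modulus cT \<gamma> G \<Longrightarrow>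
    \<exists>Z'. dominated_modification P (\<lambda>u. W (G u)) Z' c'"
    using W_continuous_modification[OF \<gamma>(1) cT(1)] by blast
  have "\<exists>T. \<forall>\<rho>. 0 < \<rho> \<and> \<rho> \<le> 1 \<longrightarrow> dominated_modification P (\<lambda>u. W (remainder z \<rho> u)) (T \<rho>) c'"
  proof (rule choice, rule allI)
    fix \<rho> :: real
    show "\<exists>T. 0 < \<rho> \<and> \<rho> \<le> 1 \<longrightarrow> dominated_modification P (\<lambda>u. W (remainder z \<rho> u)) T c'"
    proof (cases "0 < \<rho> \<and> \<rho> \<le> 1")
      case True
      show ?thesis
        using c'[of "remainder z \<rho>"] remainder_hermitian_L2[of \<rho> z] remainder_0[of z \<rho>] cT(2)[of \<rho>] True by simp
    next
      case False
      then show ?thesis by blast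
    qed
  qed
  then obtain T where T: "\<And>\<rho>. 0 < \<rho> \<Longrightarrow> \<rho> \<le> 1 \<Longrightarrow> continuous_modification P (\<lambda>u. W (remainder z \<rho> u)) (T \<rho>)"
    and TB: "\<And>\<rho> N. 0 < \<rho> \<Longrightarrow> \<rho> \<le> 1 \<Longrightarrow> \<exists>B \<in> borel_measurable P.
      (\<forall>\<omega>\<in>space P. \<forall>u. norm u \<le> real N \<longrightarrow> ennreal \<bar>T \<rho> u \<omega>\<bar> \<le> B \<omega>) \<and> (\<integral>\<^sup>+\<omega>. B \<omega> \<partial>P) \<le> ennreal (c' N)"
    by blast
  note [measurable] = continuous_modificationD(1)[OF X'] continuous_modificationD(1)[OF Y'] measurable_W[OF integrand_s_hermitian_L2]
  let ?Z = "\<lambda>\<rho> u \<omega>. (X' (z + \<rho> *\<^sub>R u) \<omega> - X' z \<omega>) / \<rho> powr h z"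
  let ?V = "\<lambda>\<rho> u \<omega>. Y' u \<omega> + \<rho> powr (\<kappa> - h z) * T \<rho> u \<omega>"
  have cZ: "continuous_on UNIV (\<lambda>u. ?Z \<rho> u \<omega>)" if "\<omega> \<in> space P" for \<rho> \<omega>
  proof -
    have "continuous_on UNIV (\<lambda>u. X' (z + \<rho> *\<^sub>R u) \<omega>)"
      by (rule continuous_on_compose2[OF continuous_modificationD(3)[OF X' that]]) (auto intro!: continuous_intros)
    then have "continuous_on UNIV (\<lambda>u. (X' (z + \<rho> *\<^sub>R u) \<omega> - X' z \<omega>) * inverse (\<rho> powr h z))"
      by (intro continuous_intros)
    then show ?thesis by (simp add: divide_inverse)
  qed
  have AEZ: "AE \<omega> in P. ?Z \<rho> u \<omega> = (W (integrand (s (z + \<rho> *\<^sub>R u)) (z + \<rho> *\<^sub>R u)) \<omega> - W (integrand (s z) z) \<omega>) / \<rho> powr h z" for \<rho> u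
    using continuous_modificationD(2)[OF X', of "z + \<rho> *\<^sub>R u"] continuous_modificationD(2)[OF X', of z] by eventually_elim simp
  \<comment> \<open>The integrals of \<open>G u\<close> and of its modulated version are different
    random variables in general; only their covariances, and hence their joint laws,
    coincide.\<close>
  have law: "process_law P (?Z \<rho>) = process_law P (?V \<rho>)" if \<rho>: "0 < \<rho>" "\<rho> \<le> 1" for \<rho>
  proof -
    note [measurable] = continuous_modificationD(1)[OF T[OF \<rho>]]
    define G where "G u = (\<lambda>\<xi>. of_real (\<rho> powr - h z) * integrand (s (z + \<rho> *\<^sub>R u)) (z + \<rho> *\<^sub>R u) \<xi> + of_real (- (\<rho> powr - h z)) * integrand (s z) z \<xi>)" for u
    note GW = W_lincomb2[OF integrand_s_hermitian_L2 integrand_s_hermitian_L2, of "\<rho> powr - h z" "z + \<rho> *\<^sub>R u" "z + \<rho> *\<^sub>R u" "- (\<rho> powr - h z)" z z for u, folded G_def]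
    note MW = W_lincomb2[OF integrand_s_hermitian_L2 remainder_hermitian_L2[OF \<rho>(1)], of 1 z u "\<rho> powr (\<kappa> - h z)" z u for u, folded modulate_rescaled_increment[OF \<rho>(1)], folded G_def]
    show ?thesis
    proof (rule process_law_W_eqI[OF GW(1) MW(1)])
      show "AE \<omega> in P. ?Z \<rho> u \<omega> = W (G u) \<omega>" for u
        using AEZ[of \<rho> u] GW(2)[of u] by eventually_elim (simp add: powr_minus divide_inverse algebra_simps)
      show "AE \<omega> in P. ?V \<rho> u \<omega> = W (modulate \<rho> z (G u)) \<omega>" for u
        using continuous_modificationD(2)[OF Y', of u] continuous_modificationD(2)[OF T[OF \<rho>], of u] MW(2)[of u] by eventually_elim simp
      show "(LINT \<xi>|lborel. G u \<xi> * cnj (G v \<xi>)) = (LINT \<xi>|lborel. modulate \<rho> z (G u) \<xi> * cnj (modulate \<rho> z (G v) \<xi>))" for u v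
        by (rule integral_modulate[symmetric, OF \<rho>(1) hermitian_L2_D(1)[OF GW(1)] hermitian_L2_D(1)[OF GW(1)]])
    qed measurable
  qed
  show ?thesis
    unfolding rescaled_increments_converge_def weakly_converges_def X_eq Y_eq
  proof (intro exI[of _ ?Z] exI[of _ Y'] conjI allI impI)
    have mZ: "?Z \<rho> u \<in> borel_measurable P" for \<rho> u by measurable
    show "\<forall>\<^sub>F \<rho> in at_right 0. continuous_modification P (\<lambda>u \<omega>. (W (integrand (s (z + \<rho> *\<^sub>R u)) (z + \<rho> *\<^sub>R u)) \<omega> - W (integrand (s z) z) \<omega>) / \<rho> powr h z) (?Z \<rho>)"
      unfolding continuous_modification_def
      by (rule always_eventually, rule allI, rule conjI, rule allI, rule conjI, rule mZ, rule AEZ, rule ballI, rule cZ)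
    show "continuous_modification P (\<lambda>u. W (integrand (s z) u)) Y'" by (rule Y')
    fix \<Phi> :: "(real ^ 2 \<Rightarrow> real) \<Rightarrow> real"
    assume "continuous_map compact_open euclideanreal \<Phi> \<and> bounded (\<Phi> ` topspace compact_open)"
    then have \<Phi>: "continuous_map compact_open euclideanreal \<Phi>" and bd: "bounded (\<Phi> ` topspace compact_open)" by auto
    have "((\<lambda>\<rho>. LINT \<omega>|P. \<Phi> (\<lambda>u. ?V \<rho> u \<omega>)) \<longlongrightarrow> (LINT \<omega>|P. \<Phi> (\<lambda>u. Y' u \<omega>))) (at_right 0)"
    proof (rule tendsto_perturbed_functional[OF \<Phi> bd continuous_modificationD(1)[OF Y'] continuous_modificationD(3)[OF Y'] _ _ TB])
      show "0 < \<kappa> - h z" using \<gamma>(4) h_bounds(4)[of z] by linarith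
      show "T \<rho> u \<in> borel_measurable P" if "0 < \<rho>" "\<rho> \<le> 1" for \<rho> u by (rule continuous_modificationD(1)[OF T[OF that]])
      show "continuous_on UNIV (\<lambda>u. T \<rho> u \<omega>)" if "0 < \<rho>" "\<rho> \<le> 1" "\<omega> \<in> space P" for \<rho> \<omega>
        by (rule continuous_modificationD(3)[OF T[OF that(1,2)] that(3)])
    qed
    moreover have "\<forall>\<^sub>F \<rho> in at_right (0::real). (LINT \<omega>|P. \<Phi> (\<lambda>u. ?V \<rho> u \<omega>)) = (LINT \<omega>|P. \<Phi> (\<lambda>u. ?Z \<rho> u \<omega>))"
    proof -
      have "(LINT \<omega>|P. \<Phi> (\<lambda>u. ?V \<rho> u \<omega>)) = (LINT \<omega>|P. \<Phi> (\<lambda>u. ?Z \<rho> u \<omega>))" if \<rho>: "0 < \<rho>" "\<rho> < 1" for \<rho>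
      proof (rule integral_path_functional_eqI[OF prob_space_axioms prob_space_axioms \<Phi> bd _ _ _ cZ])
        have \<rho>': "\<rho> \<le> 1" using \<rho> by simp
        note [measurable] = continuous_modificationD(1)[OF T[OF \<rho>(1) \<rho>']]
        show "?V \<rho> u \<in> borel_measurable P" for u by measurable
        show "?Z \<rho> u \<in> borel_measurable P" for u by measurable
        show "continuous_on UNIV (\<lambda>u. ?V \<rho> u \<omega>)" if "\<omega> \<in> space P" for \<omega>
          by (intro continuous_intros continuous_modificationD(3)[OF Y' that] continuous_modificationD(3)[OF T[OF \<rho>(1) \<rho>'] that])
        show "process_law P (?V \<rho>) = process_law P (?Z \<rho>)" using law[OF \<rho>(1) \<rho>'] by simp
      qed
      then show ?thesis by (auto simp: eventually_at_right_field intro!: exI[of _ 1])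
    qed
    ultimately show "((\<lambda>\<rho>. LINT \<omega>|P. \<Phi> (\<lambda>u. ?Z \<rho> u \<omega>)) \<longlongrightarrow> (LINT \<omega>|P. \<Phi> (\<lambda>u. Y' u \<omega>))) (at_right 0)"
      by (rule Lim_transform_eventually)
  qed
qed

section \<open>Structure of the tangent field: self-similarity, stationary increments, spectral
  density, non-triviality\<close>

lemma gaussian_tangent: "gaussian_process P UNIV (harmonizable W (s z))"
  unfolding gaussian_process_def harmonizable_integrand
  by (intro allI impI gaussian_lincomb integrand_s_hermitian_L2) auto

lemma self_similar_tangent: "self_similar P (h z) (harmonizable W (s z))"
  unfolding self_similar_def harmonizable_integrand
proof (intro allI impI)
  fix \<rho> :: real assume \<rho>: "0 < \<rho>"
  note [measurable] = measurable_W[OF integrand_s_hermitian_L2]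
  \<comment> \<open>The summand with coefficient 0 is a dummy that brings the scalar multiple into
    the shape of \<open>W_lincomb2\<close>.\<close>
  have mod: "modulate \<rho> 0 (integrand (s z) (\<rho> *\<^sub>R u)) = (\<lambda>\<xi>. of_real (\<rho> powr h z) * integrand (s z) u \<xi> + of_real 0 * integrand (s z) u \<xi>)" for u
  proof
    fix \<xi> :: "real ^ 2"
    have "\<rho> powr (h z + 1) / \<rho> = \<rho> powr h z" using \<rho> by (simp add: powr_add)
    then have p: "complex_of_real (\<rho> powr (h z + 1)) / of_real \<rho> = of_real (\<rho> powr h z)" by (simp flip: of_real_divide)
    have "modulate \<rho> 0 (integrand (s z) (\<rho> *\<^sub>R u)) \<xi> = (exp (\<i> * of_real (u \<bullet> \<xi>)) - 1) * of_real (s z \<xi>) * (complex_of_real (\<rho> powr (h z + 1)) / of_real \<rho>)"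
    proof -
      have e: "(\<rho> *\<^sub>R u) \<bullet> (\<xi> /\<^sub>R \<rho>) = u \<bullet> \<xi>" using \<rho> by simp
      show ?thesis unfolding modulate_def integrand_def s_dilate[OF \<rho>] e by simp
    qed
    then show "modulate \<rho> 0 (integrand (s z) (\<rho> *\<^sub>R u)) \<xi> = of_real (\<rho> powr h z) * integrand (s z) u \<xi> + of_real 0 * integrand (s z) u \<xi>"
      unfolding p by (simp add: integrand_def)
  qed
  note MW = W_lincomb2[OF integrand_s_hermitian_L2 integrand_s_hermitian_L2, of "\<rho> powr h z" z u 0 z u for u, folded mod]
  show "process_law P (\<lambda>u. W (integrand (s z) (\<rho> *\<^sub>R u))) = process_law P (\<lambda>u \<omega>. \<rho> powr h z * W (integrand (s z) u) \<omega>)"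
  proof (rule process_law_W_eqI[OF integrand_s_hermitian_L2 MW(1)])
    show "AE \<omega> in P. \<rho> powr h z * W (integrand (s z) u) \<omega> = W (modulate \<rho> 0 (integrand (s z) (\<rho> *\<^sub>R u))) \<omega>" for u
      using MW(2)[of u] by eventually_elim simp
    show "(LINT \<xi>|lborel. integrand (s z) (\<rho> *\<^sub>R u) \<xi> * cnj (integrand (s z) (\<rho> *\<^sub>R v) \<xi>)) =
      (LINT \<xi>|lborel. modulate \<rho> 0 (integrand (s z) (\<rho> *\<^sub>R u)) \<xi> * cnj (modulate \<rho> 0 (integrand (s z) (\<rho> *\<^sub>R v)) \<xi>))" for u v
      by (rule integral_modulate[symmetric, OF \<rho>]) measurable
    show "W (integrand (s z) (\<rho> *\<^sub>R u)) \<in> borel_measurable P" "(\<lambda>\<omega>. \<rho> powr h z * W (integrand (s z) u) \<omega>) \<in> borel_measurable P" for u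
      using measurable_W[OF integrand_s_hermitian_L2] by (auto intro: borel_measurable_times)
  qed (rule AE_I2, rule refl)
qed

text \<open>Modulation by \<open>y\<close> without dilation maps the increment of the integrand from
  \<open>y\<close> to \<open>y + u\<close> onto the integrand at \<open>u\<close>, and it is
  unitary. The value at the origin is almost surely 0.\<close>

lemma stationary_increments_tangent: "stationary_increments P (harmonizable W (s z))"
  unfolding stationary_increments_def harmonizable_integrand
proof
  fix y :: "real ^ 2"
  note [measurable] = measurable_W[OF integrand_s_hermitian_L2]
  let ?G = "\<lambda>u \<xi>. of_real 1 * integrand (s z) (y + u) \<xi> + of_real (-1) * integrand (s z) y \<xi>"
  have mod: "modulate 1 y (?G u) = integrand (s z) u" for u
  proof
    fix \<xi> :: "real ^ 2"
    have "exp (- (\<i> * of_real (y \<bullet> \<xi>))) * exp (\<i> * of_real ((y + u) \<bullet> \<xi>)) = exp (\<i> * of_real (u \<bullet> \<xi>))"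
      "exp (- (\<i> * of_real (y \<bullet> \<xi>))) * exp (\<i> * of_real (y \<bullet> \<xi>)) = 1"
      by (simp_all add: inner_add_left algebra_simps flip: exp_add)
    then show "modulate 1 y (?G u) \<xi> = integrand (s z) u \<xi>"
      unfolding modulate_def integrand_def by (simp add: left_diff_distrib right_diff_distrib flip: mult.assoc)
  qed
  note GW = W_lincomb2[OF integrand_s_hermitian_L2 integrand_s_hermitian_L2, of 1 z "y + u" "-1" z y for u]
  show "process_law P (\<lambda>u \<omega>. W (integrand (s z) (y + u)) \<omega> - W (integrand (s z) y) \<omega>) = process_law P (\<lambda>u \<omega>. W (integrand (s z) u) \<omega> - W (integrand (s z) 0) \<omega>)"
  proof (rule process_law_W_eqI[OF GW(1) integrand_s_hermitian_L2])
    show "AE \<omega> in P. W (integrand (s z) (y + u)) \<omega> - W (integrand (s z) y) \<omega> = W (?G u) \<omega>" for u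
      using GW(2)[of u] by eventually_elim simp
    show "AE \<omega> in P. W (integrand (s z) u) \<omega> - W (integrand (s z) 0) \<omega> = W (integrand (s z) u) \<omega>" for u
      unfolding integrand_0 using W_zero by eventually_elim simp
    show "(LINT \<xi>|lborel. ?G u \<xi> * cnj (?G v \<xi>)) = (LINT \<xi>|lborel. integrand (s z) u \<xi> * cnj (integrand (s z) v \<xi>))" for u v
      using integral_modulate[OF _ hermitian_L2_D(1)[OF GW(1)[of u]] hermitian_L2_D(1)[OF GW(1)[of v]], of 1 y] unfolding mod by simp
  qed measurable
qed

lemma spectral_density_tangent: "spectral_density P (harmonizable W (s z)) (\<lambda>\<xi>. (s z \<xi>)\<^sup>2)"
  unfolding spectral_density_def harmonizable_integrand
proof (intro conjI allI)
  fix x y :: "real ^ 2"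
  have eq: "(exp (\<i> * of_real (x \<bullet> \<xi>)) - 1) * (exp (- (\<i> * of_real (y \<bullet> \<xi>))) - 1) * of_real ((s z \<xi>)\<^sup>2) = integrand (s z) x \<xi> * cnj (integrand (s z) y \<xi>)" for \<xi>
    by (simp add: integrand_def exp_cnj power2_eq_square)
  show "integrable P (\<lambda>\<omega>. W (integrand (s z) x) \<omega> * W (integrand (s z) y) \<omega>)"
    by (intro integrable_W_prod integrand_s_hermitian_L2)
  show "integrable lborel (\<lambda>\<xi>. (exp (\<i> * of_real (x \<bullet> \<xi>)) - 1) * (exp (- (\<i> * of_real (y \<bullet> \<xi>))) - 1) * of_real ((s z \<xi>)\<^sup>2))"
    unfolding eq by (intro hermitian_L2_integrable_prod integrand_s_hermitian_L2)
  show "complex_of_real (LINT \<omega>|P. W (integrand (s z) x) \<omega> * W (integrand (s z) y) \<omega>) =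
     (LINT \<xi>|lborel. (exp (\<i> * of_real (x \<bullet> \<xi>)) - 1) * (exp (- (\<i> * of_real (y \<bullet> \<xi>))) - 1) * of_real ((s z \<xi>)\<^sup>2))"
    unfolding eq by (intro isometry integrand_s_hermitian_L2)
qed auto

theorem anisotropy_function_tangent:
  "anisotropy_function P (h z) (harmonizable W (s z)) (\<lambda>\<Theta>. (C z \<Theta>)\<^sup>2)"
  unfolding anisotropy_function_def
proof (intro conjI exI[of _ "\<lambda>\<xi>. (s z \<xi>)\<^sup>2"] allI impI gaussian_tangent self_similar_tangent stationary_increments_tangent spectral_density_tangent)
  fix \<xi> :: "real ^ 2" assume "\<xi> \<noteq> 0"
  then have "C z (\<xi> /\<^sub>R norm \<xi>) = C z \<xi>" by (intro C_homogeneous) simp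
  moreover have "(norm \<xi> powr (- (h z + 1)))\<^sup>2 = norm \<xi> powr (- 2 * h z - 2)"
    by (simp only: power2_eq_square powr_add[symmetric]) (rule arg_cong[where f="\<lambda>t. norm \<xi> powr t"], simp)
  ultimately show "(s z \<xi>)\<^sup>2 = norm \<xi> powr (- 2 * h z - 2) * (C z (\<xi> /\<^sub>R norm \<xi>))\<^sup>2"
    unfolding s_eq power_mult_distrib by simp
qed

text \<open>If the field vanished, the isometry would make every integrand zero almost everywhere,
  and \<open>C z\<close> with it wherever the exponential factor is nonzero.\<close>

theorem nontrivial_tangent:
  assumes "\<not> (AE \<xi> in lborel. C z \<xi> = 0)"
  shows "nontrivial_field P (harmonizable W (s z))"
proof (rule ccontr)
  assume "\<not> ?thesis"
  then have Y0: "AE \<omega> in P. W (integrand (s z) u) \<omega> = 0" for u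
    by (simp add: nontrivial_field_def harmonizable_integrand)
  have K0: "AE \<xi> in lborel. integrand (s z) u \<xi> = 0" for u
  proof -
    have "complex_of_real (expectation (\<lambda>\<omega>. W (integrand (s z) u) \<omega> * W (integrand (s z) u) \<omega>)) = 0"
      using Y0[of u] by (subst integral_eq_zero_AE) auto
    then have "(LINT \<xi>|lborel. complex_of_real ((cmod (integrand (s z) u \<xi>))\<^sup>2)) = 0"
      unfolding complex_norm_square by (subst (asm) isometry) (auto intro: integrand_s_hermitian_L2)
    then have "(LINT \<xi>|lborel. (cmod (integrand (s z) u \<xi>))\<^sup>2) = 0"
      by (simp only: integral_complex_of_real of_real_eq_0_iff)
    then have "AE \<xi> in lborel. (cmod (integrand (s z) u \<xi>))\<^sup>2 = 0"
      by (subst (asm) integral_nonneg_eq_0_iff_AE) (auto intro: hermitian_L2_D(2) integrand_s_hermitian_L2)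
    then show ?thesis by simp
  qed
  \<comment> \<open>Countably many points \<open>u\<close> admit a common null set, and they
    suffice: for a nonzero frequency some coordinate divided by a large \<open>Suc n\<close> is a
    nonzero angle below 1, whose exponential is not 1.\<close>
  have "AE \<xi> in lborel. \<forall>n. \<forall>i. integrand (s z) ((1 / real (Suc n)) *\<^sub>R axis i 1) \<xi> = 0"
    unfolding AE_all_countable using K0 by blast
  moreover have "AE \<xi> in lborel. \<xi> \<noteq> (0 :: real ^ 2)" by (rule AE_lborel_singleton)
  ultimately have "AE \<xi> in lborel. C z \<xi> = 0"
  proof eventually_elim
    case (elim \<xi>)
    from elim(2) obtain i where i: "\<xi> $ i \<noteq> 0" by (auto simp: vec_eq_iff)
    obtain n :: nat where n: "\<bar>\<xi> $ i\<bar> < real n" using reals_Archimedean2 by blast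
    define t where "t = \<xi> $ i / real (Suc n)"
    have t: "t \<noteq> 0" "\<bar>t\<bar> < 1" using i n by (auto simp: t_def abs_divide pos_divide_less_eq)
    have "exp (\<i> * of_real t) \<noteq> 1"
    proof
      assume "exp (\<i> * of_real t) = 1"
      then obtain m :: int where m: "t = of_int (2 * m) * pi" by (auto simp: exp_eq_1)
      then have "m \<noteq> 0" using t(1) by auto
      then have "1 \<le> \<bar>real_of_int m\<bar>" by linarith
      then have "2 * pi * 1 \<le> 2 * pi * \<bar>real_of_int m\<bar>" by (intro mult_left_mono) auto
      also have "\<dots> = \<bar>t\<bar>" unfolding m by (simp add: abs_mult)
      finally show False using t(2) pi_gt3 by linarith
    qed
    moreover have "integrand (s z) ((1 / real (Suc n)) *\<^sub>R axis i 1) \<xi> = 0" using elim(1) by blast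
    ultimately have "s z \<xi> = 0"
      by (simp add: integrand_def inner_axis' t_def)
    then show ?case unfolding s_eq using elim(2) by simp
  qed
  then show False using assms by simp
qed

end

text \<open>If \<open>C x\<^sub>0\<close> vanishes almost everywhere, the limit field is the zero
  field, which is excluded as a tangent field by non-triviality. Convergence and the form of the
  spectral density persist in that case, so only the two assertions built on
  \<open>localizable_at\<close> carry a proviso.\<close>

theorem theorem3:
  fixes P :: "'w measure" and W :: "(real ^ 2 \<Rightarrow> complex) \<Rightarrow> 'w \<Rightarrow> real"
    and h :: "real ^ 2 \<Rightarrow> real" and C :: "real ^ 2 \<Rightarrow> real ^ 2 \<Rightarrow> real"
    and \<beta> \<Lambda> M \<eta> :: real and A :: "real ^ 2 \<Rightarrow> real"
  assumes noise: "fourier_white_noise P W"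
    and h_range: "\<And>x. h x \<in> {0..1}"
    and h_hoelder: "\<And>x y. \<bar>h x - h y\<bar> \<le> \<Lambda> * norm (x - y) powr \<beta>"
    and h_inf: "0 < (INF x. h x)"
    and h_sup: "(SUP x. h x) < 1" "(SUP x. h x) < \<beta>" "\<beta> \<le> 1"
    and C_nonneg: "\<And>x \<xi>. 0 \<le> C x \<xi>"
    and C_measurable: "\<And>x. C x \<in> borel_measurable borel"
    and C_bounded: "\<And>x \<xi>. C x \<xi> \<le> M"
    and C_even: "\<And>x \<xi>. C x (- \<xi>) = C x \<xi>"
    and C_homogeneous: "\<And>x \<xi> \<rho>. 0 < \<rho> \<Longrightarrow> C x (\<rho> *\<^sub>R \<xi>) = C x \<xi>"
    and C_continuous: "\<And>\<xi>. continuous_on UNIV (\<lambda>x. C x \<xi>)"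
    and \<eta>: "(SUP x. h x) < \<eta>" "\<eta> \<le> 1"
    and C_increments: "\<And>x z. z \<in> ball 0 1 \<Longrightarrow>
      norm z powr (- 2 * \<eta>) * (LINT \<Theta>|arc_length. (C (x + z) \<Theta> - C x \<Theta>)\<^sup>2) \<le> A x"
    and A_bounded: "\<And>K. compact K \<Longrightarrow> bounded (A ` K)"
  shows "\<forall>x\<^sub>0. let X = gafbf W h C; Y = harmonizable W (sqrt_density h C x\<^sub>0) in
    rescaled_increments_converge P X x\<^sub>0 (h x\<^sub>0) P Y \<and>
    anisotropy_function P (h x\<^sub>0) Y (\<lambda>\<Theta>. (C x\<^sub>0 \<Theta>)\<^sup>2) \<and>
    (\<not> (AE \<xi> in lborel. C x\<^sub>0 \<xi> = 0) \<longrightarrow>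
       localizable_at P X x\<^sub>0 (h x\<^sub>0) P Y \<and>
       local_anisotropy_function P X x\<^sub>0 (\<lambda>\<Theta>. (C x\<^sub>0 \<Theta>)\<^sup>2))"
proof
  fix z :: "real ^ 2"
  \<comment> \<open>The real-valued \<open>INF\<close> and \<open>SUP\<close> bound \<open>h\<close>
    only once its range is known to be bounded; then they can play the roles of \<open>a\<close> and
    \<open>b\<close>.\<close>
  have bdd: "bdd_below (range h)" "bdd_above (range h)"
    using h_range by (auto intro!: bdd_belowI[of _ 0] bdd_aboveI[of _ 1])
  interpret noise: fourier_white_noise P W by (rule noise)
  interpret gafbf_field P W h C "INF x. h x" "SUP x. h x" \<beta> \<Lambda> M \<eta> A
  proof unfold_locales
    show "(INF x. h x) \<le> h x" for x using bdd by (intro cINF_lower) auto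
    show "h x \<le> (SUP x. h x)" for x using bdd by (intro cSUP_upper) auto
  qed (fact h_inf h_sup \<eta> h_hoelder C_nonneg C_measurable C_bounded C_even C_homogeneous C_increments A_bounded)+
  have "0 < h z" "h z < 1" using h_bounds(1,2) h_bounds(3,4)[of z] by linarith+
  then have "localizable_at P (gafbf W h C) z (h z) P (harmonizable W (sqrt_density h C z))"
    if "\<not> (AE \<xi> in lborel. C z \<xi> = 0)"
    unfolding localizable_at_def
    using nontrivial_tangent[OF that] rescaled_increments_converge_gafbf by simp
  then show "let X = gafbf W h C; Y = harmonizable W (sqrt_density h C z) in
    rescaled_increments_converge P X z (h z) P Y \<and>
    anisotropy_function P (h z) Y (\<lambda>\<Theta>. (C z \<Theta>)\<^sup>2) \<and>
    (\<not> (AE \<xi> in lborel. C z \<xi> = 0) \<longrightarrow>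
       localizable_at P X z (h z) P Y \<and>
       local_anisotropy_function P X z (\<lambda>\<Theta>. (C z \<Theta>)\<^sup>2))"
    unfolding Let_def local_anisotropy_function_def
    using rescaled_increments_converge_gafbf anisotropy_function_tangent by blast
qed

end
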